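(* For any $D\ge 2$, $d\in\{1,\dots,D\}$ and $r_0>2$, we have $\lambda^*_{d,r_0} < \lambda^{\mathrm{face}}_d$.
   Context: Let $X$ be a homogeneous Poisson point process on $\mathbb{R}^D$ of intensity $\lambda>0$ under $\mathbb{P}_\lambda$. For a discrete set $\Lambda$ (a.s. in general position), $\mathscr{S}_d(\Lambda)$ is the set of $d$-simplices $\mathrm{ConvexHull}(\{x_1,\dots,x_{d+1}\})$ with $x_i\in\Lambda$ distinct and $|x_i-x_j|\le1$ for all $i,j$. Two $d$-simplices are adjacent if they share a face (convex hull of $d$ of the vertices). $\lambda^{\mathrm{face}}_d$ is the infimum of $\lambda$ for which, with positive probability, $\mathscr{S}_d(X)$ contains an infinite path of adjacent $d$-simplices. Two $d$-simplices of $\mathscr{S}_d(X)$ are $*$-adjacent with range $r_0$ if their Euclidean distance (as subsets of $\mathbb{R}^D$) is at most $r_0$. There is $*$-percolation with range $r_0$ of $d$-simplices if there is an infinite sequence $\sigma_1,\sigma_2,\dots$ of distinct simplices of $\mathscr{S}_d(X)$ with $\sigma_i,\sigma_{i+1}$ $*$-adjacent with range $r_0$ for all $i$; $\lambda^*_{d,r_0}$ is the infimum of $\lambda>0$ for which this has positive probability. *)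

theory Defs
  imports "HOL-Analysis.Analysis" "HOL-Probability.Probability"
begin

text \<open>Homogeneous Poisson point process of intensity lam on real^'n, given by its law
  P on the configuration space (sets of points).  The sample point is the configuration.\<close>
definition is_PPP :: "(real^'n) set measure \<Rightarrow> real \<Rightarrow> bool" where
  "is_PPP P lam \<longleftrightarrow> prob_space P \<and>
     (\<forall>A \<in> sets lborel. bounded A \<longrightarrow>
        (\<forall>\<omega>\<in>space P. finite (\<omega> \<inter> A)) \<and>
        (\<lambda>\<omega>. card (\<omega> \<inter> A)) \<in> measurable P (count_space UNIV) \<and>
        (\<forall>k::nat. measure P {\<omega>\<in>space P. card (\<omega> \<inter> A) = k} =
           (lam * measure lborel A) ^ k / fact k * exp (- (lam * measure lborel A)))) \<and>
     (\<forall>(I::nat set) (A::nat \<Rightarrow> (real^'n) set). finite I \<longrightarrow>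
        (\<forall>i\<in>I. A i \<in> sets lborel \<and> bounded (A i)) \<longrightarrow> disjoint_family_on A I \<longrightarrow>
        prob_space.indep_vars P (\<lambda>_. count_space UNIV) (\<lambda>i \<omega>. card (\<omega> \<inter> A i)) I)"

definition simplex_verts :: "nat \<Rightarrow> (real^'n) set \<Rightarrow> (real^'n) set \<Rightarrow> bool" where
  "simplex_verts d \<Lambda> V \<longleftrightarrow> V \<subseteq> \<Lambda> \<and> finite V \<and> card V = d + 1 \<and>
     (\<forall>x\<in>V. \<forall>y\<in>V. dist x y \<le> 1)"

definition simplices :: "nat \<Rightarrow> (real^'n) set \<Rightarrow> (real^'n) set set" where
  "simplices d \<Lambda> = {convex hull V | V. simplex_verts d \<Lambda> V}"

definition face_adj :: "nat \<Rightarrow> (real^'n) set \<Rightarrow> (real^'n) set \<Rightarrow> (real^'n) set \<Rightarrow> bool" where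
  "face_adj d \<Lambda> \<sigma> \<tau> \<longleftrightarrow> (\<exists>V W F G. simplex_verts d \<Lambda> V \<and> simplex_verts d \<Lambda> W \<and>
     \<sigma> = convex hull V \<and> \<tau> = convex hull W \<and> F \<subseteq> V \<and> G \<subseteq> W \<and>
     card F = d \<and> card G = d \<and> convex hull F = convex hull G)"

definition face_percolates :: "nat \<Rightarrow> (real^'n) set \<Rightarrow> bool" where
  "face_percolates d \<Lambda> \<longleftrightarrow> (\<exists>s :: nat \<Rightarrow> (real^'n) set. inj s \<and>
     (\<forall>i. s i \<in> simplices d \<Lambda> \<and> face_adj d \<Lambda> (s i) (s (Suc i))))"

definition star_percolates :: "nat \<Rightarrow> real \<Rightarrow> (real^'n) set \<Rightarrow> bool" where
  "star_percolates d r0 \<Lambda> \<longleftrightarrow> (\<exists>s :: nat \<Rightarrow> (real^'n) set. inj s \<and>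
     (\<forall>i. s i \<in> simplices d \<Lambda> \<and> setdist (s i) (s (Suc i)) \<le> r0))"

definition lambda_face :: "'n::finite itself \<Rightarrow> nat \<Rightarrow> ereal" where
  "lambda_face _ d = Inf {ereal lam | lam. lam > 0 \<and>
     (\<exists>P :: (real^'n) set measure. is_PPP P lam \<and>
        measure P {\<Lambda> \<in> space P. face_percolates d \<Lambda>} > 0)}"

definition lambda_star :: "'n::finite itself \<Rightarrow> nat \<Rightarrow> real \<Rightarrow> ereal" where
  "lambda_star _ d r0 = Inf {ereal lam | lam. lam > 0 \<and>
     (\<exists>P :: (real^'n) set measure. is_PPP P lam \<and>
        measure P {\<Lambda> \<in> space P. star_percolates d r0 \<Lambda>} > 0)}"

end

theory Submission
  imports Defs
begin

text \<open>Enhancement by erasure. Cut space into cubes of side \<open>s\<close> and let \<open>\<omega>\<close> be a configuration with a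
  long face path. A face path moves by steps of length at most 1, so if a sparse family of cubes (no two
  of them meeting points at distance at most 2) is emptied, each gap left in the path can still be
  jumped by a \<open>*\<close>-step of range \<open>2 + 3 s D\<close>, which is at most \<open>r0\<close> for small \<open>s\<close>. Weight a
  configuration by the number of sparse families of cubes avoiding it. An empty cube
  allows more families, so under the weighted law, given the rest, each cube is empty with a
  conditional probability that exceeds the Poisson value \<open>\<kappa>\<close> by a uniform factor, depending on the number
  \<open>K\<close> of cubes in conflict with it. As \<open>*\<close>-connection through
  a cube can be certified by boundedly many of its points, this gain compensates for an
  intensity lowered by a factor close to 1: the weighted law at \<open>lam\<close>, hence every erased face path
  at \<open>lam\<close>, is dominated for \<open>*\<close>-connection by the Poisson law at some \<open>lam' < lam\<close>. The comparison is
  made for the occupied cells of a fine mesh and passes to the limit.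

  It remains to see that the critical values are not degenerate. The face value is positive by
  counting paths of occupied cubes, and the \<open>*\<close> value is finite by a Peierls argument in a planar
  layer of cubes. The infima are over intensities admitting a process with the given properties, so the existence
  of the Poisson process at the lower intensity is needed too; its joint law is read off from
  probability generating functions.\<close>

section \<open>Paths and planar contours\<close>

text \<open>Lowering the intensity by a factor \<open>q\<close> keeps a certificate of
  \<open>k\<close> occupied cells with probability \<open>q ^ k\<close>. Without a bound on
  \<open>k\<close> this loss would grow with the mesh, and no fixed gain could pay for it. Hence the
  comparison runs through \<open>good\<close> blocks, whose crossings have certificates of bounded
  size in each block, and not through simplices directly. The number of conflicts, the size of
  certificates and the lower bound for the emptiness probability depend on the block side and the
  intensity, not on the mesh or the window, so one \<open>q\<close> serves every finite inequality
  and survives both limits. The gain is uniform for intensities in \<open>[l, t * l)\<close>, where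
  \<open>l\<close> is the infimum for faces. Such an intensity with face percolation yields star
  percolation at \<open>l / t\<close>, strictly below \<open>l\<close>; whether \<open>l\<close> is
  attained does not matter. This needs \<open>l > 0\<close>. If no intensity gives face percolation,
  the face value is infinite, and then finiteness of the star value decides.\<close>

lemma koenig_path:
  fixes r :: "('a \<times> 'a) set"
  assumes fin: "\<And>x. finite (r `` {x})" and inf: "infinite (r\<^sup>* `` {x0})"
  shows "\<exists>f::nat \<Rightarrow> 'a. inj f \<and> f 0 = x0 \<and> (\<forall>i. (f i, f (Suc i)) \<in> r)"
proof -
  define d where "d y = (LEAST n. (x0, y) \<in> r ^^ n)" for y
  \<comment> \<open>The vertices that some shortest path from \<open>x0\<close> reaches through
    \<open>y\<close>. Following shortest paths makes \<open>d\<close> grow by 1 along the selected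
    branch, so injectivity comes for free.\<close>
  define D where "D y = {z. (x0, z) \<in> r\<^sup>* \<and> d y \<le> d z \<and> (y, z) \<in> r ^^ (d z - d y)}" for y
  have d_in: "(x0, y) \<in> r ^^ d y" if "(x0, y) \<in> r\<^sup>*" for y
    using that unfolding d_def rtrancl_power by (rule LeastI_ex)
  have d_le: "d y \<le> n" if "(x0, y) \<in> r ^^ n" for y n
    using that unfolding d_def by (rule Least_le)
  have d0: "d x0 = 0" using d_le[of x0 0] by simp
  have D0: "D x0 = r\<^sup>* `` {x0}" using d_in by (auto simp: D_def d0)
  have step: "\<exists>y'. ((x0, y') \<in> r\<^sup>* \<and> infinite (D y') \<and> d y' = Suc n) \<and> (y, y') \<in> r"
    if y: "(x0, y) \<in> r\<^sup>* \<and> infinite (D y) \<and> d y = n" for y n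
  proof -
    let ?S = "{y' \<in> r `` {y}. d y' = Suc n}"
    have "D y - {y} \<subseteq> (\<Union>y'\<in>?S. D y')"
    proof
      fix z assume z: "z \<in> D y - {y}"
      obtain k where k: "d z - d y = Suc k"
        using z by (cases "d z - d y") (auto simp: D_def)
      have "(y, z) \<in> r ^^ Suc k" using z k by (auto simp: D_def)
      then obtain y' where y': "(y, y') \<in> r" "(y', z) \<in> r ^^ k" by (meson relpow_Suc_D2)
      have "(x0, y') \<in> r ^^ Suc (d y)" using d_in[of y] y y'(1) by auto
      then have le: "d y' \<le> Suc (d y)" by (rule d_le)
      have rch: "(x0, y') \<in> r\<^sup>*" using y y'(1) by (meson rtrancl.rtrancl_into_rtrancl)
      have "(x0, z) \<in> r ^^ (d y' + k)" using d_in[OF rch] y'(2) by (auto simp: relpow_add)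
      then have "d z \<le> d y' + k" by (rule d_le)
      with k le have eq: "d y' = Suc (d y)" "k = d z - d y'" "d y' \<le> d z" by auto
      have "z \<in> D y'" using z y'(2) eq by (auto simp: D_def)
      then show "z \<in> (\<Union>y'\<in>?S. D y')" using y'(1) eq(1) y by auto
    qed
    moreover have "infinite (D y - {y})" using y by simp
    ultimately have "infinite (\<Union>y'\<in>?S. D y')" by (meson finite_subset)
    moreover have "finite ?S" by (rule finite_subset[OF _ fin[of y]]) auto
    ultimately obtain y' where "y' \<in> ?S" "infinite (D y')" by auto
    moreover have "(x0, y') \<in> r\<^sup>*"
      using calculation y by (auto intro: rtrancl.rtrancl_into_rtrancl)
    ultimately show ?thesis by auto
  qed
  have "\<exists>f. \<forall>n. ((x0, f n) \<in> r\<^sup>* \<and> infinite (D (f n)) \<and> d (f n) = n) \<and> (f n, f (Suc n)) \<in> r"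
    by (rule dependent_nat_choice) (use step D0 d0 inf in auto)
  then obtain f where f: "\<And>n. d (f n) = n" "\<And>n. (f n, f (Suc n)) \<in> r"
    "(x0, f 0) \<in> r\<^sup>*" by blast
  have "f 0 = x0" using d_in[OF f(3)] f(1)[of 0] by simp
  moreover have "inj f" using f(1) by (metis injI)
  ultimately show ?thesis using f(2) by blast
qed

lemma rtrancl_distinct_path:
  assumes "(a, b) \<in> r\<^sup>*"
  shows "\<exists>xs. xs \<noteq> [] \<and> hd xs = a \<and> last xs = b \<and> distinct xs \<and>
    successively (\<lambda>x y. (x, y) \<in> r) xs"
  using assms
proof (induction rule: rtrancl_induct)
  case base
  show ?case by (rule exI[of _ "[a]"]) simp
next
  case (step y z)
  then obtain xs where xs: "xs \<noteq> []" "hd xs = a" "last xs = y" "distinct xs"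
    "successively (\<lambda>x y. (x, y) \<in> r) xs" by blast
  show ?case
  proof (cases "z \<in> set xs")
    case True
    then obtain us vs where uv: "xs = us @ z # vs" by (meson split_list)
    have "successively (\<lambda>x y. (x, y) \<in> r) (us @ [z])"
      using xs(5) unfolding uv by (auto simp: successively_append_iff)
    moreover have "hd (us @ [z]) = a" using xs(2) unfolding uv by (cases us) auto
    ultimately show ?thesis using xs(4) unfolding uv
      by (intro exI[of _ "us @ [z]"]) auto
  next
    case False
    then show ?thesis using xs step(2)
      by (intro exI[of _ "xs @ [z]"]) (auto simp: successively_append_iff)
  qed
qed

primrec walks :: "('a \<Rightarrow> 'a set) \<Rightarrow> nat \<Rightarrow> 'a \<Rightarrow> 'a list set" where
  "walks nb 0 a = {[a]}"
| "walks nb (Suc l) a = (\<Union>b\<in>nb a. (#) a ` walks nb l b)"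

lemma finite_walks: "(\<And>a. finite (nb a)) \<Longrightarrow> finite (walks nb l a)"
  by (induction l arbitrary: a) auto

lemma card_walks:
  assumes "\<And>a. finite (nb a)" "\<And>a. card (nb a) \<le> K"
  shows "card (walks nb l a) \<le> K ^ l"
proof (induction l arbitrary: a)
  case (Suc l)
  have "card (walks nb (Suc l) a) \<le> (\<Sum>b\<in>nb a. card ((#) a ` walks nb l b))"
    by (simp add: assms(1) card_UN_le)
  also have "\<dots> \<le> (\<Sum>b\<in>nb a. K ^ l)"
    using Suc finite_walks[OF assms(1)] by (intro sum_mono) (meson card_image_le order_trans)
  also have "\<dots> \<le> K * K ^ l" using assms(2)[of a] by simp
  finally show ?case by simp
qed simp

lemma walks_length: "xs \<in> walks nb l a \<Longrightarrow> length xs = Suc l"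
  by (induction l arbitrary: a xs) auto

lemma in_walks:
  "successively (\<lambda>x y. y \<in> nb x) (a # xs) \<Longrightarrow> a # xs \<in> walks nb (length xs) a"
  by (induction xs arbitrary: a) auto

section \<open>Contours of finite clusters in the square lattice\<close>

definition adj4 :: "int \<times> int \<Rightarrow> int \<times> int \<Rightarrow> bool" where
  "adj4 u v \<longleftrightarrow> \<bar>fst u - fst v\<bar> + \<bar>snd u - snd v\<bar> = 1"

definition king :: "int \<times> int \<Rightarrow> int \<times> int \<Rightarrow> bool" where
  "king u v \<longleftrightarrow> \<bar>fst u - fst v\<bar> \<le> 1 \<and> \<bar>snd u - snd v\<bar> \<le> 1"

text \<open>Reflexivity of the closure puts the origin into the cluster even when it is closed; that
  case has to be treated apart.\<close>

definition cluster :: "(int \<times> int) set \<Rightarrow> (int \<times> int) set" where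
  "cluster Op = {(u, v). adj4 u v \<and> u \<in> Op \<and> v \<in> Op}\<^sup>* `` {(0, 0)}"

lemma king_sym: "king u v \<Longrightarrow> king v u"
  by (auto simp: king_def)

lemma adj4_sym: "adj4 u v \<Longrightarrow> adj4 v u"
  by (auto simp: adj4_def)

text \<open>The outer boundary of a finite cluster is connected under king moves. Otherwise let \<open>\<phi>\<close> mark
  the boundary edges at one of its components. Every unit square has an even number of marked
  edges, so \<open>\<phi>\<close> is the coboundary of a potential \<open>\<Psi>\<close>, which counts modulo 2 the marked horizontal
  edges to the right. This \<open>\<Psi>\<close> is constant on the cluster and on the outer region, while \<open>\<phi>\<close> marks
  some but not all edges between them.\<close>

lemma finite_cluster_dual_path:
  assumes O0: "(0, 0) \<in> Op" and fin: "finite (cluster Op)"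
  shows "\<exists>k m. 0 < k \<and> m < 0 \<and> (k, 0) \<notin> Op \<and>
    ((k, 0), (m, 0)) \<in> {(u, v). king u v \<and> u \<notin> Op \<and> v \<notin> Op}\<^sup>*"
proof -
  define C where "C = cluster Op"
  have C0: "(0, 0) \<in> C" by (simp add: C_def cluster_def)
  have CO: "C \<subseteq> Op"
  proof
    fix v assume "v \<in> C"
    then have "((0, 0), v) \<in> {(u, v). adj4 u v \<and> u \<in> Op \<and> v \<in> Op}\<^sup>*" by (simp add: C_def cluster_def)
    then show "v \<in> Op" by (induction rule: rtrancl_induct) (use O0 in auto)
  qed
  have Cstep: "v \<in> C" if "u \<in> C" "adj4 u v" "v \<in> Op" for u v
    using that CO unfolding C_def cluster_def by (auto intro: rtrancl.rtrancl_into_rtrancl)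
  obtain M where M: "\<And>a b. (a, b) \<in> C \<Longrightarrow> \<bar>a\<bar> < M \<and> \<bar>b\<bar> < M"
  proof -
    let ?F = "(\<lambda>(a, b). \<bar>a\<bar> + \<bar>b\<bar>) ` C"
    have "finite ?F" using fin by (simp add: C_def)
    then have "\<bar>a\<bar> + \<bar>b\<bar> \<le> Max ?F" if "(a, b) \<in> C" for a b
      using that by (intro Max_ge) (auto intro: rev_image_eqI)
    then show ?thesis by (intro that[of "Max ?F + 1"]) fastforce
  qed
  define r4 where "r4 = {(u, v). adj4 u v \<and> u \<notin> C \<and> v \<notin> C}"
  \<comment> \<open>The component of the complement that contains a point outside the bounding box:
    the outer region of the cluster.\<close>
  define D where "D = r4\<^sup>* `` {(M, 0)}"
  have M0: "0 < M" using M[OF C0] by simp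
  have DC: "v \<notin> C" if "v \<in> D" for v
  proof -
    have "((M, 0), v) \<in> r4\<^sup>*" using that by (simp add: D_def)
    then show ?thesis by (induction rule: rtrancl_induct) (use M[of M 0] in \<open>auto simp: r4_def\<close>)
  qed
  have Dstep: "v \<in> D" if "u \<in> D" "adj4 u v" "v \<notin> C" for u v
    using that DC[OF that(1)] unfolding D_def
    by (auto simp: r4_def intro: rtrancl.rtrancl_into_rtrancl)
  have segment: "f i \<in> D" if "f lo \<in> D" "lo \<le> i" "i \<le> hi" "\<And>j. adj4 (f j) (f (j + 1))"
    "\<And>j. lo \<le> j \<Longrightarrow> j \<le> hi \<Longrightarrow> f j \<notin> C" for f lo hi and i :: int
    using that(2,3)
  proof (induction i rule: int_ge_induct)
    case base
    then show ?case using that(1) by simp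
  next
    case (step i)
    then show ?case using Dstep[OF _ that(4)[of i]] that(5)[of "i + 1"] by auto
  qed
  define bd where "bd v \<longleftrightarrow> v \<in> D \<and> (\<exists>u\<in>C. adj4 u v)" for v
  have bdO: "v \<notin> Op" if "bd v" for v using that Cstep DC unfolding bd_def by blast
  define A where "A = {a. (a, 0) \<in> C}"
  have finA: "finite A" unfolding A_def
    by (rule finite_subset[of _ "fst ` C"]) (use fin in \<open>auto simp: C_def intro: rev_image_eqI\<close>)
  have A0: "0 \<in> A" using C0 by (simp add: A_def)
  define k where "k = Max A" define m where "m = Min A"
  have km: "k \<in> A" "m \<in> A" "\<And>a. a \<in> A \<Longrightarrow> m \<le> a \<and> a \<le> k"
    using finA A0 unfolding k_def m_def by (auto intro: Max_in Min_in)
  have km0: "0 \<le> k" "m \<le> 0" using km(3)[OF A0] by auto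
  have kM: "k < M" "-M < m" using M[of k 0] M[of m 0] km unfolding A_def by auto
  have v0D: "(k + 1, 0) \<in> D"
  proof -
    \<comment> \<open>\<open>segment\<close> only increases its parameter, so a walk to the left is
      parametrised by \<open>-i\<close>.\<close>
    have "(- (- (k + 1)), 0) \<in> D"
    proof (rule segment[of "\<lambda>i. (-i, 0)" "-M" _ "- (k + 1)"])
      show "(- j, 0) \<notin> C" if "j \<le> - (k + 1)" for j
        using km(3)[of "- j"] that by (auto simp: A_def)
    qed (use kM in \<open>auto simp: D_def adj4_def\<close>)
    then show ?thesis by (simp add: add.commute)
  qed
  \<comment> \<open>The walk follows the bounding box: up its right side, along the top, down the
    left side, then along the axis to the left end of the cluster.\<close>
  have v1D: "(m - 1, 0) \<in> D"
  proof -
    have outside: "(a, b) \<notin> C" if "\<bar>a\<bar> \<ge> M \<or> \<bar>b\<bar> \<ge> M" for a b using M[of a b] that by fastforce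
    have "(M, M) \<in> D"
      by (rule segment[of "\<lambda>i. (M, i)" 0 M M]) (use M0 outside in \<open>auto simp: D_def adj4_def\<close>)
    then have "(- M, M) \<in> D"
      using segment[of "\<lambda>i. (-i, M)" "-M" M M] M0 outside by (auto simp: adj4_def)
    then have "(- M, 0) \<in> D"
      using segment[of "\<lambda>i. (-M, -i)" "-M" 0 0] M0 outside by (auto simp: adj4_def)
    then show ?thesis
    proof (rule segment[of "\<lambda>i. (i, 0)" "-M" _ "m - 1"])
      show "(j, 0) \<notin> C" if "j \<le> m - 1" for j
        using km(3)[of j] that by (auto simp: A_def)
    qed (use kM in \<open>auto simp: adj4_def\<close>)
  qed
  have kmC: "(k, 0) \<in> C" "(m, 0) \<in> C" using km unfolding A_def by auto
  have bd0: "bd (k + 1, 0)" "bd (m - 1, 0)"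
  proof -
    have "adj4 (k, 0) (k + 1, 0)" "adj4 (m, 0) (m - 1, 0)" by (simp_all add: adj4_def)
    then show "bd (k + 1, 0)" "bd (m - 1, 0)"
      unfolding bd_def using v0D v1D kmC by blast+
  qed
  define rk where "rk = {(u, v). king u v \<and> bd u \<and> bd v}"
  define K where "K = rk\<^sup>* `` {(k + 1, 0)}"
  have Kiff: "u \<in> K \<longleftrightarrow> v \<in> K" if "king u v" "bd u" "bd v" for u v
  proof -
    have "king v u" using that(1) by (rule king_sym)
    then have "(u, v) \<in> rk" "(v, u) \<in> rk" using that by (simp_all add: rk_def)
    then show ?thesis unfolding K_def Image_singleton_iff by (meson rtrancl.rtrancl_into_rtrancl)
  qed
  have bdI: "bd u" if "u \<in> D" "v \<notin> D" "adj4 u v" for u v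
    using that Dstep adj4_sym unfolding bd_def by blast
  define \<phi> where "\<phi> u v \<longleftrightarrow> (u \<in> D \<and> v \<notin> D \<and> u \<in> K) \<or> (v \<in> D \<and> u \<notin> D \<and> v \<in> K)" for u v
  have \<phi>C: "u \<in> C \<or> v \<in> C" if "\<phi> u v" "adj4 u v" for u v
    using that Dstep adj4_sym unfolding \<phi>_def by blast
  \<comment> \<open>Any two corners of a unit square are king neighbours, so its boundary sites lie
    all in \<open>K\<close> or all outside. On the square, \<open>\<phi>\<close> is therefore either
    empty or the coboundary of membership in \<open>D\<close>, and both have even sum around
    it.\<close>
  have square: "(\<phi> (a, b) (a + 1, b) \<noteq> \<phi> (a, b + 1) (a + 1, b + 1)) \<longleftrightarrow>
      (\<phi> (a, b) (a, b + 1) \<noteq> \<phi> (a + 1, b) (a + 1, b + 1))" for a b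
  proof -
    define S where "S = {(a, b), (a + 1, b), (a, b + 1), (a + 1, b + 1)}"
    define kk where "kk \<longleftrightarrow> (\<exists>x\<in>S. bd x \<and> x \<in> K)"
    have SK: "x \<in> K \<longleftrightarrow> kk" if "x \<in> S" "bd x" for x
    proof -
      have "king x y" if "y \<in> S" for y using that \<open>x \<in> S\<close> by (auto simp: S_def king_def)
      then show ?thesis unfolding kk_def using that Kiff by blast
    qed
    have "\<phi> u v \<longleftrightarrow> ((u \<in> D) \<noteq> (v \<in> D)) \<and> kk" if "u \<in> S" "v \<in> S" "adj4 u v" for u v
      using SK[OF that(1)] SK[OF that(2)] bdI[of u v] bdI[of v u] adj4_sym[OF that(3)] that(3)
      unfolding \<phi>_def by blast
    then show ?thesis by (simp add: S_def adj4_def) blast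
  qed
  define H where "H a b = {a'. a \<le> a' \<and> \<phi> (a', b) (a' + 1, b)}" for a b
  have HM: "a' < M" if "\<phi> (a', b) (a' + 1, b)" for a' b
    using \<phi>C[OF that] M[of a' b] M[of "a' + 1" b] by (auto simp: adj4_def)
  have finH: "finite (H a b)" for a b
    by (rule finite_subset[of _ "{a..<M}"]) (auto simp: H_def dest: HM)
  define \<Psi> where "\<Psi> u \<longleftrightarrow> odd (card (H (fst u) (snd u)))" for u
  have hor: "\<Psi> (a, b) \<longleftrightarrow> (\<phi> (a, b) (a + 1, b) \<noteq> \<Psi> (a + 1, b))" for a b
  proof -
    have "H a b = (if \<phi> (a, b) (a + 1, b) then insert a (H (a + 1) b) else H (a + 1) b)"
      unfolding H_def by (auto, metis order_le_less zless_imp_add1_zle)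
    moreover have "a \<notin> H (a + 1) b" by (simp add: H_def)
    ultimately show ?thesis using finH by (simp add: \<Psi>_def)
  qed
  have ver_far: "(\<Psi> (a, b) \<noteq> \<Psi> (a, b + 1)) \<longleftrightarrow> \<phi> (a, b) (a, b + 1)" if "M \<le> a" for a b
  proof -
    have "H a b = {}" for b using that HM[of _ b] unfolding H_def by fastforce
    moreover have "\<not> \<phi> (a, b) (a, b + 1)"
      using \<phi>C[of "(a, b)" "(a, b + 1)"] M[of a b] M[of a "b + 1"] that by (auto simp: adj4_def)
    ultimately show ?thesis by (simp add: \<Psi>_def)
  qed
  \<comment> \<open>Induction from the far right, where nothing is marked and \<open>\<Psi>\<close>
    is false; one step to the left combines \<open>hor\<close> on two rows with
    \<open>square\<close>.\<close>
  have ver: "(\<Psi> (a, b) \<noteq> \<Psi> (a, b + 1)) \<longleftrightarrow> \<phi> (a, b) (a, b + 1)" for a b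
  proof (cases "a \<le> M")
    case True
    then show ?thesis
    proof (induction a rule: int_le_induct)
      case base
      then show ?case using ver_far by simp
    next
      case (step a)
      then show ?case using hor[of "a - 1" b] hor[of "a - 1" "b + 1"] square[of "a - 1" b] by auto
    qed
  qed (use ver_far in auto)
  have \<phi>_sym: "\<phi> u v = \<phi> v u" for u v unfolding \<phi>_def by blast
  have cob: "(\<Psi> u \<noteq> \<Psi> v) \<longleftrightarrow> \<phi> u v" if adj: "adj4 u v" for u v
  proof -
    obtain a b c e where uv: "u = (a, b)" "v = (c, e)" by (metis surj_pair)
    have "\<bar>a - c\<bar> + \<bar>b - e\<bar> = 1" using adj unfolding adj4_def uv by simp
    then have "(c = a + 1 \<and> e = b) \<or> (c = a - 1 \<and> e = b) \<or> (c = a \<and> e = b + 1) \<or> (c = a \<and> e = b - 1)"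
      by arith
    then consider "c = a + 1" "e = b" | "c = a - 1" "e = b" | "c = a" "e = b + 1" | "c = a" "e = b - 1"
      by blast
    then show ?thesis
      using hor[of a b] hor[of "a - 1" b] ver[of a b] ver[of a "b - 1"] \<phi>_sym[of u v] unfolding uv
      by cases auto
  qed
  have \<Psi>C: "\<Psi> v = \<Psi> (0, 0)" if "v \<in> C" for v
  proof -
    have "((0, 0), v) \<in> {(u, v). adj4 u v \<and> u \<in> Op \<and> v \<in> Op}\<^sup>*" using that by (simp add: C_def cluster_def)
    then have "v \<in> C \<and> \<Psi> v = \<Psi> (0, 0)"
    proof (induction rule: rtrancl_induct)
      case (step u v)
      then have "v \<in> C" using Cstep by blast
      moreover have "\<not> \<phi> u v" using step calculation DC unfolding \<phi>_def by blast
      ultimately show ?case using step cob by blast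
    qed (use C0 in simp)
    then show ?thesis ..
  qed
  have \<Psi>D: "\<Psi> v = \<Psi> (M, 0)" if "v \<in> D" for v
  proof -
    have "((M, 0), v) \<in> r4\<^sup>*" using that by (simp add: D_def)
    then have "v \<in> D \<and> \<Psi> v = \<Psi> (M, 0)"
    proof (induction rule: rtrancl_induct)
      case (step u v)
      then have "v \<in> D" "adj4 u v" using Dstep unfolding r4_def by blast+
      moreover have "\<not> \<phi> u v" using step calculation unfolding \<phi>_def by blast
      ultimately show ?case using step cob by blast
    qed (simp add: D_def)
    then show ?thesis ..
  qed
  \<comment> \<open>The edges at both ends of the cluster on the axis join \<open>C\<close> to
    \<open>D\<close>. The right one is marked, so \<open>\<Psi>\<close> differs between
    \<open>C\<close> and \<open>D\<close>; hence the left one is marked as well, which means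
    \<open>(m - 1, 0) \<in> K\<close>.\<close>
  have "(k, 0) \<notin> D" "(m, 0) \<notin> D" "(k, 0) \<in> C" "(m, 0) \<in> C" using km DC unfolding A_def by auto
  moreover have "(k + 1, 0) \<in> K" by (simp add: K_def)
  moreover have "adj4 (k, 0) (k + 1, 0)" "adj4 (m, 0) (m - 1, 0)" by (auto simp: adj4_def)
  ultimately have "(m - 1, 0) \<in> K"
    using cob[of "(k, 0)" "(k + 1, 0)"] cob[of "(m, 0)" "(m - 1, 0)"] v0D v1D
      \<Psi>C[of "(k, 0)"] \<Psi>C[of "(m, 0)"] \<Psi>D[OF v0D] \<Psi>D[OF v1D] unfolding \<phi>_def by auto
  then have "((k + 1, 0), (m - 1, 0)) \<in> rk\<^sup>*" by (simp add: K_def)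
  moreover have "rk \<subseteq> {(u, v). king u v \<and> u \<notin> Op \<and> v \<notin> Op}" using bdO by (auto simp: rk_def)
  ultimately have "((k + 1, 0), (m - 1, 0)) \<in> {(u, v). king u v \<and> u \<notin> Op \<and> v \<notin> Op}\<^sup>*"
    using rtrancl_mono by blast
  then show ?thesis using km0 bdO[OF bd0(1)] by (intro exI[of _ "k + 1"] exI[of _ "m - 1"]) auto
qed

definition kings :: "int \<times> int \<Rightarrow> (int \<times> int) set" where
  "kings u = {fst u - 1..fst u + 1} \<times> {snd u - 1..snd u + 1}"

lemma finite_kings: "finite (kings u)" and card_kings: "card (kings u) = 9"
  by (simp_all add: kings_def card_cartesian_product)

lemma successively_king_fst:
  "successively (\<lambda>x y. king x y) xs \<Longrightarrow> xs \<noteq> [] \<Longrightarrow> fst (hd xs) - fst (last xs) \<le> int (length xs) - 1"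
proof (induction xs)
  case (Cons x xs)
  then show ?case by (cases xs) (auto simp: king_def)
qed simp

text \<open>Only the first \<open>k\<close> steps of the dual path are kept. A king move changes the
  first coordinate by at most 1 and the path runs from \<open>(k, 0)\<close> to a negative first
  coordinate, so there are that many steps. The start is then tied to the length, and a union bound
  needs one term for each \<open>l\<close>; \<open>l = 0\<close> covers a closed origin.\<close>

lemma finite_cluster_closed_walk:
  assumes "(0, 0) \<in> Op \<Longrightarrow> finite (cluster Op)"
  shows "\<exists>l. \<exists>xs\<in>walks kings l (int l, 0). distinct xs \<and> set xs \<inter> Op = {}"
proof (cases "(0, 0) \<in> Op")
  case False
  then show ?thesis by (intro exI[of _ 0]) simp
next
  case True
  then obtain k m where km: "0 < k" "m < 0" "(k, 0) \<notin> Op"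
    "((k, 0), (m, 0)) \<in> {(u, v). king u v \<and> u \<notin> Op \<and> v \<notin> Op}\<^sup>*"
    using finite_cluster_dual_path[OF True assms[OF True]] by blast
  then obtain xs where xs: "xs \<noteq> []" "hd xs = (k, 0)" "last xs = (m, 0)" "distinct xs"
    "successively (\<lambda>x y. (x, y) \<in> {(u, v). king u v \<and> u \<notin> Op \<and> v \<notin> Op}) xs"
    using rtrancl_distinct_path[OF km(4)] by blast
  have king: "successively (\<lambda>x y. king x y) xs"
    by (rule successively_mono[OF xs(5)]) auto
  have len: "k < int (length xs)" using successively_king_fst[OF king xs(1)] xs km by simp
  have notO: "set xs \<inter> Op = {}"
  proof -
    have "hd xs \<notin> Op" using xs(2) km(3) by simp
    then show ?thesis using xs(5)
    proof (induction xs)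
      case (Cons x xs)
      then show ?case by (cases xs) auto
    qed simp
  qed
  define ys where "ys = take (nat k) (tl xs)"
  have ys: "take (Suc (nat k)) xs = (k, 0) # ys" using xs(1,2) unfolding ys_def by (cases xs) auto
  have l: "length ys = nat k" using len xs(1) unfolding ys_def by (cases xs) auto
  have "successively (\<lambda>x y. king x y) ((k, 0) # ys)"
    unfolding ys[symmetric] using king
    by (metis append_take_drop_id successively_append_iff)
  then have "successively (\<lambda>x y. y \<in> kings x) ((k, 0) # ys)"
    by (rule successively_mono) (auto simp: king_def kings_def mem_Times_iff)
  then have "(k, 0) # ys \<in> walks kings (nat k) (k, 0)" using in_walks l by metis
  moreover have "distinct ((k, 0) # ys)" using xs(4) unfolding ys[symmetric] by simp
  moreover have "set ((k, 0) # ys) \<inter> Op = {}" using notO set_take_subset unfolding ys[symmetric] by fastforce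
  ultimately show ?thesis using km(1) by (intro exI[of _ "nat k"] bexI[of _ "(k, 0) # ys"]) auto
qed

section \<open>Erasure on finite sets\<close>

text \<open>The law of a random subset of \<open>I\<close> that contains each \<open>c\<close>
  independently with probability \<open>\<pi> c\<close>.\<close>

definition wt :: "'a set \<Rightarrow> ('a \<Rightarrow> real) \<Rightarrow> 'a set \<Rightarrow> real" where
  "wt I \<pi> A = (\<Prod>c\<in>A. \<pi> c) * (\<Prod>c\<in>I - A. 1 - \<pi> c)"

lemma sum_Pow_Un:
  assumes "finite I" "finite J" "I \<inter> J = {}"
  shows "(\<Sum>A\<in>Pow (I \<union> J). f A) = (\<Sum>A\<in>Pow I. \<Sum>C\<in>Pow J. (f (A \<union> C) :: real))"
proof -
  have "bij_betw (\<lambda>(A, C). A \<union> C) (Pow I \<times> Pow J) (Pow (I \<union> J))"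
    by (rule bij_betw_byWitness[where f' = "\<lambda>A. (A \<inter> I, A \<inter> J)"]) (use assms in auto)
  then have "(\<Sum>A\<in>Pow (I \<union> J). f A) = (\<Sum>(A, C)\<in>Pow I \<times> Pow J. f (A \<union> C))"
    by (subst sum.reindex_bij_betw[symmetric]) (auto intro: sum.cong simp: case_prod_unfold)
  then show ?thesis by (simp add: sum.cartesian_product)
qed

lemma wt_Un:
  assumes "finite I" "finite J" "I \<inter> J = {}" "A \<subseteq> I" "C \<subseteq> J"
  shows "wt (I \<union> J) \<pi> (A \<union> C) = wt I \<pi> A * wt J \<pi> C"
proof -
  have "finite A" "finite C" using assms finite_subset by blast+
  have 1: "(\<Prod>c\<in>A \<union> C. \<pi> c) = (\<Prod>c\<in>A. \<pi> c) * (\<Prod>c\<in>C. \<pi> c)"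
    by (rule prod.union_disjoint) (use assms \<open>finite A\<close> \<open>finite C\<close> in auto)
  have "I \<union> J - (A \<union> C) = (I - A) \<union> (J - C)" using assms by auto
  then have 2: "(\<Prod>c\<in>I \<union> J - (A \<union> C). 1 - \<pi> c) = (\<Prod>c\<in>I - A. 1 - \<pi> c) * (\<Prod>c\<in>J - C. 1 - \<pi> c)"
    by (simp add: prod.union_disjoint assms Diff_Int_distrib2 disjoint_iff) (subst prod.union_disjoint; use assms in auto)
  show ?thesis unfolding wt_def 1 2 by simp
qed

lemma wt_nonneg: "(\<And>c. c \<in> I \<Longrightarrow> 0 \<le> \<pi> c \<and> \<pi> c \<le> 1) \<Longrightarrow> A \<subseteq> I \<Longrightarrow> 0 \<le> wt I \<pi> A"
  unfolding wt_def by (intro mult_nonneg_nonneg prod_nonneg) auto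

lemma sum_wt: "finite I \<Longrightarrow> (\<Sum>A\<in>Pow I. wt I \<pi> A) = 1"
proof (induction I rule: finite_induct)
  case (insert x I)
  have "(\<Sum>A\<in>Pow (I \<union> {x}). wt (I \<union> {x}) \<pi> A) = (\<Sum>A\<in>Pow I. \<Sum>C\<in>Pow {x}. wt I \<pi> A * wt {x} \<pi> C)"
    using insert by (subst sum_Pow_Un) (auto intro!: sum.cong wt_Un simp del: Un_insert_right)
  also have "\<dots> = (\<Sum>A\<in>Pow I. wt I \<pi> A)"
    by (rule sum.cong) (auto simp: Pow_insert sum.insert wt_def algebra_simps)
  finally show ?case using insert by simp
qed (simp add: wt_def)

lemma sum_Pow_insert:
  assumes "finite I" "x \<notin> I"
  shows "(\<Sum>A\<in>Pow (insert x I). f A) = (\<Sum>A\<in>Pow I. f A + (f (insert x A) :: real))"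
  using sum_Pow_Un[of I "{x}" f] assms by (auto simp: Pow_insert intro!: sum.cong)

lemma wt_insert:
  assumes "finite I" "x \<notin> I" "A \<subseteq> I"
  shows "wt (insert x I) \<pi> A = wt I \<pi> A * (1 - \<pi> x)"
    and "wt (insert x I) \<pi> (insert x A) = wt I \<pi> A * \<pi> x"
  using wt_Un[of I "{x}" A "{}" \<pi>] wt_Un[of I "{x}" A "{x}" \<pi>] assms
  by (auto simp: wt_def)

text \<open>Keeping each point with probability \<open>q\<close> turns the density
  \<open>\<pi>\<close> into \<open>q * \<pi>\<close>, which lies below \<open>\<pi>'\<close>.
  Thinning and monotone comparison are carried out together, one point at a time.\<close>

lemma thinning_dominated:
  assumes "finite I" "0 \<le> q" "q \<le> 1"
    and "\<And>c. c \<in> I \<Longrightarrow> 0 \<le> \<pi> c \<and> \<pi> c \<le> 1 \<and> q * \<pi> c \<le> \<pi>' c \<and> \<pi>' c \<le> 1"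
    and "\<And>A B. A \<subseteq> B \<Longrightarrow> f A \<le> f B"
  shows "(\<Sum>A\<in>Pow I. wt I \<pi> A * (\<Sum>D\<in>Pow A. q ^ card D * (1 - q) ^ card (A - D) * f D))
    \<le> (\<Sum>A\<in>Pow I. wt I \<pi>' A * f A)"
  using assms(1,4,5)
proof (induction I arbitrary: f rule: finite_induct)
  case empty
  then show ?case by (simp add: wt_def)
next
  case (insert x I)
  let ?T = "\<lambda>f A. (\<Sum>D\<in>Pow A. q ^ card D * (1 - q) ^ card (A - D) * f D)"
  let ?g = "\<lambda>A. f (insert x A)"
  let ?W = "\<lambda>f. (\<Sum>A\<in>Pow I. wt I \<pi>' A * f A)"
  have px: "0 \<le> \<pi> x" "\<pi> x \<le> 1" "q * \<pi> x \<le> \<pi>' x" "\<pi>' x \<le> 1" using insert.prems(1) by auto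
  \<comment> \<open>Conditions on the fate of \<open>x\<close>: it is discarded, or it is kept and
    \<open>f\<close> becomes \<open>?g\<close>. The induction hypothesis is needed for both
    functions, hence \<open>f\<close> is arbitrary.\<close>
  have T: "?T f (insert x A) = (1 - q) * ?T f A + q * ?T ?g A" if A: "A \<subseteq> I" for A
  proof -
    have fA: "finite A" "x \<notin> A" using A insert finite_subset by blast+
    have *: "card (insert x A - D) = Suc (card (A - D))" "card (insert x D) = Suc (card D)"
      "insert x A - insert x D = A - D" if "D \<subseteq> A" for D
    proof -
      have "insert x A - D = insert x (A - D)" using that fA by auto
      then show "card (insert x A - D) = Suc (card (A - D))" using fA that by auto
      show "card (insert x D) = Suc (card D)"
        using fA that finite_subset[OF that] by (intro card_insert_disjoint) auto
      show "insert x A - insert x D = A - D" using fA that by auto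
    qed
    have "?T f (insert x A) = (\<Sum>D\<in>Pow A. q ^ card D * (1 - q) ^ card (insert x A - D) * f D +
       q ^ card (insert x D) * (1 - q) ^ card (insert x A - insert x D) * f (insert x D))"
      by (rule sum_Pow_insert) (use fA in auto)
    also have "\<dots> = (\<Sum>D\<in>Pow A. (1 - q) * (q ^ card D * (1 - q) ^ card (A - D) * f D) +
       q * (q ^ card D * (1 - q) ^ card (A - D) * ?g D))"
      by (rule sum.cong[OF refl], simp only: Pow_iff *) simp
    also have "\<dots> = (1 - q) * ?T f A + q * ?T ?g A"
      by (simp add: sum.distrib sum_distrib_left)
    finally show ?thesis .
  qed
  have "(\<Sum>A\<in>Pow (insert x I). wt (insert x I) \<pi> A * ?T f A)
      = (\<Sum>A\<in>Pow I. wt I \<pi> A * (1 - \<pi> x) * ?T f A + wt I \<pi> A * \<pi> x * ?T f (insert x A))"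
    by (subst sum_Pow_insert) (use insert in \<open>auto intro!: sum.cong simp: wt_insert\<close>)
  also have "\<dots> = (\<Sum>A\<in>Pow I. (1 - q * \<pi> x) * (wt I \<pi> A * ?T f A) + q * \<pi> x * (wt I \<pi> A * ?T ?g A))"
    by (rule sum.cong[OF refl], simp only: Pow_iff T) (simp add: algebra_simps)
  also have "\<dots> = (1 - q * \<pi> x) * (\<Sum>A\<in>Pow I. wt I \<pi> A * ?T f A) + q * \<pi> x * (\<Sum>A\<in>Pow I. wt I \<pi> A * ?T ?g A)"
    by (simp add: sum.distrib sum_distrib_left)
  also have "\<dots> \<le> (1 - q * \<pi> x) * ?W f + q * \<pi> x * ?W ?g"
  proof (intro add_mono mult_left_mono)
    show "(\<Sum>A\<in>Pow I. wt I \<pi> A * ?T f A) \<le> ?W f"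
      by (rule insert.IH) (use insert.prems in auto)
    show "(\<Sum>A\<in>Pow I. wt I \<pi> A * ?T ?g A) \<le> ?W ?g"
      by (rule insert.IH) (use insert.prems in \<open>auto intro!: insert.prems(2)\<close>)
    show "0 \<le> 1 - q * \<pi> x" using px by linarith
    show "0 \<le> q * \<pi> x" using px assms by simp
  qed
  also have "\<dots> \<le> (1 - \<pi>' x) * ?W f + \<pi>' x * ?W ?g"
  proof -
    have nn: "0 \<le> \<pi>' c \<and> \<pi>' c \<le> 1" if "c \<in> I" for c
      using insert.prems(1)[of c] that assms(2) by (smt (verit) insertCI mult_nonneg_nonneg)
    have "?W f \<le> ?W ?g"
      by (intro sum_mono mult_left_mono insert.prems(2) wt_nonneg) (use nn in auto)
    then have "0 \<le> (\<pi>' x - q * \<pi> x) * (?W ?g - ?W f)" using px by simp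
    then show ?thesis by (simp add: algebra_simps)
  qed
  also have "\<dots> = (\<Sum>A\<in>Pow I. wt I \<pi>' A * (1 - \<pi>' x) * f A + wt I \<pi>' A * \<pi>' x * ?g A)"
    by (simp add: sum.distrib sum_distrib_left mult_ac)
  also have "\<dots> = (\<Sum>A\<in>Pow (insert x I). wt (insert x I) \<pi>' A * f A)"
    by (subst sum_Pow_insert) (use insert in \<open>auto intro!: sum.cong simp: wt_insert\<close>)
  finally show ?case .
qed

lemma sum_thinning: "finite A \<Longrightarrow> (\<Sum>D\<in>Pow A. q ^ card D * (1 - q) ^ card (A - D)) = (1::real)"
  using sum_wt[of A "\<lambda>_. q"] by (simp add: wt_def)

text \<open>A certificate of at most \<open>k\<close> points survives the thinning with probability
  at least \<open>q ^ k\<close>, and as long as it survives the event still holds.\<close>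

lemma certificate_thinning:
  fixes u :: "'a set \<Rightarrow> bool"
  assumes "finite I" "0 \<le> q" "q \<le> 1"
    and pi: "\<And>c. c \<in> I \<Longrightarrow> 0 \<le> \<pi> c \<and> \<pi> c \<le> 1 \<and> q * \<pi> c \<le> \<pi>' c \<and> \<pi>' c \<le> 1"
    and cert: "\<And>A. A \<subseteq> I \<Longrightarrow> u A \<Longrightarrow> \<exists>C\<subseteq>A. card C \<le> k \<and> (\<forall>B. C \<subseteq> B \<longrightarrow> u B)"
  shows "q ^ k * (\<Sum>A\<in>Pow I. wt I \<pi> A * of_bool (u A)) \<le> (\<Sum>A\<in>Pow I. wt I \<pi>' A * of_bool (u A))"
proof -
  \<comment> \<open>A monotone function of all sets that agrees with \<open>u\<close> on the subsets
    of \<open>I\<close>, as \<open>thinning_dominated\<close> requires.\<close>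
  define f where "f A = (of_bool (\<exists>C\<subseteq>A. C \<subseteq> I \<and> card C \<le> k \<and> (\<forall>B. C \<subseteq> B \<longrightarrow> u B)) :: real)" for A
  have fu: "f A = of_bool (u A)" if AI: "A \<subseteq> I" for A
  proof -
    have "(\<exists>C\<subseteq>A. C \<subseteq> I \<and> card C \<le> k \<and> (\<forall>B. C \<subseteq> B \<longrightarrow> u B)) \<longleftrightarrow> u A"
    proof
      assume "u A"
      then obtain C where "C \<subseteq> A" "card C \<le> k" "\<forall>B. C \<subseteq> B \<longrightarrow> u B"
        using cert[OF AI] by blast
      then show "\<exists>C\<subseteq>A. C \<subseteq> I \<and> card C \<le> k \<and> (\<forall>B. C \<subseteq> B \<longrightarrow> u B)"
        using AI by (intro exI[of _ C]) simp
    qed auto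
    then show ?thesis unfolding f_def by simp
  qed
  have "q ^ k * (\<Sum>A\<in>Pow I. wt I \<pi> A * of_bool (u A)) =
      (\<Sum>A\<in>Pow I. wt I \<pi> A * (q ^ k * of_bool (u A)))"
    by (simp add: sum_distrib_left mult_ac)
  also have "\<dots> \<le> (\<Sum>A\<in>Pow I. wt I \<pi> A * (\<Sum>D\<in>Pow A. q ^ card D * (1 - q) ^ card (A - D) * f D))"
  proof (intro sum_mono mult_left_mono)
    fix A assume A: "A \<in> Pow I"
    then have finA: "finite A" using assms(1) finite_subset by auto
    show "0 \<le> wt I \<pi> A" by (rule wt_nonneg) (use A pi in blast)+
    have nn: "0 \<le> q ^ card D * (1 - q) ^ card (A - D)" for D
      by (intro mult_nonneg_nonneg zero_le_power) (use assms(2,3) in simp_all)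
    show "q ^ k * of_bool (u A) \<le> (\<Sum>D\<in>Pow A. q ^ card D * (1 - q) ^ card (A - D) * f D)"
    proof (cases "u A")
      case True
      then obtain C where C: "C \<subseteq> A" "card C \<le> k" "\<forall>B. C \<subseteq> B \<longrightarrow> u B"
        using cert[of A] A by auto
      have finC: "finite C" using C finA finite_subset by blast
      have "q ^ k \<le> q ^ card C" using C assms(2,3) by (intro power_decreasing) auto
      \<comment> \<open>The thinned sets containing all of \<open>C\<close> have total weight
        \<open>q ^ card C\<close>, whatever happens on \<open>A - C\<close>.\<close>
      also have "\<dots> = (\<Sum>D\<in>Pow (A - C). q ^ card C * (q ^ card D * (1 - q) ^ card ((A - C) - D)))"
        using sum_thinning[of "A - C" q] finA by (simp add: sum_distrib_left[symmetric])
      also have "\<dots> = (\<Sum>D\<in>Pow (A - C). q ^ card (C \<union> D) * (1 - q) ^ card (A - (C \<union> D)) * f (C \<union> D))"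
      proof (rule sum.cong)
        fix D assume D: "D \<in> Pow (A - C)"
        have "finite D" using D finA by (meson PowD finite_Diff finite_subset)
        then have "card (C \<union> D) = card C + card D" using D finC by (intro card_Un_disjoint) auto
        moreover have "A - (C \<union> D) = A - C - D" by auto
        moreover have "f (C \<union> D) = 1" using C A unfolding f_def by auto
        ultimately show "q ^ card C * (q ^ card D * (1 - q) ^ card ((A - C) - D)) =
          q ^ card (C \<union> D) * (1 - q) ^ card (A - (C \<union> D)) * f (C \<union> D)" by (simp add: power_add)
      qed simp
      also have "\<dots> = (\<Sum>D\<in>(\<lambda>D. C \<union> D) ` Pow (A - C). q ^ card D * (1 - q) ^ card (A - D) * f D)"
        by (subst sum.reindex) (auto simp: inj_on_def)
      also have "\<dots> \<le> (\<Sum>D\<in>Pow A. q ^ card D * (1 - q) ^ card (A - D) * f D)"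
        by (intro sum_mono2) (use finA C nn in \<open>auto simp: f_def\<close>)
      finally show ?thesis using True by simp
    next
      case False
      then show ?thesis using nn by (auto intro!: sum_nonneg simp: f_def)
    qed
  qed
  also have "\<dots> \<le> (\<Sum>A\<in>Pow I. wt I \<pi>' A * f A)"
  proof (rule thinning_dominated)
    show "f A \<le> f B" if "A \<subseteq> B" for A B
      unfolding f_def of_bool_def using that by (auto intro: order_trans)
  qed (use assms in auto)
  also have "\<dots> = (\<Sum>A\<in>Pow I. wt I \<pi>' A * of_bool (u A))"
    by (intro sum.cong) (auto simp: fu)
  finally show ?thesis .
qed


text \<open>Blocks are made independent one after another. Given the rest \<open>A\<close>, the law
  \<open>Q\<close> on a block is the multiple \<open>q\<close> of the product law for
  \<open>\<pi>\<close> plus an excess at the empty set. The excess adds to the total mass but not to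
  the increments of \<open>u\<close>, so it pays for the factor \<open>1 + \<kappa>\<close> lost in
  passing from \<open>\<pi>\<close> to \<open>\<pi>'\<close>. Then the block is summed out of
  \<open>Q\<close> and averaged out of \<open>u\<close>; the hypotheses are stable under these sums,
  which drives the induction.\<close>

lemma block_domination:
  fixes cells :: "'b \<Rightarrow> 'a set" and u Q :: "'a set \<Rightarrow> real"
  assumes "finite B" and "\<And>b. b \<in> B \<Longrightarrow> finite (cells b)"
    and "\<And>b b'. b \<in> B \<Longrightarrow> b' \<in> B \<Longrightarrow> b \<noteq> b' \<Longrightarrow> cells b \<inter> cells b' = {}"
    and pi': "\<And>c. 0 \<le> \<pi>' c \<and> \<pi>' c \<le> 1" and pi: "\<And>c. 0 \<le> \<pi> c \<and> \<pi> c \<le> 1"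
    and "\<And>A A'. A \<subseteq> A' \<Longrightarrow> u A \<le> u A'"
    and "\<And>b A. b \<in> B \<Longrightarrow> A \<subseteq> \<Union>(cells ` (B - {b})) \<Longrightarrow>
      (\<Sum>C\<in>Pow (cells b). wt (cells b) \<pi> C * (u (A \<union> C) - u A))
        \<le> (1 + \<kappa>) * (\<Sum>C\<in>Pow (cells b). wt (cells b) \<pi>' C * (u (A \<union> C) - u A))"
    and "\<And>b A. b \<in> B \<Longrightarrow> A \<subseteq> \<Union>(cells ` (B - {b})) \<Longrightarrow>
      \<exists>q\<ge>0. (\<forall>C\<subseteq>cells b. C \<noteq> {} \<longrightarrow> Q (A \<union> C) = wt (cells b) \<pi> C * q) \<and>
        wt (cells b) \<pi> {} * (1 + \<theta>) * q \<le> Q A"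
    and "\<And>b. b \<in> B \<Longrightarrow> \<kappa> \<le> \<theta> * wt (cells b) \<pi> {}"
  shows "(\<Sum>A\<in>Pow (\<Union>(cells ` B)). Q A * u A)
    \<le> (\<Sum>A\<in>Pow (\<Union>(cells ` B)). Q A) * (\<Sum>A\<in>Pow (\<Union>(cells ` B)). wt (\<Union>(cells ` B)) \<pi>' A * u A)"
  using assms(1,2,3,6-9)
proof (induction B arbitrary: Q u rule: finite_induct)
  case empty
  then show ?case by (simp add: wt_def)
next
  case (insert b B)
  note fin = insert.prems(1) and disj = insert.prems(2) and mono = insert.prems(3)
    and ucond = insert.prems(4) and Qcond = insert.prems(5) and \<kappa> = insert.prems(6)
  define I where "I = cells b"
  define J where "J = \<Union>(cells ` B)"
  have IJ: "finite I" "finite J" "J \<inter> I = {}" "\<Union>(cells ` insert b B) = J \<union> I"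
    using insert.hyps fin disj[of b] unfolding I_def J_def by fastforce+
  have minus: "insert b B - {b} = B" using insert.hyps by auto
  define Q2 where "Q2 A = (\<Sum>C\<in>Pow I. Q (A \<union> C))" for A
  define u2 where "u2 A = (\<Sum>C\<in>Pow I. wt I \<pi>' C * u (A \<union> C))" for A
  have wt_nn: "0 \<le> wt X \<pi>' C" "0 \<le> wt X \<pi> C" if "C \<subseteq> X" for C X
    using that pi pi' by (auto intro!: wt_nonneg)
  have "(\<Sum>C\<in>Pow I. Q (A \<union> C) * u (A \<union> C)) \<le> Q2 A * u2 A" if A: "A \<in> Pow J" for A
  proof -
    have AJ: "A \<subseteq> \<Union> (cells ` (insert b B - {b}))" using A unfolding minus J_def by simp
    obtain q where q: "q \<ge> 0" "\<And>C. C \<subseteq> I \<Longrightarrow> C \<noteq> {} \<Longrightarrow> Q (A \<union> C) = wt I \<pi> C * q"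
      "wt I \<pi> {} * (1 + \<theta>) * q \<le> Q A"
      using Qcond[OF _ AJ, of] unfolding I_def by auto
    define \<Delta> where "\<Delta> = (\<Sum>C\<in>Pow I. wt I \<pi>' C * (u (A \<union> C) - u A))"
    have \<Delta>0: "0 \<le> \<Delta>" unfolding \<Delta>_def
      by (intro sum_nonneg mult_nonneg_nonneg) (use mono in \<open>auto intro: wt_nn\<close>)
    have split: "(\<Sum>C\<in>Pow I. Q (A \<union> C) * g C) = q * (\<Sum>C\<in>Pow I. wt I \<pi> C * g C) + (Q A - wt I \<pi> {} * q) * g {}" for g
    proof -
      have "(\<Sum>C\<in>Pow I. Q (A \<union> C) * g C) = Q A * g {} + (\<Sum>C\<in>Pow I - {{}}. Q (A \<union> C) * g C)"
        by (subst sum.remove[of _ "{}"]) (use IJ in auto)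
      also have "(\<Sum>C\<in>Pow I - {{}}. Q (A \<union> C) * g C) = (\<Sum>C\<in>Pow I - {{}}. q * (wt I \<pi> C * g C))"
        by (rule sum.cong) (auto simp: q(2))
      also have "\<dots> = q * (\<Sum>C\<in>Pow I - {{}}. wt I \<pi> C * g C)" by (simp add: sum_distrib_left)
      also have "(\<Sum>C\<in>Pow I - {{}}. wt I \<pi> C * g C) = (\<Sum>C\<in>Pow I. wt I \<pi> C * g C) - wt I \<pi> {} * g {}"
        by (subst (2) sum.remove[of _ "{}"]) (use IJ in auto)
      finally show ?thesis by (simp add: algebra_simps)
    qed
    have Q2: "Q2 A = q + Q A - wt I \<pi> {} * q"
      using split[of "\<lambda>_. 1"] sum_wt[OF IJ(1), of \<pi>] unfolding Q2_def by simp
    have u2: "u2 A = \<Delta> + u A"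
      using sum_wt[OF IJ(1), of \<pi>'] unfolding u2_def \<Delta>_def
      by (simp add: right_diff_distrib sum_subtractf sum_distrib_right[symmetric])
    have w0: "0 \<le> wt I \<pi> {}" by (rule wt_nn) simp
    have "(\<Sum>C\<in>Pow I. Q (A \<union> C) * u (A \<union> C)) = q * (\<Sum>C\<in>Pow I. wt I \<pi> C * u (A \<union> C)) + (Q A - wt I \<pi> {} * q) * u A"
      using split[of "\<lambda>C. u (A \<union> C)"] by simp
    also have "(\<Sum>C\<in>Pow I. wt I \<pi> C * u (A \<union> C)) = (\<Sum>C\<in>Pow I. wt I \<pi> C * (u (A \<union> C) - u A)) + u A"
      using sum_wt[OF IJ(1), of \<pi>]
      by (simp add: right_diff_distrib sum_subtractf sum_distrib_right[symmetric])
    also have "q * ((\<Sum>C\<in>Pow I. wt I \<pi> C * (u (A \<union> C) - u A)) + u A) + (Q A - wt I \<pi> {} * q) * u A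
      = q * (\<Sum>C\<in>Pow I. wt I \<pi> C * (u (A \<union> C) - u A)) + Q2 A * u A"
      unfolding Q2 by (simp add: algebra_simps)
    also have "\<dots> \<le> q * ((1 + \<kappa>) * \<Delta>) + Q2 A * u A"
      using ucond[OF _ AJ] q(1) unfolding \<Delta>_def I_def by (auto intro!: mult_left_mono)
    \<comment> \<open>\<open>Q2 A\<close> consists of \<open>q\<close> and the excess at the empty
      set, which is at least \<open>\<theta> * wt I \<pi> {} * q\<close> and hence at least
      \<open>\<kappa> * q\<close>.\<close>
    also have "q * ((1 + \<kappa>) * \<Delta>) \<le> Q2 A * \<Delta>"
    proof -
      have "q * \<kappa> \<le> q * (\<theta> * wt I \<pi> {})"
        using \<kappa>[of b] q(1) by (intro mult_left_mono) (auto simp: I_def)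
      then have "q * (1 + \<kappa>) \<le> Q2 A" using q(3) unfolding Q2 by (simp add: algebra_simps)
      then show ?thesis using mult_right_mono[OF _ \<Delta>0, of "q * (1 + \<kappa>)"] by (simp add: mult.assoc)
    qed
    finally show ?thesis unfolding u2 by (simp add: algebra_simps)
  qed
  then have "(\<Sum>A\<in>Pow (J \<union> I). Q A * u A) \<le> (\<Sum>A\<in>Pow J. Q2 A * u2 A)"
    by (subst sum_Pow_Un) (use IJ in \<open>auto intro!: sum_mono\<close>)
  also have "\<dots> \<le> (\<Sum>A\<in>Pow J. Q2 A) * (\<Sum>A\<in>Pow J. wt J \<pi>' A * u2 A)"
    unfolding J_def
  proof (rule insert.IH)
    fix A A' :: "'a set" assume "A \<subseteq> A'"
    then show "u2 A \<le> u2 A'" unfolding u2_def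
      by (intro sum_mono mult_left_mono mono wt_nn) auto
  next
    fix b' A assume b': "b' \<in> B" "A \<subseteq> \<Union> (cells ` (B - {b'}))"
    have sub: "A \<union> C \<subseteq> \<Union> (cells ` (insert b B - {b'}))" if "C \<in> Pow I" for C
      using that b' insert.hyps unfolding I_def by fastforce
    have "(\<Sum>C\<in>Pow (cells b'). wt (cells b') \<rho> C * (u2 (A \<union> C) - u2 A))
       = (\<Sum>D\<in>Pow I. wt I \<pi>' D * (\<Sum>C\<in>Pow (cells b'). wt (cells b') \<rho> C * (u ((A \<union> D) \<union> C) - u (A \<union> D))))" for \<rho>
      unfolding u2_def sum_subtractf[symmetric] sum_distrib_left
      by (subst sum.swap) (auto intro!: sum.cong simp: algebra_simps Un_commute Un_left_commute)
    \<comment> \<open>Increments in block \<open>b'\<close> commute with averaging over block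
      \<open>b\<close>, so the comparison for \<open>u2\<close> is an average of comparisons for
      \<open>u\<close>.\<close>
    note eq = this
    have "(\<Sum>C\<in>Pow (cells b'). wt (cells b') \<pi> C * (u2 (A \<union> C) - u2 A))
      \<le> (\<Sum>D\<in>Pow I. wt I \<pi>' D * ((1 + \<kappa>) * (\<Sum>C\<in>Pow (cells b'). wt (cells b') \<pi>' C * (u ((A \<union> D) \<union> C) - u (A \<union> D)))))"
      unfolding eq by (intro sum_mono mult_left_mono ucond sub wt_nn) (use b'(1) in auto)
    also have "\<dots> = (1 + \<kappa>) * (\<Sum>C\<in>Pow (cells b'). wt (cells b') \<pi>' C * (u2 (A \<union> C) - u2 A))"
      unfolding eq sum_distrib_left[of "1 + \<kappa>" _ "Pow I"] by (simp only: mult.left_commute)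
    finally show "(\<Sum>C\<in>Pow (cells b'). wt (cells b') \<pi> C * (u2 (A \<union> C) - u2 A))
        \<le> (1 + \<kappa>) * (\<Sum>C\<in>Pow (cells b'). wt (cells b') \<pi>' C * (u2 (A \<union> C) - u2 A))" .
  next
    fix b' A assume b': "b' \<in> B" "A \<subseteq> \<Union> (cells ` (B - {b'}))"
    have sub: "A \<union> C \<subseteq> \<Union> (cells ` (insert b B - {b'}))" if "C \<in> Pow I" for C
      using that b' insert.hyps unfolding I_def by fastforce
    have "\<forall>D\<in>Pow I. \<exists>q\<ge>0. (\<forall>C\<subseteq>cells b'. C \<noteq> {} \<longrightarrow> Q ((A \<union> D) \<union> C) = wt (cells b') \<pi> C * q) \<and>
        wt (cells b') \<pi> {} * (1 + \<theta>) * q \<le> Q (A \<union> D)"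
      using Qcond[of b', OF _ sub] b'(1) by blast
    then obtain q where q: "\<And>D. D \<in> Pow I \<Longrightarrow> q D \<ge> 0"
      "\<And>D C. D \<in> Pow I \<Longrightarrow> C \<subseteq> cells b' \<Longrightarrow> C \<noteq> {} \<Longrightarrow> Q ((A \<union> D) \<union> C) = wt (cells b') \<pi> C * q D"
      "\<And>D. D \<in> Pow I \<Longrightarrow> wt (cells b') \<pi> {} * (1 + \<theta>) * q D \<le> Q (A \<union> D)"
      by metis
    show "\<exists>q\<ge>0. (\<forall>C\<subseteq>cells b'. C \<noteq> {} \<longrightarrow> Q2 (A \<union> C) = wt (cells b') \<pi> C * q) \<and>
        wt (cells b') \<pi> {} * (1 + \<theta>) * q \<le> Q2 A"
    proof (intro exI[of _ "\<Sum>D\<in>Pow I. q D"] conjI allI impI)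
      show "0 \<le> (\<Sum>D\<in>Pow I. q D)" using q(1) by (intro sum_nonneg) auto
      show "wt (cells b') \<pi> {} * (1 + \<theta>) * (\<Sum>D\<in>Pow I. q D) \<le> Q2 A"
        unfolding Q2_def sum_distrib_left using q(3) by (intro sum_mono) auto
      fix C assume C: "C \<subseteq> cells b'" "C \<noteq> {}"
      show "Q2 (A \<union> C) = wt (cells b') \<pi> C * (\<Sum>D\<in>Pow I. q D)"
        unfolding Q2_def sum_distrib_left
      proof (rule sum.cong[OF refl])
        fix D assume "D \<in> Pow I"
        then show "Q (A \<union> C \<union> D) = wt (cells b') \<pi> C * q D"
          using q(2)[of D C] C by (simp add: Un_ac)
      qed
    qed
  qed (use fin disj \<kappa> in auto)
  also have "(\<Sum>A\<in>Pow J. Q2 A) = (\<Sum>A\<in>Pow (J \<union> I). Q A)"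
    unfolding Q2_def by (rule sum_Pow_Un[symmetric]) (use IJ in auto)
  also have "(\<Sum>A\<in>Pow J. wt J \<pi>' A * u2 A) = (\<Sum>A\<in>Pow (J \<union> I). wt (J \<union> I) \<pi>' A * u A)"
  proof -
    have "(\<Sum>A\<in>Pow (J \<union> I). wt (J \<union> I) \<pi>' A * u A)
        = (\<Sum>A\<in>Pow J. \<Sum>C\<in>Pow I. wt (J \<union> I) \<pi>' (A \<union> C) * u (A \<union> C))"
      by (rule sum_Pow_Un) (use IJ in auto)
    also have "\<dots> = (\<Sum>A\<in>Pow J. wt J \<pi>' A * u2 A)"
      unfolding u2_def sum_distrib_left by (intro sum.cong refl) (use IJ in \<open>simp add: wt_Un\<close>)
    finally show ?thesis by simp
  qed
  finally show ?case unfolding IJ(4) .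
qed

text \<open>The set of erased blocks is a hard-core configuration: an independent set \<open>T\<close> of the conflict
  graph, with the weight that makes erasing independent of the occupied cells. The law \<open>Q\<close> of
  what is left has the density \<open>card {T. T avoids the occupied blocks}\<close>, so
  a block is empty with a conditional probability that exceeds the product value by a
  uniform factor.\<close>

lemma erasure_inequality:
  fixes cells :: "'b \<Rightarrow> 'a set" and E U :: "'a set \<Rightarrow> bool" and conf :: "'b \<Rightarrow> 'b \<Rightarrow> bool"
  defines "indep T \<equiv> (\<forall>x\<in>T. \<forall>y\<in>T. x \<noteq> y \<longrightarrow> \<not> conf x y)"
  assumes finB: "finite B" and fin: "\<And>b. b \<in> B \<Longrightarrow> finite (cells b)"
    and disj: "\<And>b b'. b \<in> B \<Longrightarrow> b' \<in> B \<Longrightarrow> b \<noteq> b' \<Longrightarrow> cells b \<inter> cells b' = {}"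
    and sym: "\<And>x y. conf x y \<Longrightarrow> conf y x"
    and deg: "\<And>b. b \<in> B \<Longrightarrow> card {b' \<in> B. conf b b'} \<le> K"
    and pi': "\<And>c. 0 \<le> \<pi>' c \<and> \<pi>' c \<le> 1" and pi: "\<And>c. 0 \<le> \<pi> c \<and> \<pi> c \<le> 1"
    and q: "0 \<le> q" "q \<le> 1" "\<And>c. q * \<pi> c \<le> \<pi>' c"
    and \<kappa>: "0 \<le> \<kappa>" "\<And>b. b \<in> B \<Longrightarrow> \<kappa> \<le> wt (cells b) \<pi> {}"
    and qk: "1 \<le> (1 + \<kappa> / 2 ^ K) * q ^ k"
    and EU: "\<And>A T. A \<subseteq> \<Union>(cells ` B) \<Longrightarrow> E A \<Longrightarrow> T \<subseteq> B \<Longrightarrow> indep T \<Longrightarrow> U (A - \<Union>(cells ` T))"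
    and mono: "\<And>A A'. U A \<Longrightarrow> A \<subseteq> A' \<Longrightarrow> U A'"
    and cert: "\<And>A b. A \<subseteq> \<Union>(cells ` B) \<Longrightarrow> U A \<Longrightarrow> b \<in> B \<Longrightarrow>
      \<exists>C\<subseteq>A \<inter> cells b. card C \<le> k \<and> U ((A - cells b) \<union> C)"
  shows "(\<Sum>A\<in>Pow (\<Union>(cells ` B)). wt (\<Union>(cells ` B)) \<pi> A * of_bool (E A))
    \<le> (\<Sum>A\<in>Pow (\<Union>(cells ` B)). wt (\<Union>(cells ` B)) \<pi>' A * of_bool (U A))"
proof -
  define I where "I = \<Union>(cells ` B)"
  define u where "u A = (of_bool (U A) :: real)" for A
  define \<T> where "\<T> = {T. T \<subseteq> B \<and> indep T}"
  define h where "h A = card {T \<in> \<T>. \<Union>(cells ` T) \<inter> A = {}}" for A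
  define Q where "Q A = wt I \<pi> A * real (h A)" for A
  define g where "g T = wt (\<Union>(cells ` T)) \<pi> {}" for T
  have fin\<T>: "finite \<T>" using finB unfolding \<T>_def by auto
  have finI: "finite I" using finB fin unfolding I_def by auto
  have wt_nn: "0 \<le> wt X \<pi> C" if "C \<subseteq> X" for C X using that pi by (auto intro!: wt_nonneg)
  have split: "finite (\<Union>(cells ` T))" "finite (\<Union>(cells ` (B - T)))"
    "\<Union>(cells ` (B - T)) \<inter> \<Union>(cells ` T) = {}" "\<Union>(cells ` (B - T)) \<union> \<Union>(cells ` T) = I"
    if "T \<subseteq> B" for T
  proof -
    show "finite (\<Union>(cells ` T))" "finite (\<Union>(cells ` (B - T)))"
      using that finB fin by (auto intro: finite_subset)
    show "\<Union>(cells ` (B - T)) \<inter> \<Union>(cells ` T) = {}"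
      using that disj by fastforce
    show "\<Union>(cells ` (B - T)) \<union> \<Union>(cells ` T) = I"
      using that unfolding I_def by auto
  qed
  \<comment> \<open>Exchanging the sum over \<open>A\<close> with the count \<open>h A\<close> shows
    \<open>Q\<close> as a mixture over \<open>T\<close>: the blocks of \<open>T\<close> are empty,
    the others follow the product law, and the weight \<open>g T\<close> is the probability that the
    blocks of \<open>T\<close> are empty.\<close>
  have Qv: "(\<Sum>A\<in>Pow I. Q A * v A) = (\<Sum>T\<in>\<T>. g T * (\<Sum>A\<in>Pow (\<Union>(cells ` (B - T))). wt (\<Union>(cells ` (B - T))) \<pi> A * v A))" for v
  proof -
    have "(\<Sum>A\<in>Pow I. Q A * v A) = (\<Sum>A\<in>Pow I. \<Sum>T\<in>\<T>. if \<Union>(cells ` T) \<inter> A = {} then wt I \<pi> A * v A else 0)"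
      unfolding Q_def h_def using fin\<T> by (intro sum.cong refl) (simp add: sum.If_cases Int_def)
    also have "\<dots> = (\<Sum>T\<in>\<T>. \<Sum>A\<in>Pow I. if \<Union>(cells ` T) \<inter> A = {} then wt I \<pi> A * v A else 0)"
      by (rule sum.swap)
    also have "\<dots> = (\<Sum>T\<in>\<T>. g T * (\<Sum>A\<in>Pow (\<Union>(cells ` (B - T))). wt (\<Union>(cells ` (B - T))) \<pi> A * v A))"
    proof (rule sum.cong[OF refl])
      fix T assume "T \<in> \<T>"
      then have T: "T \<subseteq> B" by (simp add: \<T>_def)
      let ?J = "\<Union>(cells ` (B - T))" and ?I = "\<Union>(cells ` T)"
      have "(\<Sum>A\<in>Pow I. if ?I \<inter> A = {} then wt I \<pi> A * v A else 0) = (\<Sum>A\<in>Pow ?J. wt I \<pi> A * v A)"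
      proof (rule sum.mono_neutral_cong_right)
        show "\<forall>A\<in>Pow I - Pow ?J. (if ?I \<inter> A = {} then wt I \<pi> A * v A else 0) = 0"
          using split(4)[OF T] by (auto; blast)
      qed (use split[OF T] finI in auto)
      also have "\<dots> = (\<Sum>A\<in>Pow ?J. g T * (wt ?J \<pi> A * v A))"
      proof (rule sum.cong[OF refl])
        fix A assume "A \<in> Pow ?J"
        then have "wt (?J \<union> ?I) \<pi> (A \<union> {}) = wt ?J \<pi> A * wt ?I \<pi> {}"
          by (intro wt_Un split T) auto
        then show "wt I \<pi> A * v A = g T * (wt ?J \<pi> A * v A)"
          unfolding split(4)[OF T] g_def by simp
      qed
      finally show "(\<Sum>A\<in>Pow I. if ?I \<inter> A = {} then wt I \<pi> A * v A else 0) = g T * (\<Sum>A\<in>Pow ?J. wt ?J \<pi> A * v A)"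
        by (simp add: sum_distrib_left)
    qed
    finally show ?thesis .
  qed
  have g0: "0 \<le> g T" for T unfolding g_def by (rule wt_nn) simp
  define Z where "Z = (\<Sum>T\<in>\<T>. g T)"
  have Z: "Z > 0"
  proof -
    have "{} \<in> \<T>" by (simp add: \<T>_def indep_def)
    then have "g {} \<le> Z" unfolding Z_def by (intro member_le_sum) (use g0 fin\<T> in auto)
    then show ?thesis by (simp add: g_def wt_def)
  qed
  have QZ: "(\<Sum>A\<in>Pow I. Q A) = Z"
    using Qv[of "\<lambda>_. 1"] split(2) unfolding Z_def \<T>_def
    by (auto intro!: sum.cong simp: sum_wt)
  let ?pE = "\<Sum>A\<in>Pow I. wt I \<pi> A * of_bool (E A)"
  \<comment> \<open>For fixed \<open>T\<close>, erasing its blocks from a product-distributed set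
    leaves the product law on the other blocks and turns \<open>E\<close> into \<open>U\<close>; the
    erased contents \<open>C\<close> have total weight 1.\<close>
  have lower: "?pE * Z \<le> (\<Sum>A\<in>Pow I. Q A * u A)"
    unfolding Qv Z_def mult.commute[of ?pE] sum_distrib_right[of g]
  proof (intro sum_mono mult_left_mono g0)
    fix T assume "T \<in> \<T>"
    then have T: "T \<subseteq> B" "indep T" by (auto simp: \<T>_def)
    let ?J = "\<Union>(cells ` (B - T))" and ?I = "\<Union>(cells ` T)"
    have "?pE = (\<Sum>A\<in>Pow (?J \<union> ?I). wt (?J \<union> ?I) \<pi> A * of_bool (E A))"
      unfolding split(4)[OF T(1)] ..
    also have "\<dots> = (\<Sum>A\<in>Pow ?J. \<Sum>C\<in>Pow ?I. wt (?J \<union> ?I) \<pi> (A \<union> C) * of_bool (E (A \<union> C)))"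
      by (intro sum_Pow_Un split T)
    also have "\<dots> \<le> (\<Sum>A\<in>Pow ?J. \<Sum>C\<in>Pow ?I. wt ?J \<pi> A * u A * wt ?I \<pi> C)"
    proof (intro sum_mono)
      fix A C assume AC: "A \<in> Pow ?J" "C \<in> Pow ?I"
      have "wt (?J \<union> ?I) \<pi> (A \<union> C) = wt ?J \<pi> A * wt ?I \<pi> C"
        by (intro wt_Un split T) (use AC in auto)
      moreover have "of_bool (E (A \<union> C)) \<le> u A"
      proof -
        have "A \<union> C \<subseteq> ?J \<union> ?I" using AC by (intro Un_mono) simp_all
        then have AC': "A \<union> C \<subseteq> \<Union>(cells ` B)" using split(4)[OF T(1)] unfolding I_def by (simp only:)
        have "U (A \<union> C - ?I)" if E: "E (A \<union> C)" by (rule EU[OF AC' E T])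
        moreover have "A \<union> C - ?I = A" using AC split(3)[OF T(1)] by (auto simp del: UN_simps)
        ultimately show ?thesis by (simp add: u_def)
      qed
      moreover have "0 \<le> wt ?J \<pi> A * wt ?I \<pi> C" using AC by (intro mult_nonneg_nonneg wt_nn) auto
      ultimately show "wt (?J \<union> ?I) \<pi> (A \<union> C) * of_bool (E (A \<union> C)) \<le> wt ?J \<pi> A * u A * wt ?I \<pi> C"
        using mult_left_mono by (fastforce simp: mult_ac)
    qed
    also have "\<dots> = (\<Sum>A\<in>Pow ?J. wt ?J \<pi> A * u A)"
      using sum_wt[OF split(1)[OF T(1)], of \<pi>] by (simp add: sum_distrib_left[symmetric])
    finally show "?pE \<le> (\<Sum>A\<in>Pow ?J. wt ?J \<pi> A * u A)" .
  qed
  have upper: "(\<Sum>A\<in>Pow I. Q A * u A) \<le> (\<Sum>A\<in>Pow I. Q A) * (\<Sum>A\<in>Pow I. wt I \<pi>' A * u A)"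
    unfolding I_def
  proof (rule block_domination[where \<pi> = \<pi> and \<kappa> = "\<kappa> / 2 ^ K" and \<theta> = "1 / 2 ^ K"])
    fix A A' :: "'a set" assume "A \<subseteq> A'" then show "u A \<le> u A'" using mono by (auto simp: u_def)
  next
    fix b A assume b: "b \<in> B" and A: "A \<subseteq> \<Union> (cells ` (B - {b}))"
    let ?s = "\<lambda>\<rho>. \<Sum>C\<in>Pow (cells b). wt (cells b) \<rho> C * of_bool (U (A \<union> C))"
    have disjA: "A \<inter> cells b = {}" using A b disj by fastforce
    show "(\<Sum>C\<in>Pow (cells b). wt (cells b) \<pi> C * (u (A \<union> C) - u A))
        \<le> (1 + \<kappa> / 2 ^ K) * (\<Sum>C\<in>Pow (cells b). wt (cells b) \<pi>' C * (u (A \<union> C) - u A))"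
    \<comment> \<open>If \<open>U A\<close> holds, all increments vanish. Otherwise they are the
      values of \<open>u (A \<union> C)\<close> themselves, to which the thinning of certificates
      applies, and \<open>qk\<close> absorbs the factor \<open>q ^ k\<close>.\<close>
    proof (cases "U A")
      case True
      then have "U (A \<union> C)" for C using mono by blast
      then show ?thesis using True by (simp add: u_def)
    next
      case False
      have nn: "0 \<le> ?s \<pi>" by (intro sum_nonneg mult_nonneg_nonneg wt_nn) auto
      have le: "q ^ k * ?s \<pi> \<le> ?s \<pi>'"
      proof (rule certificate_thinning)
        fix C assume C: "C \<subseteq> cells b" "U (A \<union> C)"
        have sub: "A \<union> C \<subseteq> \<Union>(cells ` B)" using A C b by blast
        obtain D where D: "D \<subseteq> (A \<union> C) \<inter> cells b" "card D \<le> k" "U ((A \<union> C - cells b) \<union> D)"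
          using cert[OF sub C(2) b] by blast
        have "U (A \<union> X)" if "D \<subseteq> X" for X
          by (rule mono[OF D(3)]) (use that C in auto)
        then show "\<exists>D\<subseteq>C. card D \<le> k \<and> (\<forall>X. D \<subseteq> X \<longrightarrow> U (A \<union> X))"
          using D disjA by (intro exI[of _ D]) auto
      qed (use fin b q pi pi' in auto)
      have "?s \<pi> \<le> ((1 + \<kappa> / 2 ^ K) * q ^ k) * ?s \<pi>" using mult_right_mono[OF qk nn] by simp
      also have "\<dots> \<le> (1 + \<kappa> / 2 ^ K) * ?s \<pi>'"
        unfolding mult.assoc by (intro mult_left_mono le) (use \<kappa>(1) in simp)
      finally show ?thesis using False by (simp add: u_def)
    qed
  next
    fix b A assume b: "b \<in> B" and A: "A \<subseteq> \<Union> (cells ` (B - {b}))"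
    have disjA: "A \<inter> cells b = {}" using A b disj by fastforce
    define S0 where "S0 = {T \<in> \<T>. b \<notin> T \<and> \<Union>(cells ` T) \<inter> A = {}}"
    define S1 where "S1 = {T \<in> \<T>. b \<in> T \<and> \<Union>(cells ` T) \<inter> A = {}}"
    define N where "N = {b' \<in> B. conf b b'}"
    have finS: "finite S0" "finite S1" "finite N"
      using fin\<T> finB unfolding S0_def S1_def N_def by auto
    \<comment> \<open>Adding \<open>b\<close> to \<open>T\<close> forces the blocks in conflict with
      it to be dropped. Recording the dropped ones, a subset of \<open>N\<close>, makes the map
      injective; this is the origin of \<open>2 ^ K\<close>.\<close>
    have "card S0 \<le> card (S1 \<times> Pow N)"
    proof (rule card_inj_on_le[where f = "\<lambda>T. (insert b (T - N), T \<inter> N)"])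
      show "inj_on (\<lambda>T. (insert b (T - N), T \<inter> N)) S0"
        unfolding inj_on_def S0_def by (auto; blast)
      show "(\<lambda>T. (insert b (T - N), T \<inter> N)) ` S0 \<subseteq> S1 \<times> Pow N"
        using b disjA sym unfolding S0_def S1_def \<T>_def indep_def N_def by (auto; blast)
    qed (use finS in auto)
    also have "\<dots> = card S1 * 2 ^ card N" using finS by (simp add: card_cartesian_product card_Pow)
    also have "\<dots> \<le> card S1 * 2 ^ K" using deg[OF b] unfolding N_def by (intro mult_left_mono power_increasing) auto
    finally have "real (card S0) \<le> real (card S1) * 2 ^ K"
      by (metis of_nat_le_iff of_nat_mult of_nat_numeral of_nat_power)
    then have S01: "real (card S0) / 2 ^ K \<le> real (card S1)" by (simp add: divide_simps)
    have hA: "h A = card S0 + card S1"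
    proof -
      have "{T \<in> \<T>. \<Union>(cells ` T) \<inter> A = {}} = S0 \<union> S1" unfolding S0_def S1_def by auto
      then show ?thesis unfolding h_def using finS by (simp add: card_Un_disjoint S0_def S1_def disjoint_iff)
    qed
    \<comment> \<open>A point in block \<open>b\<close>, wherever it lies there, excludes exactly
      the families containing \<open>b\<close>, so the count does not depend on the nonempty set
      \<open>C\<close>.\<close>
    have hAC: "h (A \<union> C) = card S0" if C: "C \<subseteq> cells b" "C \<noteq> {}" for C
    proof -
      have "\<Union>(cells ` T) \<inter> (A \<union> C) = {} \<longleftrightarrow> b \<notin> T \<and> \<Union>(cells ` T) \<inter> A = {}" if T: "T \<subseteq> B" for T
      proof
        assume *: "\<Union>(cells ` T) \<inter> (A \<union> C) = {}"
        then have "b \<notin> T" using C by fastforce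
        then show "b \<notin> T \<and> \<Union>(cells ` T) \<inter> A = {}" using * by auto
      next
        assume *: "b \<notin> T \<and> \<Union>(cells ` T) \<inter> A = {}"
        have "cells b' \<inter> C = {}" if "b' \<in> T" for b'
          using disj[of b' b] that T b * C by blast
        then show "\<Union>(cells ` T) \<inter> (A \<union> C) = {}" using * by blast
      qed
      then have "{T \<in> \<T>. \<Union>(cells ` T) \<inter> (A \<union> C) = {}} = S0"
        unfolding S0_def \<T>_def by blast
      then show ?thesis by (simp add: h_def)
    qed
    let ?J = "\<Union>(cells ` (B - {b}))"
    have sb: "finite (cells b)" "finite ?J" "?J \<inter> cells b = {}" "?J \<union> cells b = I"
      using split[of "{b}"] b by auto
    have w: "wt I \<pi> (A \<union> C) = wt ?J \<pi> A * wt (cells b) \<pi> C" if "C \<subseteq> cells b" for C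
      using wt_Un[OF sb(2,1,3) A that] unfolding sb(4) .
    show "\<exists>q\<ge>0. (\<forall>C\<subseteq>cells b. C \<noteq> {} \<longrightarrow> Q (A \<union> C) = wt (cells b) \<pi> C * q) \<and>
        wt (cells b) \<pi> {} * (1 + 1 / 2 ^ K) * q \<le> Q A"
    proof (intro exI[of _ "wt ?J \<pi> A * card S0"] conjI allI impI)
      show "0 \<le> wt ?J \<pi> A * card S0" using A by (intro mult_nonneg_nonneg wt_nn) auto
      show "Q (A \<union> C) = wt (cells b) \<pi> C * (wt ?J \<pi> A * card S0)" if "C \<subseteq> cells b" "C \<noteq> {}" for C
        unfolding Q_def using w[OF that(1)] hAC[OF that] by simp
      have "(wt (cells b) \<pi> {} * wt ?J \<pi> A) * ((1 + 1 / 2 ^ K) * card S0) \<le> (wt (cells b) \<pi> {} * wt ?J \<pi> A) * h A"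
        using S01 A by (intro mult_left_mono mult_nonneg_nonneg wt_nn) (auto simp: hA algebra_simps)
      then show "wt (cells b) \<pi> {} * (1 + 1 / 2 ^ K) * (wt ?J \<pi> A * card S0) \<le> Q A"
        unfolding Q_def using w[of "{}"] by (simp add: mult_ac)
    qed
  next
    fix b assume "b \<in> B"
    then show "\<kappa> / 2 ^ K \<le> 1 / 2 ^ K * wt (cells b) \<pi> {}"
      using \<kappa>(2) by (simp add: divide_right_mono)
  qed (use assms in auto)
  have "?pE * Z \<le> Z * (\<Sum>A\<in>Pow I. wt I \<pi>' A * u A)"
    using lower upper unfolding QZ by linarith
  then show ?thesis using Z unfolding I_def u_def by (simp add: mult.commute)
qed

section \<open>Simplices and cubes\<close>

definition blk :: "real \<Rightarrow> real^'n \<Rightarrow> int^'n" where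
  "blk s x = (\<chi> i. \<lfloor>x $ i / s\<rfloor>)"

lemma floor_eq_close: "\<lfloor>a\<rfloor> = \<lfloor>b\<rfloor> \<Longrightarrow> \<bar>a - b\<bar> < 1" for a b :: real
  by linarith

lemma floor_diff_le: "\<bar>a - b\<bar> \<le> t \<Longrightarrow> \<bar>\<lfloor>a\<rfloor> - \<lfloor>b\<rfloor>\<bar> \<le> \<lceil>t\<rceil> + 1" for a b t :: real
  by linarith

text \<open>The norm is bounded by the sum of the coordinates, so a cube counts with diameter
  \<open>s * CARD('n)\<close>, the unit in which all later distance losses are measured.\<close>

lemma blk_close:
  fixes x y :: "real^'n"
  assumes "s > 0" "blk s x = blk s y"
  shows "dist x y \<le> s * CARD('n)"
proof -
  have "\<bar>(x - y) $ i\<bar> \<le> s" for i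
  proof -
    have "\<lfloor>x $ i / s\<rfloor> = \<lfloor>y $ i / s\<rfloor>" using assms(2) by (simp add: blk_def vec_eq_iff)
    then have "\<bar>x $ i / s - y $ i / s\<bar> < 1"
      by (rule floor_eq_close)
    then show ?thesis using assms(1) by (simp add: diff_divide_distrib[symmetric])
  qed
  then have "(\<Sum>i\<in>UNIV. \<bar>(x - y) $ i\<bar>) \<le> (\<Sum>i\<in>(UNIV :: 'n set). s)" by (intro sum_mono)
  then show ?thesis using norm_le_l1_cart[of "x - y"] by (simp add: dist_norm mult.commute)
qed

lemma blk_near:
  fixes x y :: "real^'n"
  assumes "s > 0" "dist x y \<le> r"
  shows "\<bar>blk s x $ i - blk s y $ i\<bar> \<le> \<lceil>r / s\<rceil> + 1"
proof -
  have "\<bar>x $ i - y $ i\<bar> \<le> r"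
    using component_le_norm_cart[of "x - y" i] assms(2) by (simp add: dist_norm)
  then have "\<bar>x $ i / s - y $ i / s\<bar> \<le> r / s"
    using assms(1) by (simp add: diff_divide_distrib[symmetric] divide_right_mono)
  then have "\<bar>\<lfloor>x $ i / s\<rfloor> - \<lfloor>y $ i / s\<rfloor>\<bar> \<le> \<lceil>r / s\<rceil> + 1" by (rule floor_diff_le)
  then show ?thesis by (simp add: blk_def)
qed

text \<open>The index at side \<open>s\<close> is the index at side \<open>s / m\<close> divided by
  \<open>m\<close> with rounding down, so the finer cubes are nested in the coarser ones.\<close>

lemma blk_refine:
  fixes x y :: "real^'n"
  assumes "m > 0" "blk (s / real m) x = blk (s / real m) y"
  shows "blk s x = blk s y"
proof -
  have eq: "\<lfloor>z / s\<rfloor> = \<lfloor>z / (s / real m)\<rfloor> div int m" for z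
  proof -
    have "z / s = (z / (s / real m)) / real_of_int (int m)" using assms(1) by simp
    then have "\<lfloor>z / s\<rfloor> = \<lfloor>(z / (s / real m)) / real_of_int (int m)\<rfloor>" by (rule arg_cong)
    also have "\<dots> = \<lfloor>z / (s / real m)\<rfloor> div int m"
      by (rule floor_divide_real_eq_div[OF of_nat_0_le_iff])
    finally show ?thesis .
  qed
  have "\<lfloor>x $ i / s\<rfloor> = \<lfloor>y $ i / s\<rfloor>" for i
  proof -
    have "blk (s / real m) x $ i = blk (s / real m) y $ i" using assms(2) by simp
    then have "\<lfloor>x $ i / (s / real m)\<rfloor> = \<lfloor>y $ i / (s / real m)\<rfloor>" unfolding blk_def vec_lambda_beta .
    then show ?thesis by (simp only: eq[of "x $ i"] eq[of "y $ i"])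
  qed
  then show ?thesis unfolding blk_def vec_eq_iff by simp
qed

lemma blk_corner: "s > 0 \<Longrightarrow> blk s (\<chi> i. s * real_of_int (w $ i)) = w"
  by (simp add: blk_def vec_eq_iff)

lemma finite_int_box: "finite {w :: int^'n. \<forall>i. \<bar>w $ i\<bar> \<le> k}"
proof -
  have "{w :: int^'n. \<forall>i. \<bar>w $ i\<bar> \<le> k} \<subseteq> vec_lambda ` (UNIV \<rightarrow>\<^sub>E {-k..k})"
  proof
    fix w :: "int^'n" assume w: "w \<in> {w. \<forall>i. \<bar>w $ i\<bar> \<le> k}"
    then have "- k \<le> w $ i \<and> w $ i \<le> k" for i using abs_le_iff[of "w $ i" k] by force
    then show "w \<in> vec_lambda ` (UNIV \<rightarrow>\<^sub>E {-k..k})"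
      by (intro image_eqI[of _ _ "vec_nth w"]) (auto simp: vec_nth_inverse)
  qed
  then show ?thesis by (rule finite_subset) (simp add: finite_PiE)
qed

lemma int_box_translate:
  fixes b :: "int^'n"
  shows "finite {w. \<forall>i. \<bar>w $ i - b $ i\<bar> \<le> k}"
    and "card {w. \<forall>i. \<bar>w $ i - b $ i\<bar> \<le> k} \<le> card {w :: int^'n. \<forall>i. \<bar>w $ i\<bar> \<le> k}"
proof -
  have sub: "{w. \<forall>i. \<bar>w $ i - b $ i\<bar> \<le> k} \<subseteq> (\<lambda>w. w + b) ` {w. \<forall>i. \<bar>w $ i\<bar> \<le> k}"
  proof
    fix x assume "x \<in> {w. \<forall>i. \<bar>w $ i - b $ i\<bar> \<le> k}"
    then show "x \<in> (\<lambda>w. w + b) ` {w. \<forall>i. \<bar>w $ i\<bar> \<le> k}"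
      by (intro image_eqI[of _ _ "x - b"]) simp_all
  qed
  show "finite {w. \<forall>i. \<bar>w $ i - b $ i\<bar> \<le> k}"
    by (rule finite_surj[OF finite_int_box sub])
  show "card {w. \<forall>i. \<bar>w $ i - b $ i\<bar> \<le> k} \<le> card {w :: int^'n. \<forall>i. \<bar>w $ i\<bar> \<le> k}"
    by (rule surj_card_le[OF finite_int_box sub])
qed

section \<open>Paths of points, blocks and simplices, and their crossing events\<close>

definition loc_finite :: "(real^'n) set \<Rightarrow> bool" where
  "loc_finite \<omega> \<longleftrightarrow> (\<forall>r. finite (\<omega> \<inter> cball 0 r))"

text \<open>Consecutive simplices of a face path share a vertex, so the path descends to a path of
  points with steps of length at most 1.\<close>

definition pstep :: "nat \<Rightarrow> (real^'n) set \<Rightarrow> ((real^'n) \<times> (real^'n)) set" where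
  "pstep d \<omega> = {(x, y). \<exists>V. simplex_verts d \<omega> V \<and> x \<in> V \<and> y \<in> V}"

text \<open>Goodness of a block is certified by the \<open>d + 1\<close> vertices of a single
  simplex, which may lie mostly in other blocks.\<close>

definition good :: "nat \<Rightarrow> real \<Rightarrow> (real^'n) set \<Rightarrow> int^'n \<Rightarrow> bool" where
  "good d s \<omega> b \<longleftrightarrow> (\<exists>V. simplex_verts d \<omega> V \<and> b \<in> blk s ` V)"

text \<open>\<open>x\<close> and \<open>y\<close> are arbitrary points of space, not points of
  \<open>\<omega>\<close>. The relation thus depends on \<open>\<omega>\<close> only through the set
  of good blocks, which gives monotonicity and small certificates.\<close>

definition bstep :: "nat \<Rightarrow> real \<Rightarrow> real \<Rightarrow> (real^'n) set \<Rightarrow> ((int^'n) \<times> (int^'n)) set" where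
  "bstep d s \<rho> \<omega> = {(b, c). good d s \<omega> b \<and> good d s \<omega> c \<and>
     (\<exists>x y. blk s x = b \<and> blk s y = c \<and> dist x y \<le> \<rho>)}"

text \<open>Stated for vertex sets and not for simplices, because vertex sets can be transported
  along a map of points.\<close>

definition sstep :: "nat \<Rightarrow> real \<Rightarrow> (real^'n) set \<Rightarrow> ((real^'n) set \<times> (real^'n) set) set" where
  "sstep d r \<omega> = {(V, W). simplex_verts d \<omega> V \<and> simplex_verts d \<omega> W \<and>
     setdist (convex hull V) (convex hull W) \<le> r}"

definition face_crosses :: "nat \<Rightarrow> real \<Rightarrow> real \<Rightarrow> (real^'n) set \<Rightarrow> bool" where
  "face_crosses d j n \<omega> \<longleftrightarrow> (\<exists>x y. x \<in> \<omega> \<and> norm x \<le> j \<and> n \<le> norm y \<and> (x, y) \<in> (pstep d \<omega>)\<^sup>*)"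

definition block_crosses :: "nat \<Rightarrow> real \<Rightarrow> real \<Rightarrow> real \<Rightarrow> real \<Rightarrow> (real^'n) set \<Rightarrow> bool" where
  "block_crosses d s \<rho> j n \<omega> \<longleftrightarrow> (\<exists>x y. good d s \<omega> (blk s x) \<and> norm x \<le> j \<and> n \<le> norm y \<and>
     (blk s x, blk s y) \<in> (bstep d s \<rho> \<omega>)\<^sup>*)"

definition star_crosses :: "nat \<Rightarrow> real \<Rightarrow> real \<Rightarrow> real \<Rightarrow> (real^'n) set \<Rightarrow> bool" where
  "star_crosses d r j n \<omega> \<longleftrightarrow> (\<exists>V W x y. simplex_verts d \<omega> V \<and> x \<in> V \<and> norm x \<le> j \<and>
     y \<in> W \<and> n \<le> norm y \<and> (V, W) \<in> (sstep d r \<omega>)\<^sup>*)"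

lemma simplex_verts_mono: "simplex_verts d \<omega> V \<Longrightarrow> \<omega> \<subseteq> \<omega>' \<Longrightarrow> simplex_verts d \<omega>' V"
  by (auto simp: simplex_verts_def)

lemma simplex_verts_restrict: "simplex_verts d \<omega> V \<Longrightarrow> V \<subseteq> A \<Longrightarrow> simplex_verts d (\<omega> \<inter> A) V"
  unfolding simplex_verts_def by blast

lemma simplex_verts_dist: "simplex_verts d \<omega> V \<Longrightarrow> x \<in> V \<Longrightarrow> y \<in> V \<Longrightarrow> dist x y \<le> 1"
  unfolding simplex_verts_def by blast

lemma simplex_verts_ne: "simplex_verts d \<omega> V \<Longrightarrow> V \<noteq> {} \<and> finite V \<and> V \<subseteq> \<omega>"
  unfolding simplex_verts_def by (metis Suc_eq_plus1 card.empty nat.distinct(1))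

lemma good_mono: "good d s \<omega> b \<Longrightarrow> \<omega> \<subseteq> \<omega>' \<Longrightarrow> good d s \<omega>' b"
  unfolding good_def using simplex_verts_mono by blast

lemma bstep_mono: "(\<And>b. good d s \<omega> b \<Longrightarrow> good d s \<omega>' b) \<Longrightarrow> bstep d s \<rho> \<omega> \<subseteq> bstep d s \<rho> \<omega>'"
  unfolding bstep_def by auto

lemma block_crosses_mono_good:
  assumes "block_crosses d s \<rho> j n \<omega>" "\<And>b. good d s \<omega> b \<Longrightarrow> good d s \<omega>' b"
  shows "block_crosses d s \<rho> j n \<omega>'"
proof -
  obtain x y where xy: "good d s \<omega> (blk s x)" "norm x \<le> j" "n \<le> norm y"
    "(blk s x, blk s y) \<in> (bstep d s \<rho> \<omega>)\<^sup>*" using assms(1) unfolding block_crosses_def by blast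
  have "bstep d s \<rho> \<omega> \<subseteq> bstep d s \<rho> \<omega>'" by (rule bstep_mono) (rule assms(2))
  then have "(blk s x, blk s y) \<in> (bstep d s \<rho> \<omega>')\<^sup>*" using xy(4) rtrancl_mono by blast
  then show ?thesis unfolding block_crosses_def using xy(1-3) assms(2) by blast
qed

lemma bstep_good: "(b, c) \<in> (bstep d s \<rho> \<omega>)\<^sup>* \<Longrightarrow> good d s \<omega> b \<Longrightarrow> good d s \<omega> c"
  by (induction rule: rtrancl_induct) (auto simp: bstep_def)

text \<open>A maximal run of simplices meeting erased blocks meets only one of them, so it is bridged by
  two points of surviving simplices that are both within distance 1 of that block.\<close>

lemma erase_blocks:
  fixes \<omega> :: "(real^'n) set" and T :: "(int^'n) set" and s :: real
  assumes s: "s > 0" "s * CARD('n) \<le> 1" and \<rho>: "\<rho> = 2 + s * CARD('n)" and jn: "j + 3 < n"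
    and cr: "face_crosses d j n \<omega>"
    and sep: "\<And>p q. blk s p \<in> T \<Longrightarrow> blk s q \<in> T \<Longrightarrow> dist p q \<le> 2 \<Longrightarrow> blk s p = blk s q"
  shows "block_crosses d s \<rho> (j + 3) (n - 3) {x \<in> \<omega>. blk s x \<notin> T}"
proof -
  define \<omega>' where "\<omega>' = {x \<in> \<omega>. blk s x \<notin> T}"
  obtain x0 y where xy: "x0 \<in> \<omega>" "norm x0 \<le> j" "n \<le> norm y" "(x0, y) \<in> (pstep d \<omega>)\<^sup>*"
    using cr unfolding face_crosses_def by blast
  define W where "W p \<longleftrightarrow> (\<exists>a. norm a \<le> j + 3 \<and> good d s \<omega>' (blk s a) \<and> (blk s a, blk s p) \<in> (bstep d s \<rho> \<omega>')\<^sup>*)" for p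
  define near where "near p Q \<longleftrightarrow> (\<exists>q. blk s q = Q \<and> dist p q \<le> 1)" for p :: "real^'n" and Q
  \<comment> \<open>Invariant along the face path: \<open>p\<close> is the last point reached
    through good blocks, or still the start \<open>x0\<close>, which may itself be erased; the
    current point \<open>v\<close> equals \<open>p\<close> or lies within 1 of the same erased block
    as \<open>p\<close>.\<close>
  define Inv where "Inv v \<longleftrightarrow> (\<exists>p. (p = x0 \<or> W p) \<and> (p = v \<or> (\<exists>Q\<in>T. near p Q \<and> near v Q)))" for v
  have near_dist: "dist p v \<le> \<rho>" if pv: "p = v \<or> (\<exists>Q\<in>T. near p Q \<and> near v Q)" for p v
  proof (cases "p = v")
    case False
    then obtain q q' where q: "blk s q = blk s q'" "dist p q \<le> 1" "dist v q' \<le> 1"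
      using pv unfolding near_def by metis
    have "dist p v \<le> dist p q + dist q q' + dist q' v"
      using dist_triangle[of p v q] dist_triangle[of q v q'] by linarith
    then show ?thesis using q blk_close[OF s(1) q(1)] \<rho> by (simp add: dist_commute)
  qed (use s \<rho> in simp)
  have Wstep: "W q" if Wp: "W p" and gq: "good d s \<omega>' (blk s q)" "dist p q \<le> \<rho>" for p q
  proof -
    obtain a where a: "norm a \<le> j + 3" "good d s \<omega>' (blk s a)" "(blk s a, blk s p) \<in> (bstep d s \<rho> \<omega>')\<^sup>*"
      using Wp unfolding W_def by blast
    have "(blk s p, blk s q) \<in> bstep d s \<rho> \<omega>'"
      using bstep_good[OF a(3,2)] gq unfolding bstep_def by blast
    then show ?thesis using a unfolding W_def by (meson rtrancl.rtrancl_into_rtrancl)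
  qed
  have "Inv y" using xy(4)
  proof (induction rule: rtrancl_induct)
    case base
    show ?case unfolding Inv_def by blast
  next
    case (step v v')
    then obtain V where V: "simplex_verts d \<omega> V" "v \<in> V" "v' \<in> V" unfolding pstep_def by blast
    obtain p where p: "p = x0 \<or> W p" "p = v \<or> (\<exists>Q\<in>T. near p Q \<and> near v Q)"
      using step.IH unfolding Inv_def by blast
    note d1 = simplex_verts_dist[OF V(1)]
    show ?case
    proof (cases "\<forall>x\<in>V. blk s x \<notin> T")
      case True
      then have "simplex_verts d \<omega>' V" using V(1) unfolding simplex_verts_def \<omega>'_def by auto
      then have gd: "good d s \<omega>' (blk s v)" "good d s \<omega>' (blk s v')" using V unfolding good_def by blast+
      have pv: "dist p v \<le> \<rho>" using near_dist[OF p(2)] .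
      \<comment> \<open>If nothing has survived so far, \<open>p\<close> is \<open>x0\<close>, and
        \<open>v\<close> becomes the new starting point with norm at most \<open>j + \<rho>\<close>;
        this explains the shift by 3.\<close>
      have "W v"
      proof (cases "W p")
        case False
        then have "dist x0 v \<le> \<rho>" using p pv by simp
        then have "norm v \<le> j + 3"
          using xy(2) s(2) \<rho> norm_triangle_ineq2[of v x0] by (simp add: dist_norm norm_minus_commute)
        then show ?thesis using gd(1) unfolding W_def by blast
      qed (use Wstep gd(1) pv in blast)
      moreover have "dist v v' \<le> \<rho>" using d1[OF V(2,3)] \<rho> mult_pos_pos[OF s(1), of "real CARD('n)"] by simp
      ultimately have "W v'" using Wstep gd(2) by blast
      then show ?thesis unfolding Inv_def by blast
    next
      case False
      then obtain q where q: "q \<in> V" "blk s q \<in> T" by blast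
      have nr: "near v (blk s q)" "near v' (blk s q)" using d1[OF V(2) q(1)] d1[OF V(3) q(1)]
        unfolding near_def by blast+
      show ?thesis
      proof (cases "p = v")
        case True
        then show ?thesis unfolding Inv_def using p(1) nr q(2) by blast
      next
        case False
        then obtain Q where Q: "Q \<in> T" "near p Q" "near v Q" using p(2) by blast
        then obtain q' where q': "blk s q' = Q" "dist v q' \<le> 1" unfolding near_def by blast
        \<comment> \<open>The block pending since \<open>p\<close> and the block met by the present
          simplex both have points within 1 of \<open>v\<close>. Separation makes them equal, so the
          bridge can go on from the same \<open>p\<close>.\<close>
        have "dist q' q \<le> 2"
          using dist_triangle[of q' q v] q'(2) d1[OF V(2) q(1)] by (simp add: dist_commute)
        then have "blk s q' = blk s q" using sep q(2) q'(1) Q(1) by blast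
        then show ?thesis unfolding Inv_def using p(1) Q nr q'(1) by metis
      qed
    qed
  qed
  then obtain p where p: "p = x0 \<or> W p" "dist p y \<le> \<rho>" using near_dist unfolding Inv_def by blast
  have np: "n - 3 \<le> norm p"
    using p(2) xy(3) s(2) \<rho> norm_triangle_ineq2[of y p] by (simp add: dist_norm norm_minus_commute)
  \<comment> \<open>The alternative \<open>p = x0\<close> is impossible, since the norm of
    \<open>x0\<close> is at most \<open>j\<close>, below \<open>n - 3\<close>.\<close>
  then have "W p" using p(1) xy(2) jn by auto
  then show ?thesis using np unfolding W_def block_crosses_def \<omega>'_def by blast
qed

text \<open>One simplex is fixed for every good block. In block \<open>b\<close> only vertices of
  these simplices matter, and such a simplex belongs to one of the boundedly many blocks with a
  point within 1 of \<open>b\<close>, each contributing at most \<open>d + 1\<close> vertices. The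
  bound is independent of how many points \<open>b\<close> contains.\<close>

lemma block_crosses_certificate:
  fixes \<omega> :: "(real^'n) set"
  assumes s: "s > 0" and cr: "block_crosses d s \<rho> j n \<omega>"
  defines "k0 \<equiv> card {w :: int^'n. \<forall>i. \<bar>w $ i\<bar> \<le> \<lceil>1 / s\<rceil> + 1} * (d + 1)"
  shows "\<exists>A \<subseteq> {x \<in> \<omega>. blk s x = b}. finite A \<and> card A \<le> k0 \<and>
    block_crosses d s \<rho> j n ({x \<in> \<omega>. blk s x \<noteq> b} \<union> A)"
proof -
  have "\<forall>c. \<exists>V. good d s \<omega> c \<longrightarrow> simplex_verts d \<omega> V \<and> c \<in> blk s ` V" unfolding good_def by blast
  then obtain V where V: "\<And>c. good d s \<omega> c \<Longrightarrow> simplex_verts d \<omega> (V c) \<and> c \<in> blk s ` V c" by metis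
  define Nb where "Nb = {c. good d s \<omega> c \<and> (\<exists>x\<in>V c. blk s x = b)}"
  have Nb: "Nb \<subseteq> {w. \<forall>i. \<bar>w $ i - b $ i\<bar> \<le> \<lceil>1 / s\<rceil> + 1}"
  proof (intro subsetI CollectI allI)
    fix c i assume "c \<in> Nb"
    then obtain x y where xy: "x \<in> V c" "blk s x = b" "y \<in> V c" "blk s y = c" "good d s \<omega> c"
      using V unfolding Nb_def by blast
    have "dist y x \<le> 1" using simplex_verts_dist V[OF xy(5)] xy by blast
    then show "\<bar>c $ i - b $ i\<bar> \<le> \<lceil>1 / s\<rceil> + 1" using blk_near[OF s, of y x 1 i] xy by simp
  qed
  have finNb: "finite Nb" using Nb int_box_translate(1) by (rule finite_subset)
  have cardNb: "card Nb \<le> card {w :: int^'n. \<forall>i. \<bar>w $ i\<bar> \<le> \<lceil>1 / s\<rceil> + 1}"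
    using card_mono[OF int_box_translate(1) Nb] int_box_translate(2) order_trans by blast
  define A where "A = (\<Union>c\<in>Nb. V c) \<inter> {x \<in> \<omega>. blk s x = b}"
  have finV: "finite (V c)" "card (V c) = d + 1" if "c \<in> Nb" for c
    using V that unfolding Nb_def simplex_verts_def by auto
  have "card A \<le> card (\<Union>c\<in>Nb. V c)" unfolding A_def using finNb finV by (intro card_mono) auto
  also have "\<dots> \<le> (\<Sum>c\<in>Nb. card (V c))" by (rule card_UN_le[OF finNb])
  also have "\<dots> = card Nb * (d + 1)" using finV by simp
  also have "\<dots> \<le> k0" unfolding k0_def using cardNb by (intro mult_right_mono) auto
  finally have "card A \<le> k0" .
  moreover have "finite A" unfolding A_def using finNb finV by auto
  moreover have "block_crosses d s \<rho> j n ({x \<in> \<omega>. blk s x \<noteq> b} \<union> A)"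
  proof (rule block_crosses_mono_good[OF cr])
    fix c assume c: "good d s \<omega> c"
    have "V c \<subseteq> {x \<in> \<omega>. blk s x \<noteq> b} \<union> A"
      using V[OF c] c unfolding A_def Nb_def simplex_verts_def by auto
    then have "simplex_verts d ({x \<in> \<omega>. blk s x \<noteq> b} \<union> A) (V c)"
      using V[OF c] unfolding simplex_verts_def by auto
    then show "good d s ({x \<in> \<omega>. blk s x \<noteq> b} \<union> A) c" using V[OF c] unfolding good_def by blast
  qed
  ultimately show ?thesis unfolding A_def by (intro exI[of _ A]) (auto simp: A_def)
qed

text \<open>Each good block picks a simplex with a vertex in it. Replacing the two points witnessing
  a block step by these vertices costs one cube diameter at either end, hence
  \<open>\<rho> + 2 * (s * CARD('n))\<close>.\<close>

lemma block_crosses_imp_star: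
  fixes \<omega> :: "(real^'n) set" and s :: real
  assumes s: "s > 0" "s * CARD('n) \<le> 1" and r: "\<rho> + 2 * (s * CARD('n)) \<le> r"
    and cr: "block_crosses d s \<rho> j n \<omega>"
  shows "star_crosses d r (j + 1) (n - 1) \<omega>"
proof -
  have "\<forall>c. \<exists>V. good d s \<omega> c \<longrightarrow> simplex_verts d \<omega> V \<and> c \<in> blk s ` V" unfolding good_def by blast
  then obtain V where V: "\<And>c. good d s \<omega> c \<Longrightarrow> simplex_verts d \<omega> (V c) \<and> c \<in> blk s ` V c" by metis
  obtain x y where xy: "good d s \<omega> (blk s x)" "norm x \<le> j" "n \<le> norm y"
    "(blk s x, blk s y) \<in> (bstep d s \<rho> \<omega>)\<^sup>*" using cr unfolding block_crosses_def by blast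
  have chain: "(V (blk s x), V (blk s y)) \<in> (sstep d r \<omega>)\<^sup>*" using xy(4)
  proof (induction rule: rtrancl_induct)
    case (step b c)
    then have gd: "good d s \<omega> b" "good d s \<omega> c" unfolding bstep_def by auto
    obtain p q where pq: "blk s p = b" "blk s q = c" "dist p q \<le> \<rho>"
      using step.hyps unfolding bstep_def by blast
    obtain p' q' where pq': "p' \<in> V b" "blk s p' = b" "q' \<in> V c" "blk s q' = c" using V gd by blast
    have "dist p' q' \<le> dist p' p + dist p q + dist q q'"
      using dist_triangle[of p' q' p] dist_triangle[of p q' q] by linarith
    also have "\<dots> \<le> r"
      using blk_close[OF s(1), of p' p] blk_close[OF s(1), of q q'] pq pq' r by simp
    finally have "setdist (convex hull (V b)) (convex hull (V c)) \<le> r"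
      using setdist_le_dist[of p' "convex hull (V b)" q' "convex hull (V c)"] pq' hull_inc by fastforce
    then have "(V b, V c) \<in> sstep d r \<omega>" using V gd unfolding sstep_def by blast
    with step.IH show ?case by (rule rtrancl.rtrancl_into_rtrancl)
  qed simp
  obtain x' where x': "x' \<in> V (blk s x)" "blk s x' = blk s x" using V[OF xy(1)] by force
  obtain y' where y': "y' \<in> V (blk s y)" "blk s y' = blk s y"
    using V[OF bstep_good[OF xy(4,1)]] by force
  have "norm x' \<le> j + 1" "n - 1 \<le> norm y'"
    using blk_close[OF s(1) x'(2)] blk_close[OF s(1) y'(2)] s(2) xy(2,3)
      norm_triangle_ineq2[of x' x] norm_triangle_ineq2[of y y']
    by (simp_all add: dist_norm norm_minus_commute)
  then show ?thesis unfolding star_crosses_def using V[OF xy(1)] x' y' chain by blast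
qed

lemma convex_hull_simplex_subset:
  assumes "simplex_verts d \<omega> V" "x \<in> V"
  shows "convex hull V \<subseteq> cball x 1"
  by (rule hull_minimal) (use assms simplex_verts_dist in \<open>auto\<close>)

lemma sstep_near:
  assumes "(V, W) \<in> sstep d r \<omega>" "x \<in> V" "y \<in> W"
  shows "dist x y \<le> r + 2"
proof -
  have VW: "simplex_verts d \<omega> V" "simplex_verts d \<omega> W" "setdist (convex hull V) (convex hull W) \<le> r"
    using assms unfolding sstep_def by auto
  have "compact (convex hull V)" "compact (convex hull W)" "convex hull V \<noteq> {}" "convex hull W \<noteq> {}"
    using simplex_verts_ne VW by (auto intro: finite_imp_compact_convex_hull)
  then obtain p q where pq: "p \<in> convex hull V" "q \<in> convex hull W" "dist p q = setdist (convex hull V) (convex hull W)"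
    using setdist_compact_closed compact_imp_closed by metis
  have "dist x p \<le> 1" "dist y q \<le> 1"
    using convex_hull_simplex_subset[OF VW(1) assms(2)] convex_hull_simplex_subset[OF VW(2) assms(3)] pq by auto
  then show ?thesis
    using pq VW(3) dist_triangle[of x y p] dist_triangle[of p y q] by (simp add: dist_commute)
qed

section \<open>Infinite paths versus crossings to every distance\<close>

lemma infinite_simplices_unbounded:
  fixes V :: "nat \<Rightarrow> (real^'n) set"
  assumes lf: "loc_finite \<omega>" and V: "\<And>i. simplex_verts d \<omega> (V i)" and inj: "inj (\<lambda>i. convex hull V i)"
  shows "\<exists>i. \<exists>y\<in>V i. n \<le> norm y"
proof (rule ccontr)
  assume "\<not> ?thesis"
  then have "V i \<subseteq> \<omega> \<inter> cball 0 n" for i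
    using simplex_verts_ne[OF V[of i]] by (fastforce simp: not_le)
  then have "range V \<subseteq> Pow (\<omega> \<inter> cball 0 n)" by blast
  moreover have "finite (Pow (\<omega> \<inter> cball 0 n))" using lf unfolding loc_finite_def finite_Pow_iff by blast
  ultimately have "finite (range V)" by (rule finite_subset)
  moreover have "inj V" using inj unfolding inj_def by metis
  ultimately show False using finite_imageD by blast
qed

lemma star_percolates_imp_crosses:
  assumes lf: "loc_finite \<omega>" and perc: "star_percolates d r \<omega>"
  shows "\<exists>j::nat. \<forall>n. star_crosses d r j n \<omega>"
proof -
  obtain s where s: "inj s" "\<And>i. s i \<in> simplices d \<omega>" "\<And>i. setdist (s i) (s (Suc i)) \<le> r"
    using perc unfolding star_percolates_def by blast
  then have "\<forall>i. \<exists>V. s i = convex hull V \<and> simplex_verts d \<omega> V" unfolding simplices_def by blast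
  then obtain V where V: "\<And>i. s i = convex hull V i" "\<And>i. simplex_verts d \<omega> (V i)" by metis
  have chain: "(V 0, V i) \<in> (sstep d r \<omega>)\<^sup>*" for i
  proof (induction i)
    case (Suc i)
    have "(V i, V (Suc i)) \<in> sstep d r \<omega>" using V s(3)[of i] unfolding sstep_def by auto
    with Suc show ?case by (rule rtrancl.rtrancl_into_rtrancl)
  qed simp
  obtain x where x: "x \<in> V 0" using simplex_verts_ne[OF V(2)[of 0]] by blast
  obtain j :: nat where j: "norm x \<le> j" using real_arch_simple by blast
  have "star_crosses d r j n \<omega>" for n
  proof -
    have "s = (\<lambda>i. convex hull V i)" by (rule ext) (rule V(1))
    then have "inj (\<lambda>i. convex hull V i)" using s(1) by simp
    from infinite_simplices_unbounded[OF lf V(2) this, of n]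
    obtain i y where "y \<in> V i" "n \<le> norm y" by blast
    then show ?thesis unfolding star_crosses_def using chain[of i] x j V(2)[of 0]
      by (intro exI[of _ "V 0"] exI[of _ "V i"] exI[of _ x] exI[of _ y]) simp
  qed
  then show ?thesis by blast
qed

text \<open>The crossings start from the finitely many simplices meeting the ball of radius
  \<open>j\<close>. If each of these reached only finitely many simplices, everything reached would
  be bounded; so one of them has an infinite component, and \<open>koenig_path\<close> yields a path
  of distinct simplices.\<close>

lemma crosses_imp_star_percolates:
  fixes \<omega> :: "(real^'n) set"
  assumes lf: "loc_finite \<omega>" and cr: "\<And>n::nat. star_crosses d r j n \<omega>"
  shows "star_percolates d r \<omega>"
proof -
  define R where "R = {(\<sigma>, \<tau>). \<sigma> \<in> simplices d \<omega> \<and> \<tau> \<in> simplices d \<omega> \<and> setdist \<sigma> \<tau> \<le> r}"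
  have fin_near: "finite {V. simplex_verts d \<omega> V \<and> V \<subseteq> cball 0 a}" for a
  proof (rule finite_subset)
    show "finite (Pow (\<omega> \<inter> cball 0 a))" using lf unfolding loc_finite_def finite_Pow_iff by blast
  qed (auto simp: simplex_verts_def)
  have finR: "finite (R `` {\<sigma>})" for \<sigma>
  proof (cases "\<sigma> \<in> simplices d \<omega>")
    case True
    then obtain V where V: "\<sigma> = convex hull V" "simplex_verts d \<omega> V" unfolding simplices_def by blast
    obtain x where x: "x \<in> V" using simplex_verts_ne[OF V(2)] by blast
    have "R `` {\<sigma>} \<subseteq> (\<lambda>W. convex hull W) ` {W. simplex_verts d \<omega> W \<and> W \<subseteq> cball 0 (norm x + r + 2)}"
    proof
      fix \<tau> assume "\<tau> \<in> R `` {\<sigma>}"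
      then obtain W where W: "\<tau> = convex hull W" "simplex_verts d \<omega> W" "setdist \<sigma> \<tau> \<le> r"
        unfolding R_def simplices_def by blast
      then have st: "(V, W) \<in> sstep d r \<omega>" using V unfolding sstep_def by blast
      have "norm y \<le> norm x + r + 2" if "y \<in> W" for y
        using sstep_near[OF st x that] norm_triangle_ineq2[of y x]
        by (simp add: dist_norm norm_minus_commute)
      then show "\<tau> \<in> (\<lambda>W. convex hull W) ` {W. simplex_verts d \<omega> W \<and> W \<subseteq> cball 0 (norm x + r + 2)}"
        using W by auto
    qed
    then show ?thesis using fin_near finite_surj by blast
  qed (auto simp: R_def)
  define S where "S = {V. simplex_verts d \<omega> V \<and> (\<exists>x\<in>V. norm x \<le> j)}"
  have finS: "finite S"
  proof (rule finite_subset[OF _ fin_near[of "j + 1"]])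
    show "S \<subseteq> {V. simplex_verts d \<omega> V \<and> V \<subseteq> cball 0 (j + 1)}"
    proof (safe)
      fix V y assume V: "V \<in> S" and y: "y \<in> V"
      then obtain x where "x \<in> V" "norm x \<le> j" "simplex_verts d \<omega> V" unfolding S_def by blast
      then show "y \<in> cball 0 (j + 1)"
        using simplex_verts_dist[of d \<omega> V y x] y norm_triangle_ineq2[of y x] by (simp add: dist_norm)
    qed (simp add: S_def)
  qed
  have "\<exists>V\<in>S. infinite (R\<^sup>* `` {convex hull V})"
  proof (rule ccontr)
    assume "\<not> ?thesis"
    then have finY: "finite (\<Union>V\<in>S. R\<^sup>* `` {convex hull V})" using finS by blast
    have "bounded \<sigma>" if \<sigma>: "\<sigma> \<in> (\<Union>V\<in>S. R\<^sup>* `` {convex hull V})" for \<sigma>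
    proof -
      obtain V where V: "V \<in> S" "(convex hull V, \<sigma>) \<in> R\<^sup>*" using \<sigma> by blast
      from V(2) have "\<sigma> \<in> simplices d \<omega>"
        by (induction rule: rtrancl_induct) (use V(1) in \<open>auto simp: S_def simplices_def R_def\<close>)
      then obtain U where "\<sigma> = convex hull U" "simplex_verts d \<omega> U" unfolding simplices_def by blast
      then show ?thesis using simplex_verts_ne by (metis bounded_convex_hull finite_imp_bounded)
    qed
    then have "bounded (\<Union>(\<Union>V\<in>S. R\<^sup>* `` {convex hull V}))" by (intro bounded_Union finY) auto
    then obtain M where M: "\<And>y. y \<in> \<Union>(\<Union>V\<in>S. R\<^sup>* `` {convex hull V}) \<Longrightarrow> norm y \<le> M"
      unfolding bounded_iff by blast
    obtain n :: nat where n: "M < n" using reals_Archimedean2 by blast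
    obtain V W x y where VW: "simplex_verts d \<omega> V" "x \<in> V" "norm x \<le> j" "y \<in> W" "n \<le> norm y"
      "(V, W) \<in> (sstep d r \<omega>)\<^sup>*" using cr[of n] unfolding star_crosses_def by blast
    from VW(6) have "(convex hull V, convex hull W) \<in> R\<^sup>*"
    proof (induction rule: rtrancl_induct)
      case (step U W)
      then have "(convex hull U, convex hull W) \<in> R" unfolding sstep_def R_def simplices_def by blast
      with step.IH show ?case by (rule rtrancl.rtrancl_into_rtrancl)
    qed simp
    moreover have "V \<in> S" using VW unfolding S_def by blast
    moreover have "y \<in> convex hull W" using VW(4) by (rule hull_inc)
    ultimately have "norm y \<le> M" by (intro M) blast
    then show False using n VW(5) by simp
  qed
  then obtain f :: "nat \<Rightarrow> (real^'n) set" where "inj f" "\<And>i. (f i, f (Suc i)) \<in> R"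
    using koenig_path[of R, OF finR] by blast
  then show ?thesis unfolding star_percolates_def R_def by blast
qed

text \<open>\<open>face_adj\<close> equates hulls, and without general position equal hulls need not
  come from equal vertex sets. An extreme point of the common hull, however, belongs to every set
  spanning it.\<close>

lemma common_vertex:
  fixes F G :: "(real^'n) set"
  assumes "finite F" "F \<noteq> {}" "convex hull F = convex hull G"
  shows "F \<inter> G \<noteq> {}"
proof -
  obtain x where x: "x extreme_point_of (convex hull F)"
    using extreme_point_exists_convex[of "convex hull F"] assms
    by (metis convex_convex_hull convex_hull_eq_empty finite_imp_compact_convex_hull)
  then have "x \<in> F" "x \<in> G" using extreme_point_of_convex_hull assms(3) by metis+
  then show ?thesis by blast
qed

lemma face_percolates_reach:
  fixes \<omega> :: "(real^'n) set"
  assumes lf: "loc_finite \<omega>" and d: "1 \<le> d" and perc: "face_percolates d \<omega>"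
  shows "\<exists>x\<in>\<omega>. \<forall>n. \<exists>y. n \<le> norm y \<and> (x, y) \<in> (pstep d \<omega>)\<^sup>*"
proof -
  obtain s where s: "inj s" "\<And>i. face_adj d \<omega> (s i) (s (Suc i))"
    using perc unfolding face_percolates_def by blast
  have "\<forall>i. \<exists>V W. simplex_verts d \<omega> V \<and> simplex_verts d \<omega> W \<and> s i = convex hull V \<and>
      s (Suc i) = convex hull W \<and> V \<inter> W \<noteq> {}"
  proof
    fix i
    obtain V W F G where VW: "simplex_verts d \<omega> V" "simplex_verts d \<omega> W" "s i = convex hull V"
      "s (Suc i) = convex hull W" "F \<subseteq> V" "G \<subseteq> W" "card F = d" "convex hull F = convex hull G"
      using s(2)[of i] unfolding face_adj_def by blast
    have "finite F" "F \<noteq> {}" using VW(7) d card.infinite by fastforce+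
    then have "F \<inter> G \<noteq> {}" using common_vertex VW(8) by blast
    then show "\<exists>V W. simplex_verts d \<omega> V \<and> simplex_verts d \<omega> W \<and> s i = convex hull V \<and>
      s (Suc i) = convex hull W \<and> V \<inter> W \<noteq> {}" using VW by blast
  qed
  then obtain V W where V: "\<And>i. simplex_verts d \<omega> (V i)" "\<And>i. s i = convex hull V i"
    and W: "\<And>i. simplex_verts d \<omega> (W i)" "\<And>i. s (Suc i) = convex hull W i" "\<And>i. V i \<inter> W i \<noteq> {}"
    by metis
  obtain x where x: "x \<in> V 0" using simplex_verts_ne[OF V(1)[of 0]] by blast
  have chain: "\<forall>y\<in>V i. (x, y) \<in> (pstep d \<omega>)\<^sup>*" for i
  proof (induction i)
    case 0
    then show ?case using x V(1)[of 0] unfolding pstep_def by blast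
  next
    case (Suc i)
    obtain p where p: "p \<in> V i" "p \<in> W i" using W(3) by blast
    \<comment> \<open>The same simplex may be given by different vertex sets in two consecutive
      adjacencies; these share a vertex too.\<close>
    have "W i \<inter> V (Suc i) \<noteq> {}"
      by (rule common_vertex) (use simplex_verts_ne[OF W(1)] V(2) W(2) in metis)+
    then obtain q where q: "q \<in> W i" "q \<in> V (Suc i)" by blast
    have "(x, q) \<in> (pstep d \<omega>)\<^sup>*"
      using Suc p q W(1)[of i] unfolding pstep_def by (blast intro: rtrancl.rtrancl_into_rtrancl)
    then show ?case
      using q V(1)[of "Suc i"] unfolding pstep_def by (blast intro: rtrancl.rtrancl_into_rtrancl)
  qed
  have "\<exists>y. n \<le> norm y \<and> (x, y) \<in> (pstep d \<omega>)\<^sup>*" for n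
  proof -
    have "s = (\<lambda>i. convex hull V i)" by (rule ext) (rule V(2))
    then have "inj (\<lambda>i. convex hull V i)" using s(1) by simp
    from infinite_simplices_unbounded[OF lf V(1) this, of n]
    obtain i y where "y \<in> V i" "n \<le> norm y" by blast
    then show ?thesis using chain by blast
  qed
  moreover have "x \<in> \<omega>" using x simplex_verts_ne[OF V(1)[of 0]] by blast
  ultimately show ?thesis by blast
qed

lemma face_percolates_imp_crosses:
  fixes \<omega> :: "(real^'n) set"
  assumes lf: "loc_finite \<omega>" and d: "1 \<le> d" and perc: "face_percolates d \<omega>"
  shows "\<exists>j::nat. \<forall>n. face_crosses d j n \<omega>"
proof -
  obtain x where x: "x \<in> \<omega>" "\<And>n. \<exists>y. n \<le> norm y \<and> (x, y) \<in> (pstep d \<omega>)\<^sup>*"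
    using face_percolates_reach[OF assms] by blast
  obtain j :: nat where "norm x \<le> j" using real_arch_simple by blast
  then have "face_crosses d j n \<omega>" for n using x unfolding face_crosses_def by blast
  then show ?thesis by blast
qed

text \<open>A crossing may be stopped at its first point of norm at least \<open>n\<close>. Each
  simplex used until then has a vertex of norm below \<open>n\<close> and diameter at most 1, hence
  the radius \<open>n + 1\<close>.\<close>

lemma face_crosses_local:
  assumes "face_crosses d j n \<omega>" "j \<le> n" "cball 0 (n + 1) \<subseteq> A"
  shows "face_crosses d j n (\<omega> \<inter> A)"
proof -
  obtain x y where xy: "x \<in> \<omega>" "norm x \<le> j" "n \<le> norm y" "(x, y) \<in> (pstep d \<omega>)\<^sup>*"
    using assms(1) unfolding face_crosses_def by blast
  have "norm v < n \<and> (x, v) \<in> (pstep d (\<omega> \<inter> A))\<^sup>* \<or> (\<exists>v. n \<le> norm v \<and> (x, v) \<in> (pstep d (\<omega> \<inter> A))\<^sup>*)"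
    if "(x, v) \<in> (pstep d \<omega>)\<^sup>*" for v
    using that
  proof (induction rule: rtrancl_induct)
    case base
    then show ?case by (cases "norm x < n") (simp, intro disjI2 exI[of _ x], simp)
  next
    case (step v v')
    show ?case
    proof (cases "norm v < n \<and> (x, v) \<in> (pstep d (\<omega> \<inter> A))\<^sup>*")
      case True
      obtain V where V: "simplex_verts d \<omega> V" "v \<in> V" "v' \<in> V" using step unfolding pstep_def by blast
      have "V \<subseteq> A"
      proof
        fix z assume "z \<in> V"
        then have "norm z \<le> n + 1"
          using simplex_verts_dist[OF V(1) _ V(2), of z] norm_triangle_ineq2[of z v] True by (simp add: dist_norm)
        then show "z \<in> A" using assms(3) by auto
      qed
      then have "(v, v') \<in> pstep d (\<omega> \<inter> A)"
        using simplex_verts_restrict[OF V(1)] V unfolding pstep_def by blast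
      then have "(x, v') \<in> (pstep d (\<omega> \<inter> A))\<^sup>*" using True by (meson rtrancl.rtrancl_into_rtrancl)
      then show ?thesis by (cases "norm v' < n") (simp, intro disjI2 exI[of _ v'], simp)
    qed (use step.IH in blast)
  qed
  from this[OF xy(4)] obtain v where "n \<le> norm v" "(x, v) \<in> (pstep d (\<omega> \<inter> A))\<^sup>*" using xy(3) by auto
  moreover have "x \<in> A" using assms(2,3) xy(2) by auto
  ultimately show ?thesis unfolding face_crosses_def using xy by blast
qed

text \<open>Stopping argument as for faces; vertices of star-adjacent simplices are at distance at
  most \<open>r + 2\<close>, which enlarges the radius.\<close>

lemma star_crosses_local:
  assumes "star_crosses d r j n \<omega>" "j \<le> n" "0 \<le> r" "cball 0 (n + r + 2) \<subseteq> A"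
  shows "star_crosses d r j n (\<omega> \<inter> A)"
proof -
  obtain V W x y where VW: "simplex_verts d \<omega> V" "x \<in> V" "norm x \<le> j" "y \<in> W" "n \<le> norm y"
    "(V, W) \<in> (sstep d r \<omega>)\<^sup>*" using assms(1) unfolding star_crosses_def by blast
  have far: "U \<subseteq> A" if "\<And>u. u \<in> U \<Longrightarrow> norm u \<le> n + r + 2" for U :: "(real^'a) set"
    using assms(4) that by (auto intro!: subsetD[OF assms(4)])
  have V': "simplex_verts d (\<omega> \<inter> A) V"
  proof (rule simplex_verts_restrict[OF VW(1) far])
    fix u assume "u \<in> V"
    then show "norm u \<le> n + r + 2"
      using simplex_verts_dist[OF VW(1) _ VW(2), of u] norm_triangle_ineq2[of u x] VW(3) assms(2,3)
      by (simp add: dist_norm)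
  qed
  have "(\<forall>u\<in>W. norm u < n) \<and> simplex_verts d (\<omega> \<inter> A) W \<and> (V, W) \<in> (sstep d r (\<omega> \<inter> A))\<^sup>* \<or>
      (\<exists>W. (\<exists>u\<in>W. n \<le> norm u) \<and> (V, W) \<in> (sstep d r (\<omega> \<inter> A))\<^sup>*)"
    if "(V, W) \<in> (sstep d r \<omega>)\<^sup>*" for W
    using that
  proof (induction rule: rtrancl_induct)
    case base
    then show ?case using V' by (cases "\<forall>u\<in>V. norm u < n") (auto simp: not_less)
  next
    case (step U W)
    show ?case
    proof (cases "(\<forall>u\<in>U. norm u < n) \<and> simplex_verts d (\<omega> \<inter> A) U \<and> (V, U) \<in> (sstep d r (\<omega> \<inter> A))\<^sup>*")
      case True
      obtain u where u: "u \<in> U" using simplex_verts_ne True by blast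
      have W: "simplex_verts d (\<omega> \<inter> A) W"
      proof (rule simplex_verts_restrict[OF _ far])
        show "simplex_verts d \<omega> W" using step unfolding sstep_def by blast
        fix w assume "w \<in> W"
        then have "dist u w \<le> r + 2" using sstep_near step u by blast
        then show "norm w \<le> n + r + 2"
          using norm_triangle_ineq2[of w u] True u by (fastforce simp: dist_norm norm_minus_commute)
      qed
      then have "(U, W) \<in> sstep d r (\<omega> \<inter> A)" using step True unfolding sstep_def by blast
      then have "(V, W) \<in> (sstep d r (\<omega> \<inter> A))\<^sup>*" using True by (meson rtrancl.rtrancl_into_rtrancl)
      then show ?thesis using W by (cases "\<forall>u\<in>W. norm u < n") (auto simp: not_less)
    qed (use step.IH in blast)
  qed
  from this[OF VW(6)] have "\<exists>W. (\<exists>u\<in>W. n \<le> norm u) \<and> (V, W) \<in> (sstep d r (\<omega> \<inter> A))\<^sup>*"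
  proof (elim disjE conjE)
    assume "\<forall>u\<in>W. norm u < n"
    then show ?thesis using VW(4,5) by (simp add: not_le[symmetric])
  qed
  then obtain W u where "u \<in> W" "n \<le> norm u" "(V, W) \<in> (sstep d r (\<omega> \<inter> A))\<^sup>*" by blast
  then show ?thesis unfolding star_crosses_def using V' VW(2,3)
    by (intro exI[of _ V] exI[of _ W] exI[of _ x] exI[of _ u]) simp
qed

section \<open>Poisson processes and mesh approximation\<close>

text \<open>If for arbitrarily fine meshes some configuration with the same occupied cells satisfies a limit-closed
  \<open>F\<close>, then so does the configuration itself.\<close>

definition limit_closed :: "((real^'n) set \<Rightarrow> bool) \<Rightarrow> bool" where
  "limit_closed F \<longleftrightarrow> (\<forall>\<omega>. finite \<omega> \<longrightarrow> (\<exists>\<epsilon>>0. \<forall>\<omega>' g. bij_betw g \<omega>' \<omega> \<longrightarrow>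
     (\<forall>x\<in>\<omega>'. dist x (g x) < \<epsilon>) \<longrightarrow> F \<omega>' \<longrightarrow> F \<omega>))"

text \<open>Finitely many violations of a non-strict inequality have a common positive margin.
  Simplex conditions, norms and ranges are all of this non-strict kind, so small moves of the points
  cannot create a crossing that is not already there.\<close>

lemma finite_gap:
  fixes S :: "real set"
  assumes "finite S"
  shows "\<exists>\<epsilon>>0. \<forall>t\<in>S. t \<le> a + \<epsilon> \<longrightarrow> t \<le> a"
  using assms
proof (induction S rule: finite_induct)
  case (insert t S)
  then obtain e where e: "e > 0" "\<forall>t\<in>S. t \<le> a + e \<longrightarrow> t \<le> a" by blast
  define e' where "e' = (if t \<le> a then e else min e ((t - a) / 2))"
  have "e' > 0" "e' \<le> e" using e(1) by (auto simp: e'_def)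
  moreover have "t \<le> a + e' \<longrightarrow> t \<le> a" by (auto simp: e'_def min_def field_simps)
  moreover have "t' \<le> a" if "t' \<in> S" "t' \<le> a + e'" for t'
    using e(2) that \<open>e' \<le> e\<close> by fastforce
  ultimately show ?case by blast
qed (auto intro: exI[of _ 1])

lemma simplex_verts_gap:
  fixes \<omega> :: "(real^'n) set"
  assumes "finite \<omega>"
  shows "\<exists>\<epsilon>>0. \<forall>\<omega>' g V. bij_betw g \<omega>' \<omega> \<longrightarrow> (\<forall>x\<in>\<omega>'. dist x (g x) < \<epsilon>) \<longrightarrow>
    simplex_verts d \<omega>' V \<longrightarrow> simplex_verts d \<omega> (g ` V)"
proof -
  obtain e where e: "e > 0" "\<And>x y. x \<in> \<omega> \<Longrightarrow> y \<in> \<omega> \<Longrightarrow> dist x y \<le> 1 + e \<Longrightarrow> dist x y \<le> 1"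
    using finite_gap[of "(\<lambda>(x, y). dist x y) ` (\<omega> \<times> \<omega>)" 1] assms by auto
  have "simplex_verts d \<omega> (g ` V)"
    if g: "bij_betw g \<omega>' \<omega>" "\<forall>x\<in>\<omega>'. dist x (g x) < e / 2" and V: "simplex_verts d \<omega>' V" for \<omega>' g V
  proof -
    have V': "V \<subseteq> \<omega>'" "finite V" "card V = d + 1" "\<And>x y. x \<in> V \<Longrightarrow> y \<in> V \<Longrightarrow> dist x y \<le> 1"
      using V unfolding simplex_verts_def by auto
    have "inj_on g V" using g(1) V'(1) unfolding bij_betw_def by (blast intro: inj_on_subset)
    then have "card (g ` V) = d + 1" using V'(3) by (simp add: card_image)
    moreover have "g ` V \<subseteq> \<omega>" using g(1) V'(1) unfolding bij_betw_def by blast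
    moreover have "dist (g x) (g y) \<le> 1" if "x \<in> V" "y \<in> V" for x y
    proof (rule e(2))
      show "g x \<in> \<omega>" "g y \<in> \<omega>" using that calculation(2) by auto
      have "dist x (g x) < e / 2" "dist y (g y) < e / 2" using g(2) V'(1) that by blast+
      then show "dist (g x) (g y) \<le> 1 + e"
        using V'(4)[OF that] dist_triangle[of "g x" "g y" x] dist_triangle[of x "g y" y]
        by (simp add: dist_commute)
    qed
    ultimately show ?thesis using V'(2) unfolding simplex_verts_def by blast
  qed
  then show ?thesis using e(1) by (intro exI[of _ "e / 2"]) auto
qed

lemma norm_gap:
  fixes \<omega> :: "(real^'n) set"
  assumes "finite \<omega>"
  shows "\<exists>\<epsilon>>0. \<forall>x. \<forall>z\<in>\<omega>. dist x z < \<epsilon> \<longrightarrow> (norm x \<le> j \<longrightarrow> norm z \<le> j) \<and> (n \<le> norm x \<longrightarrow> n \<le> norm z)"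
proof -
  obtain e where e: "e > 0" "\<And>z. z \<in> \<omega> \<Longrightarrow> norm z \<le> j + e \<Longrightarrow> norm z \<le> j"
    using finite_gap[of "norm ` \<omega>" j] assms by auto
  obtain e' where e': "e' > 0" "\<And>z. z \<in> \<omega> \<Longrightarrow> - norm z \<le> - n + e' \<Longrightarrow> - norm z \<le> - n"
    using finite_gap[of "(\<lambda>z. - norm z) ` \<omega>" "- n"] assms by auto
  have "(norm x \<le> j \<longrightarrow> norm z \<le> j) \<and> (n \<le> norm x \<longrightarrow> n \<le> norm z)"
    if "z \<in> \<omega>" "dist x z < min e e'" for x z
    using e(2)[OF that(1)] e'(2)[OF that(1)] that(2) norm_triangle_ineq2[of z x] norm_triangle_ineq2[of x z]
    by (auto simp: dist_norm norm_minus_commute)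
  then show ?thesis using e(1) e'(1) by (intro exI[of _ "min e e'"]) auto
qed

lemma rtrancl_image:
  assumes "(x, y) \<in> r\<^sup>*" "\<And>a b. (a, b) \<in> r \<Longrightarrow> (h a, h b) \<in> r'"
  shows "(h x, h y) \<in> r'\<^sup>*"
  using assms(1)
proof (induction rule: rtrancl_induct)
  case (step y z)
  from step.IH assms(2)[OF step.hyps(2)] show ?case by (rule rtrancl.rtrancl_into_rtrancl)
qed simp

lemma limit_closed_face_crosses:
  assumes jn: "j < n"
  shows "limit_closed (face_crosses d j n)"
  unfolding limit_closed_def
proof (intro allI impI)
  fix \<omega> :: "(real^'n) set" assume fin: "finite \<omega>"
  obtain e where e: "e > 0" "\<And>\<omega>' g V. bij_betw g \<omega>' \<omega> \<Longrightarrow> (\<forall>x\<in>\<omega>'. dist x (g x) < e) \<Longrightarrow>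
    simplex_verts d \<omega>' V \<Longrightarrow> simplex_verts d \<omega> (g ` V)" using simplex_verts_gap[OF fin, of d] by blast
  obtain e' where e': "e' > 0" "\<And>x z. z \<in> \<omega> \<Longrightarrow> dist x z < e' \<Longrightarrow> (norm x \<le> j \<longrightarrow> norm z \<le> j) \<and> (n \<le> norm x \<longrightarrow> n \<le> norm z)"
    using norm_gap[OF fin, of j n] by blast
  have "face_crosses d j n \<omega>" if g: "bij_betw g \<omega>' \<omega>" "\<forall>x\<in>\<omega>'. dist x (g x) < min e e'"
    and F: "face_crosses d j n \<omega>'" for \<omega>' g
  proof -
    obtain x y where xy: "x \<in> \<omega>'" "norm x \<le> j" "n \<le> norm y" "(x, y) \<in> (pstep d \<omega>')\<^sup>*"
      using F unfolding face_crosses_def by blast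
    have "(g a, g b) \<in> pstep d \<omega>" if "(a, b) \<in> pstep d \<omega>'" for a b
    proof -
      obtain V where "simplex_verts d \<omega>' V" "a \<in> V" "b \<in> V" using \<open>(a, b) \<in> pstep d \<omega>'\<close> unfolding pstep_def by blast
      moreover have "\<forall>x\<in>\<omega>'. dist x (g x) < e" using g(2) by simp
      ultimately show ?thesis using e(2)[OF g(1)] unfolding pstep_def by blast
    qed
    then have "(g x, g y) \<in> (pstep d \<omega>)\<^sup>*" using rtrancl_image[OF xy(4)] by blast
    \<comment> \<open>\<open>j < n\<close> makes the path nontrivial, so its last step shows that
      \<open>y\<close> is a point of the configuration, where \<open>g\<close> is
      controlled.\<close>
    moreover have "x \<noteq> y" using xy(2,3) jn by auto
    then obtain z where "(z, y) \<in> pstep d \<omega>'" using xy(4) by (metis rtranclE)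
    then have y': "y \<in> \<omega>'" unfolding pstep_def simplex_verts_def by blast
    have gxy: "g x \<in> \<omega>" "g y \<in> \<omega>" using bij_betwE[OF g(1)] xy(1) y' by blast+
    have "dist x (g x) < e'" "dist y (g y) < e'" using g(2) xy(1) y' by auto
    then have "norm (g x) \<le> j" "n \<le> norm (g y)" using e'(2) gxy xy(2,3) by blast+
    ultimately show ?thesis using gxy unfolding face_crosses_def by blast
  qed
  then show "\<exists>\<epsilon>>0. \<forall>\<omega>' g. bij_betw g \<omega>' \<omega> \<longrightarrow> (\<forall>x\<in>\<omega>'. dist x (g x) < \<epsilon>) \<longrightarrow>
      face_crosses d j n \<omega>' \<longrightarrow> face_crosses d j n \<omega>"
    using e(1) e'(1) by (intro exI[of _ "min e e'"]) auto
qed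

text \<open>The Minkowski sum of the perturbed hull with a ball of radius \<open>\<epsilon>\<close>
  is convex and contains \<open>V\<close>, hence contains its hull.\<close>

lemma convex_hull_perturb:
  fixes g :: "real^'n \<Rightarrow> real^'n"
  assumes "\<And>x. x \<in> V \<Longrightarrow> dist x (g x) \<le> \<epsilon>" "p \<in> convex hull V"
  shows "\<exists>q\<in>convex hull (g ` V). dist p q \<le> \<epsilon>"
proof -
  have "convex hull V \<subseteq> (\<Union>x\<in>convex hull (g ` V). \<Union>y\<in>cball 0 \<epsilon>. {x + y})"
  proof (rule hull_minimal)
    show "V \<subseteq> (\<Union>x\<in>convex hull (g ` V). \<Union>y\<in>cball 0 \<epsilon>. {x + y})"
    proof
      fix x assume "x \<in> V"
      then have "g x \<in> convex hull (g ` V)" "x - g x \<in> cball 0 \<epsilon>"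
        using assms(1) hull_inc by (auto simp: dist_norm norm_minus_commute intro: hull_inc)
      moreover have "x = g x + (x - g x)" by simp
      ultimately show "x \<in> (\<Union>x\<in>convex hull (g ` V). \<Union>y\<in>cball 0 \<epsilon>. {x + y})" by blast
    qed
    show "convex (\<Union>x\<in>convex hull (g ` V). \<Union>y\<in>cball 0 \<epsilon>. {x + y})"
      by (rule convex_sums) simp_all
  qed
  then obtain x y where "p = x + y" "x \<in> convex hull (g ` V)" "y \<in> cball 0 \<epsilon>" using assms(2) by blast
  then show ?thesis by (intro bexI[of _ x]) (auto simp: dist_norm)
qed

lemma limit_closed_star_crosses: "limit_closed (star_crosses d r j n)"
  unfolding limit_closed_def
proof (intro allI impI)
  fix \<omega> :: "(real^'n) set" assume fin: "finite \<omega>"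
  obtain e where e: "e > 0" "\<And>\<omega>' g V. bij_betw g \<omega>' \<omega> \<Longrightarrow> (\<forall>x\<in>\<omega>'. dist x (g x) < e) \<Longrightarrow>
    simplex_verts d \<omega>' V \<Longrightarrow> simplex_verts d \<omega> (g ` V)" using simplex_verts_gap[OF fin, of d] by blast
  obtain e' where e': "e' > 0" "\<And>x z. z \<in> \<omega> \<Longrightarrow> dist x z < e' \<Longrightarrow> (norm x \<le> j \<longrightarrow> norm z \<le> j) \<and> (n \<le> norm x \<longrightarrow> n \<le> norm z)"
    using norm_gap[OF fin, of j n] by blast
  \<comment> \<open>Hulls of subsets of \<open>\<omega>\<close> have only finitely many mutual
    distances. Moving the points by less than \<open>e'' / 2\<close> shifts either hull by at most
    \<open>e'' / 2\<close>, so the range grows by at most \<open>e''\<close> in total.\<close>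
  obtain e'' where e'': "e'' > 0" "\<And>V W. V \<subseteq> \<omega> \<Longrightarrow> W \<subseteq> \<omega> \<Longrightarrow>
      setdist (convex hull V) (convex hull W) \<le> r + e'' \<Longrightarrow> setdist (convex hull V) (convex hull W) \<le> r"
    using finite_gap[of "(\<lambda>(V, W). setdist (convex hull V) (convex hull W)) ` (Pow \<omega> \<times> Pow \<omega>)" r] fin by auto
  define \<epsilon> where "\<epsilon> = min e (min e' (e'' / 2))"
  have "star_crosses d r j n \<omega>" if g: "bij_betw g \<omega>' \<omega>" "\<forall>x\<in>\<omega>'. dist x (g x) < \<epsilon>"
    and F: "star_crosses d r j n \<omega>'" for \<omega>' g
  proof -
    obtain V W x y where VW: "simplex_verts d \<omega>' V" "x \<in> V" "norm x \<le> j" "y \<in> W" "n \<le> norm y"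
      "(V, W) \<in> (sstep d r \<omega>')\<^sup>*" using F unfolding star_crosses_def by blast
    have ge: "\<forall>x\<in>\<omega>'. dist x (g x) < e" using g(2) by (simp add: \<epsilon>_def)
    have sv: "simplex_verts d \<omega> (g ` U)" if "simplex_verts d \<omega>' U" for U using e(2)[OF g(1) ge that] .
    have "(g ` A, g ` B) \<in> sstep d r \<omega>" if "(A, B) \<in> sstep d r \<omega>'" for A B
    proof -
      have AB: "simplex_verts d \<omega>' A" "simplex_verts d \<omega>' B" "setdist (convex hull A) (convex hull B) \<le> r"
        using \<open>(A, B) \<in> sstep d r \<omega>'\<close> unfolding sstep_def by auto
      note AB' = simplex_verts_ne[OF AB(1)] simplex_verts_ne[OF AB(2)]
      have "compact (convex hull A)" "compact (convex hull B)" "convex hull A \<noteq> {}" "convex hull B \<noteq> {}"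
        using AB' by (auto intro: finite_imp_compact_convex_hull)
      then obtain p q where pq: "p \<in> convex hull A" "q \<in> convex hull B" "dist p q = setdist (convex hull A) (convex hull B)"
        using setdist_compact_closed compact_imp_closed by metis
      have gd: "dist x (g x) \<le> e'' / 2" if "x \<in> \<omega>'" for x using g(2) that by (auto simp: \<epsilon>_def less_imp_le)
      obtain p' where p': "p' \<in> convex hull (g ` A)" "dist p p' \<le> e'' / 2"
        using convex_hull_perturb[OF _ pq(1), of g "e'' / 2"] gd AB' by blast
      obtain q' where q': "q' \<in> convex hull (g ` B)" "dist q q' \<le> e'' / 2"
        using convex_hull_perturb[OF _ pq(2), of g "e'' / 2"] gd AB' by blast
      have "setdist (convex hull (g ` A)) (convex hull (g ` B)) \<le> dist p' q'"
        using p'(1) q'(1) by (rule setdist_le_dist)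
      also have "\<dots> \<le> dist p p' + dist p q + dist q q'"
        using dist_triangle[of p' q' p] dist_triangle[of p q' q] by (simp add: dist_commute)
      also have "\<dots> \<le> r + e''" using pq(3) AB(3) p'(2) q'(2) by simp
      finally have "setdist (convex hull (g ` A)) (convex hull (g ` B)) \<le> r"
        using e''(2) sv[OF AB(1)] sv[OF AB(2)] simplex_verts_ne by metis
      then show ?thesis using sv AB(1,2) unfolding sstep_def by blast
    qed
    then have ch: "(g ` V, g ` W) \<in> (sstep d r \<omega>)\<^sup>*" using rtrancl_image[OF VW(6), of "\<lambda>U. g ` U"] by blast
    have "simplex_verts d \<omega>' W" using VW(6)
      by (cases rule: rtranclE) (use VW(1) in \<open>auto simp: sstep_def\<close>)
    then have xy': "x \<in> \<omega>'" "y \<in> \<omega>'" using VW(2,4) simplex_verts_ne[OF VW(1)] simplex_verts_ne by blast+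
    have gxy: "g x \<in> \<omega>" "g y \<in> \<omega>" using bij_betwE[OF g(1)] xy' by blast+
    have "dist x (g x) < e'" "dist y (g y) < e'" using g(2) xy' by (auto simp: \<epsilon>_def)
    then have "norm (g x) \<le> j" "n \<le> norm (g y)" using e'(2) gxy VW(3,5) by blast+
    then show ?thesis using ch sv[OF VW(1)] VW(2,4) unfolding star_crosses_def by blast
  qed
  then show "\<exists>\<epsilon>>0. \<forall>\<omega>' g. bij_betw g \<omega>' \<omega> \<longrightarrow> (\<forall>x\<in>\<omega>'. dist x (g x) < \<epsilon>) \<longrightarrow>
      star_crosses d r j n \<omega>' \<longrightarrow> star_crosses d r j n \<omega>"
    using e(1) e'(1) e''(1) by (intro exI[of _ \<epsilon>]) (auto simp: \<epsilon>_def)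
qed

section \<open>Counts of a Poisson process and their independence\<close>

lemma PPP_prob_space: "is_PPP P lam \<Longrightarrow> prob_space P"
  by (simp add: is_PPP_def)

lemma PPP_count:
  assumes "is_PPP P lam" "A \<in> sets lborel" "bounded A"
  shows "\<omega> \<in> space P \<Longrightarrow> finite (\<omega> \<inter> A)"
    and "(\<lambda>\<omega>. card (\<omega> \<inter> A)) \<in> measurable P (count_space UNIV)"
    and "measure P {\<omega>\<in>space P. card (\<omega> \<inter> A) = k} =
           (lam * measure lborel A) ^ k / fact k * exp (- (lam * measure lborel A))"
proof -
  have "\<forall>A \<in> sets lborel. bounded A \<longrightarrow>
        (\<forall>\<omega>\<in>space P. finite (\<omega> \<inter> A)) \<and>
        (\<lambda>\<omega>. card (\<omega> \<inter> A)) \<in> measurable P (count_space UNIV) \<and>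
        (\<forall>k::nat. measure P {\<omega>\<in>space P. card (\<omega> \<inter> A) = k} =
           (lam * measure lborel A) ^ k / fact k * exp (- (lam * measure lborel A)))"
    using assms(1) unfolding is_PPP_def by (elim conjE)
  note * = mp[OF bspec[OF this assms(2)] assms(3)]
  from * show "\<omega> \<in> space P \<Longrightarrow> finite (\<omega> \<inter> A)" by (elim conjE) (rule bspec)
  from * show "(\<lambda>\<omega>. card (\<omega> \<inter> A)) \<in> measurable P (count_space UNIV)" by (elim conjE)
  from * show "measure P {\<omega>\<in>space P. card (\<omega> \<inter> A) = k} =
           (lam * measure lborel A) ^ k / fact k * exp (- (lam * measure lborel A))" by (elim conjE allE)
qed

lemma PPP_loc_finite: "is_PPP P lam \<Longrightarrow> \<omega> \<in> space P \<Longrightarrow> loc_finite \<omega>"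
  unfolding loc_finite_def by (intro allI PPP_count(1)[where lam = lam]) auto

lemma PPP_sets:
  assumes "is_PPP P lam" "A \<in> sets lborel" "bounded A"
  shows "{\<omega>\<in>space P. card (\<omega> \<inter> A) \<in> S} \<in> sets P"
proof -
  have "(\<lambda>\<omega>. card (\<omega> \<inter> A)) -` S \<inter> space P \<in> sets P"
    using measurable_sets[OF PPP_count(2)[OF assms]] by simp
  then show ?thesis by (rule back_subst[of "\<lambda>X. X \<in> sets P"]) auto
qed

lemma PPP_indep_vars:
  fixes A :: "nat \<Rightarrow> (real^'n) set"
  assumes "is_PPP P lam" "finite I" "\<And>i. i \<in> I \<Longrightarrow> A i \<in> sets lborel \<and> bounded (A i)"
    "disjoint_family_on A I"
  shows "prob_space.indep_vars P (\<lambda>_. count_space UNIV) (\<lambda>i \<omega>. card (\<omega> \<inter> A i)) (I :: nat set)"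
proof -
  have "\<forall>(I::nat set) (A::nat \<Rightarrow> (real^'n) set). finite I \<longrightarrow>
        (\<forall>i\<in>I. A i \<in> sets lborel \<and> bounded (A i)) \<longrightarrow> disjoint_family_on A I \<longrightarrow>
        prob_space.indep_vars P (\<lambda>_. count_space UNIV) (\<lambda>i \<omega>. card (\<omega> \<inter> A i)) I"
    using assms(1) unfolding is_PPP_def by (elim conjE)
  from this[rule_format, OF assms(2) _ assms(4)] assms(3) show ?thesis by simp
qed

text \<open>\<open>is_PPP\<close> speaks of families indexed by naturals; an enumeration of
  \<open>J\<close> carries the product formula over to index sets such as cubes and lattice
  sites.\<close>

lemma PPP_indep:
  fixes A :: "'i \<Rightarrow> (real^'n) set"
  assumes P: "is_PPP P lam" and "finite J" and A: "\<And>j. j \<in> J \<Longrightarrow> A j \<in> sets lborel \<and> bounded (A j)"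
    and disj: "disjoint_family_on A J"
  shows "measure P {\<omega>\<in>space P. \<forall>j\<in>J. card (\<omega> \<inter> A j) \<in> S j}
    = (\<Prod>j\<in>J. measure P {\<omega>\<in>space P. card (\<omega> \<inter> A j) \<in> S j})"
proof (cases "J = {}")
  case True
  then show ?thesis using prob_space.prob_space[OF PPP_prob_space[OF P]] by simp
next
  case False
  interpret prob_space P using PPP_prob_space[OF P] .
  obtain e where e: "bij_betw e {..<card J} J" using ex_bij_betw_nat_finite[OF \<open>finite J\<close>] by (auto simp: lessThan_atLeast0)
  let ?K = "{..<card J}"
  have eJ: "e k \<in> J" if "k \<in> ?K" for k using e that unfolding bij_betw_def by blast
  have "disjoint_family_on (\<lambda>k. A (e k)) ?K"
    using disj e unfolding disjoint_family_on_def bij_betw_def inj_on_def by (auto; blast)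
  then have ind: "indep_vars (\<lambda>_. count_space UNIV) (\<lambda>k \<omega>. card (\<omega> \<inter> A (e k))) ?K"
    by (intro PPP_indep_vars[OF P]) (use A eJ in auto)
  have "0 < card J" using False \<open>finite J\<close> by (simp add: card_gt_0_iff)
  then have "?K \<noteq> {}" by auto
  then have "prob (\<Inter>k\<in>?K. (\<lambda>\<omega>. card (\<omega> \<inter> A (e k))) -` S (e k) \<inter> space P)
      = (\<Prod>k\<in>?K. prob ((\<lambda>\<omega>. card (\<omega> \<inter> A (e k))) -` S (e k) \<inter> space P))"
    by (intro indep_varsD_finite[OF ind]) auto
  also have "(\<Inter>k\<in>?K. (\<lambda>\<omega>. card (\<omega> \<inter> A (e k))) -` S (e k) \<inter> space P)
      = {\<omega>\<in>space P. \<forall>j\<in>J. card (\<omega> \<inter> A j) \<in> S j}"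
  proof -
    have "(\<forall>j\<in>J. card (\<omega> \<inter> A j) \<in> S j) \<longleftrightarrow> (\<forall>k\<in>?K. card (\<omega> \<inter> A (e k)) \<in> S (e k))" for \<omega>
    proof -
      have "(\<forall>j\<in>e ` ?K. card (\<omega> \<inter> A j) \<in> S j) \<longleftrightarrow> (\<forall>k\<in>?K. card (\<omega> \<inter> A (e k)) \<in> S (e k))" by simp
      then show ?thesis unfolding bij_betw_imp_surj_on[OF e] .
    qed
    then show ?thesis using \<open>?K \<noteq> {}\<close> by (simp add: set_eq_iff) blast
  qed
  also have "(\<Prod>k\<in>?K. prob ((\<lambda>\<omega>. card (\<omega> \<inter> A (e k))) -` S (e k) \<inter> space P))
      = (\<Prod>j\<in>J. prob ((\<lambda>\<omega>. card (\<omega> \<inter> A j)) -` S j \<inter> space P))"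
    by (subst prod.reindex_bij_betw[OF e, symmetric]) simp
  also have "\<dots> = (\<Prod>j\<in>J. measure P {\<omega>\<in>space P. card (\<omega> \<inter> A j) \<in> S j})"
    by (intro prod.cong refl arg_cong[of _ _ "measure P"]) auto
  finally show ?thesis .
qed

section \<open>Mesh cells and occupation patterns\<close>

definition cell :: "real \<Rightarrow> int^'n \<Rightarrow> (real^'n) set" where
  "cell h w = {x. blk h x = w}"

lemma cell_sets:
  fixes w :: "int^'n"
  shows "h > 0 \<Longrightarrow> cell h w \<in> sets lborel"
proof -
  assume "h > 0"
  have "(cell h w :: (real^'n) set) = (\<Inter>i\<in>UNIV. {x. \<lfloor>x $ i / h\<rfloor> = w $ i})"
    unfolding cell_def blk_def vec_eq_iff by auto
  also have "\<dots> \<in> sets borel"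
  proof (intro sets.finite_INT)
    fix i
    have "{x :: real^'n. \<lfloor>x $ i / h\<rfloor> = w $ i} = {x. x $ i \<ge> w $ i * h} \<inter> {x. x $ i < (w $ i + 1) * h}"
      using \<open>h > 0\<close> by (auto simp: floor_eq_iff field_simps)
    also have "\<dots> \<in> sets borel"
      by (intro sets.Int borel_closed borel_open closed_halfspace_component_ge_cart open_halfspace_component_lt_cart)
    finally show "{x :: real^'n. \<lfloor>x $ i / h\<rfloor> = w $ i} \<in> sets borel" .
  qed auto
  finally show ?thesis by simp
qed

lemma cell_subset_cball:
  fixes w :: "int^'n"
  shows "h > 0 \<Longrightarrow> cell h w \<subseteq> cball (\<chi> i. h * real_of_int (w $ i)) (h * CARD('n))"
proof
  fix x :: "real^'n" assume "h > 0" "x \<in> cell h w"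
  then have "blk h (\<chi> i. h * real_of_int (w $ i)) = blk h x" by (simp add: cell_def blk_corner)
  from blk_close[OF \<open>h > 0\<close> this] show "x \<in> cball (\<chi> i. h * real_of_int (w $ i)) (h * CARD('n))"
    by (simp only: mem_cball)
qed

lemma bounded_cell: "h > 0 \<Longrightarrow> bounded (cell h w)"
  by (rule bounded_subset[OF bounded_cball cell_subset_cball])

lemma disjoint_cells: "disjoint_family_on (cell h) I"
  unfolding disjoint_family_on_def cell_def by blast

definition blocks :: "nat \<Rightarrow> (int^'n) set" where
  "blocks N = {b. \<forall>i. \<bar>b $ i\<bar> \<le> int N}"

definition region :: "real \<Rightarrow> nat \<Rightarrow> (real^'n) set" where
  "region s N = {x. blk s x \<in> blocks N}"

definition cells :: "real \<Rightarrow> nat \<Rightarrow> int^'n \<Rightarrow> (int^'n) set" where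
  "cells s m b = blk (s / Suc m) ` {x. blk s x = b}"

definition mesh_cells :: "real \<Rightarrow> nat \<Rightarrow> nat \<Rightarrow> (int^'n) set" where
  "mesh_cells s m N = \<Union>(cells s m ` blocks N)"

definition pattern :: "real \<Rightarrow> nat \<Rightarrow> nat \<Rightarrow> (real^'n) set \<Rightarrow> (int^'n) set" where
  "pattern s m N \<omega> = blk (s / Suc m) ` (\<omega> \<inter> region s N)"

text \<open>Turns a property of configurations into one of sets of occupied cells: some
  configuration with exactly one point in each cell of \<open>A\<close> and none elsewhere has the
  property.\<close>

definition realizes :: "real \<Rightarrow> nat \<Rightarrow> ((real^'n) set \<Rightarrow> bool) \<Rightarrow> (int^'n) set \<Rightarrow> bool" where
  "realizes s m F A \<longleftrightarrow> (\<exists>\<omega>. inj_on (blk (s / Suc m)) \<omega> \<and> blk (s / Suc m) ` \<omega> = A \<and> F \<omega>)"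

text \<open>The probability that the cell is occupied at intensity \<open>lam\<close>.\<close>

definition occ :: "real \<Rightarrow> real \<Rightarrow> int^'n \<Rightarrow> real" where
  "occ lam h w = 1 - exp (- (lam * measure lborel (cell h w)))"

lemma finite_blocks: "finite (blocks N :: (int^'n) set)"
  unfolding blocks_def by (rule finite_int_box)

lemma blk_refine_Suc: "blk (s / real (Suc m)) x = blk (s / real (Suc m)) y \<Longrightarrow> blk s x = blk s y"
  by (rule blk_refine[where m = "Suc m"]) (simp, assumption)

lemma in_cells_iff: "blk (s / Suc m) x \<in> cells s m b \<longleftrightarrow> blk s x = b"
  unfolding cells_def using blk_refine_Suc by blast

lemma finite_cells:
  fixes b :: "int^'n"
  assumes s: "s > 0"
  shows "finite (cells s m b)"
proof -
  let ?h = "s / real (Suc m)" and ?c = "\<chi> i. s * real_of_int (b $ i)"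
  have h: "?h > 0" using s by simp
  have "cells s m b \<subseteq> {w. \<forall>i. \<bar>w $ i - blk ?h ?c $ i\<bar> \<le> \<lceil>s * CARD('n) / ?h\<rceil> + 1}"
  proof
    fix w assume "w \<in> cells s m b"
    then obtain x where x: "w = blk ?h x" "blk s x = b" unfolding cells_def by blast
    have "dist x ?c \<le> s * CARD('n)" by (rule blk_close[OF s]) (simp add: x blk_corner s)
    then show "w \<in> {w. \<forall>i. \<bar>w $ i - blk ?h ?c $ i\<bar> \<le> \<lceil>s * CARD('n) / ?h\<rceil> + 1}"
      unfolding x(1) using blk_near[OF h] by blast
  qed
  then show ?thesis using int_box_translate(1) by (rule finite_subset)
qed

lemma disjoint_cells_blocks: "b \<noteq> b' \<Longrightarrow> cells s m b \<inter> cells s m b' = {}"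
  unfolding cells_def using blk_refine_Suc by blast

lemma finite_mesh_cells: "s > 0 \<Longrightarrow> finite (mesh_cells s m N)"
  unfolding mesh_cells_def using finite_blocks finite_cells by blast

lemma in_mesh_cells_iff: "blk (s / Suc m) x \<in> mesh_cells s m N \<longleftrightarrow> x \<in> region s N"
  unfolding mesh_cells_def region_def by (simp add: in_cells_iff del: of_nat_Suc)

lemma cball_subset_region:
  assumes "s > 0" "t \<le> s * real N"
  shows "cball 0 t \<subseteq> region s N"
proof
  fix x :: "real^'n" assume "x \<in> cball 0 t"
  then have "\<bar>x $ i\<bar> \<le> s * real N" for i
    using component_le_norm_cart[of x i] assms(2) by simp
  then have "\<bar>x $ i / s\<bar> \<le> real N" for i using assms(1) by (simp add: divide_le_eq mult.commute)
  then have *: "- real N \<le> x $ i / s \<and> x $ i / s \<le> real N" for i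
    using abs_le_iff[of "x $ i / s" "real N"] by (simp add: minus_le_iff)
  have "\<bar>\<lfloor>x $ i / s\<rfloor>\<bar> \<le> int N" for i
  proof -
    have "- int N \<le> \<lfloor>x $ i / s\<rfloor>" using *[of i] by (simp add: le_floor_iff)
    moreover have "\<lfloor>x $ i / s\<rfloor> \<le> int N" using *[of i] by (simp add: floor_le_iff)
    ultimately show ?thesis by linarith
  qed
  then show "x \<in> region s N" by (simp add: region_def blocks_def blk_def)
qed

lemma pattern_subset: "pattern s m N \<omega> \<subseteq> mesh_cells s m N"
  unfolding pattern_def using in_mesh_cells_iff by blast

lemma region_bounded:
  assumes "s > 0"
  shows "bounded (region s N :: (real^'n) set)"
proof -
  have "region s N = (\<Union>b\<in>blocks N. cell s b :: (real^'n) set)" unfolding region_def cell_def by blast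
  also have "bounded \<dots>" by (intro bounded_UN finite_blocks ballI bounded_cell assms)
  finally show ?thesis .
qed

lemma PPP_finite_region:
  fixes \<omega> :: "(real^'n) set"
  assumes "is_PPP P lam" "s > 0" "\<omega> \<in> space P"
  shows "finite (\<omega> \<inter> region s N)"
proof -
  have "bounded (region s N :: (real^'n) set)" by (rule region_bounded[OF assms(2)])
  then obtain r where "\<forall>x\<in>(region s N :: (real^'n) set). norm x \<le> r" unfolding bounded_iff by (rule exE)
  then have "(region s N :: (real^'n) set) \<subseteq> cball 0 r" by (intro subsetI) simp
  then have "\<omega> \<inter> region s N \<subseteq> \<omega> \<inter> cball 0 r" by (rule Int_mono[OF subset_refl])
  moreover have "finite (\<omega> \<inter> cball 0 r)"
    using PPP_loc_finite[OF assms(1,3)] unfolding loc_finite_def by (rule spec)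
  ultimately show ?thesis by (rule finite_subset)
qed

lemma PPP_occ:
  assumes "is_PPP P lam" "h > 0"
  shows "measure P {\<omega>\<in>space P. card (\<omega> \<inter> cell h w) \<in> {0}} = 1 - occ lam h w"
    and "measure P {\<omega>\<in>space P. card (\<omega> \<inter> cell h w) \<in> {0<..}} = occ lam h w"
proof -
  interpret prob_space P using PPP_prob_space[OF assms(1)] .
  note cl = cell_sets[OF assms(2), of w] bounded_cell[OF assms(2), of w]
  show 0: "measure P {\<omega>\<in>space P. card (\<omega> \<inter> cell h w) \<in> {0}} = 1 - occ lam h w"
    using PPP_count(3)[OF assms(1) cl, of 0] by (simp add: occ_def)
  have "{\<omega>\<in>space P. card (\<omega> \<inter> cell h w) \<in> {0<..}} = space P - {\<omega>\<in>space P. card (\<omega> \<inter> cell h w) \<in> {0}}"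
    by (intro set_eqI) (simp, linarith)
  then have "measure P {\<omega>\<in>space P. card (\<omega> \<inter> cell h w) \<in> {0<..}}
      = 1 - measure P {\<omega>\<in>space P. card (\<omega> \<inter> cell h w) \<in> {0}}"
    by (simp only: prob_compl[OF PPP_sets[OF assms(1) cl]])
  then show "measure P {\<omega>\<in>space P. card (\<omega> \<inter> cell h w) \<in> {0<..}} = occ lam h w"
    using 0 by linarith
qed

lemma PPP_pattern_eq:
  fixes P :: "(real^'n) set measure"
  assumes P: "is_PPP P lam" and s: "s > 0" and A: "A \<subseteq> mesh_cells s m N"
  defines "I \<equiv> mesh_cells s m N" and "h \<equiv> s / Suc m"
  shows "{\<omega>\<in>space P. pattern s m N \<omega> = A} \<in> sets P"
    and "measure P {\<omega>\<in>space P. pattern s m N \<omega> = A} = wt I (occ lam h) A"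
proof -
  interpret prob_space P using PPP_prob_space[OF P] .
  have h: "h > 0" using s by (simp add: h_def)
  have finI: "finite I" unfolding I_def by (rule finite_mesh_cells[OF s])
  define S where "S w = (if w \<in> A then {0::nat<..} else {0})" for w
  have pat: "w \<in> pattern s m N \<omega> \<longleftrightarrow> w \<in> I \<and> 0 < card (\<omega> \<inter> cell h w)" if "\<omega> \<in> space P" for w \<omega>
  proof -
    \<comment> \<open>Finiteness is essential here, as \<open>card\<close> of an infinite set would
      be 0.\<close>
    have "finite (\<omega> \<inter> cell h w)" using PPP_count(1)[OF P cell_sets[OF h] bounded_cell[OF h] that] .
    then have c: "0 < card (\<omega> \<inter> cell h w) \<longleftrightarrow> (\<exists>x\<in>\<omega>. blk h x = w)"
      by (simp add: card_gt_0_iff cell_def Int_def) blast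
    have iff: "blk h x \<in> I \<longleftrightarrow> x \<in> region s N" for x
      unfolding I_def h_def by (rule in_mesh_cells_iff)
    have "w \<in> pattern s m N \<omega> \<longleftrightarrow> (\<exists>x\<in>\<omega>. x \<in> region s N \<and> blk h x = w)"
      unfolding pattern_def h_def[symmetric] image_iff by auto
    also have "\<dots> \<longleftrightarrow> (\<exists>x\<in>\<omega>. blk h x \<in> I \<and> blk h x = w)" by (simp only: iff)
    also have "\<dots> \<longleftrightarrow> w \<in> I \<and> (\<exists>x\<in>\<omega>. blk h x = w)" by auto
    finally show ?thesis by (simp only: c)
  qed
  have eq: "{\<omega>\<in>space P. pattern s m N \<omega> = A} = {\<omega>\<in>space P. \<forall>w\<in>I. card (\<omega> \<inter> cell h w) \<in> S w}"
  proof (intro Collect_cong conj_cong refl)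
    fix \<omega> assume \<omega>: "\<omega> \<in> space P"
    have "pattern s m N \<omega> = A \<longleftrightarrow> (\<forall>w\<in>I. w \<in> pattern s m N \<omega> \<longleftrightarrow> w \<in> A)"
      using pattern_subset[of s m N \<omega>] A unfolding I_def by blast
    also have "\<dots> \<longleftrightarrow> (\<forall>w\<in>I. card (\<omega> \<inter> cell h w) \<in> S w)"
      using pat[OF \<omega>] by (intro ball_cong refl) (simp add: S_def)
    finally show "pattern s m N \<omega> = A \<longleftrightarrow> (\<forall>w\<in>I. card (\<omega> \<inter> cell h w) \<in> S w)" .
  qed
  have cl: "cell h w \<in> sets lborel \<and> bounded (cell h w)" for w :: "int^'n"
    using cell_sets[OF h] bounded_cell[OF h] by blast
  have "{\<omega>\<in>space P. \<forall>w\<in>I. card (\<omega> \<inter> cell h w) \<in> S w} = (\<Inter>w\<in>I. {\<omega>\<in>space P. card (\<omega> \<inter> cell h w) \<in> S w}) \<inter> space P"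
    by blast
  also have "\<dots> \<in> sets P"
    using finI PPP_sets[OF P] cl by (cases "I = {}") (auto intro!: sets.Int sets.finite_INT)
  finally show "{\<omega>\<in>space P. pattern s m N \<omega> = A} \<in> sets P" unfolding eq .
  have "measure P {\<omega>\<in>space P. pattern s m N \<omega> = A} = (\<Prod>w\<in>I. measure P {\<omega>\<in>space P. card (\<omega> \<inter> cell h w) \<in> S w})"
    unfolding eq by (rule PPP_indep[OF P finI cl disjoint_cells])
  also have "\<dots> = (\<Prod>w\<in>I. if w \<in> A then occ lam h w else 1 - occ lam h w)"
    using PPP_occ[OF P h] by (intro prod.cong refl) (simp add: S_def)
  also have "\<dots> = wt I (occ lam h) A"
  proof -
    have "I \<inter> {w. w \<in> A} = A" "I \<inter> - {w. w \<in> A} = I - A" using A unfolding I_def by auto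
    then show ?thesis unfolding wt_def using finI by (simp add: prod.If_cases)
  qed
  finally show "measure P {\<omega>\<in>space P. pattern s m N \<omega> = A} = wt I (occ lam h) A" .
qed

lemma PPP_pattern:
  fixes P :: "(real^'n) set measure" and N m :: nat
  assumes P: "is_PPP P lam" and s: "s > 0"
  defines "I \<equiv> (mesh_cells s m N :: (int^'n) set)"
  shows "{\<omega>\<in>space P. Q (pattern s m N \<omega>)} \<in> sets P"
    and "measure P {\<omega>\<in>space P. Q (pattern s m N \<omega>)}
      = (\<Sum>A\<in>Pow I. wt I (occ lam (s / Suc m)) A * of_bool (Q A))"
proof -
  interpret prob_space P using PPP_prob_space[OF P] .
  have finI: "finite I" unfolding I_def by (rule finite_mesh_cells[OF s])
  let ?E = "\<lambda>A. {\<omega>\<in>space P. pattern s m N \<omega> = A}"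
  let ?\<A> = "{A \<in> Pow I. Q A}"
  have eq: "{\<omega>\<in>space P. Q (pattern s m N \<omega>)} = (\<Union>A\<in>?\<A>. ?E A)"
    using pattern_subset[of s m N] unfolding I_def by blast
  have sets: "?E A \<in> sets P" "measure P (?E A) = wt I (occ lam (s / Suc m)) A" if "A \<in> ?\<A>" for A
    using PPP_pattern_eq[OF P s, of A m N] that unfolding I_def by auto
  show "{\<omega>\<in>space P. Q (pattern s m N \<omega>)} \<in> sets P"
    unfolding eq using sets(1) finI by (intro sets.finite_UN) auto
  have "measure P {\<omega>\<in>space P. Q (pattern s m N \<omega>)} = (\<Sum>A\<in>?\<A>. measure P (?E A))"
    unfolding eq by (rule finite_measure_finite_Union) (use finI sets(1) in \<open>auto simp: disjoint_family_on_def\<close>)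
  also have "\<dots> = (\<Sum>A\<in>?\<A>. wt I (occ lam (s / Suc m)) A)" using sets(2) by (intro sum.cong refl)
  also have "\<dots> = (\<Sum>A\<in>Pow I. wt I (occ lam (s / Suc m)) A * of_bool (Q A))"
    by (rule sum.mono_neutral_cong_left) (use finI in auto)
  finally show "measure P {\<omega>\<in>space P. Q (pattern s m N \<omega>)}
      = (\<Sum>A\<in>Pow I. wt I (occ lam (s / Suc m)) A * of_bool (Q A))" .
qed

lemma mesh_small:
  fixes s c \<epsilon> :: real
  assumes "\<epsilon> > 0" "s > 0" "c \<ge> 0"
  shows "\<exists>m0. \<forall>m\<ge>m0. s / Suc m * c < \<epsilon>"
proof -
  obtain m0 :: nat where m0: "s * c / \<epsilon> < m0" using reals_Archimedean2 by blast
  have "s / Suc m * c < \<epsilon>" if "m \<ge> m0" for m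
  proof -
    have "s * c / \<epsilon> < real (Suc m)" using m0 that by simp
    then show ?thesis using assms(1) by (simp add: divide_less_eq mult.commute)
  qed
  then show ?thesis by blast
qed

lemma mesh_separates:
  fixes \<omega> :: "(real^'n) set"
  assumes "finite \<omega>" "s > 0"
  shows "\<exists>m0. \<forall>m\<ge>m0. inj_on (blk (s / Suc m)) \<omega>"
proof -
  obtain e where e: "e > 0" "\<And>x y. x \<in> \<omega> \<Longrightarrow> y \<in> \<omega> \<Longrightarrow> dist x y \<le> 0 + e \<Longrightarrow> dist x y \<le> 0"
    using finite_gap[of "(\<lambda>(x, y). dist x y) ` (\<omega> \<times> \<omega>)" 0] assms by auto
  obtain m0 where m0: "\<And>m. m \<ge> m0 \<Longrightarrow> s / Suc m * CARD('n) < e"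
    using mesh_small[OF e(1) assms(2), of "CARD('n)"] by auto
  have "inj_on (blk (s / Suc m)) \<omega>" if "m \<ge> m0" for m
  proof (rule inj_onI)
    fix x y assume xy: "x \<in> \<omega>" "y \<in> \<omega>" "blk (s / Suc m) x = blk (s / Suc m) y"
    have "s / Suc m > 0" using assms(2) by simp
    from blk_close[OF this xy(3)] have "dist x y \<le> 0 + e" using m0[OF that] by simp
    then show "x = y" using e(2)[OF xy(1,2)] by simp
  qed
  then show ?thesis by blast
qed

text \<open>Once the mesh separates the points, the configuration itself realizes its pattern.
  Conversely, on a fine mesh any realizing configuration arises by moving each point inside its
  cell, which is the perturbation that \<open>limit_closed\<close> allows.\<close>

lemma limit_closed_pattern:
  fixes F :: "(real^'n) set \<Rightarrow> bool"
  assumes F: "limit_closed F" and fin: "finite (\<omega> \<inter> region s N)" and s: "s > 0"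
  shows "F (\<omega> \<inter> region s N) \<Longrightarrow> \<exists>k. \<forall>m\<ge>k. realizes s m F (pattern s m N \<omega>)"
    and "\<forall>k. \<exists>m\<ge>k. realizes s m F (pattern s m N \<omega>) \<Longrightarrow> F (\<omega> \<inter> region s N)"
proof -
  let ?\<omega> = "\<omega> \<inter> region s N"
  obtain m0 where m0: "\<And>m. m \<ge> m0 \<Longrightarrow> inj_on (blk (s / Suc m)) ?\<omega>" using mesh_separates[OF fin s] by blast
  show "\<exists>k. \<forall>m\<ge>k. realizes s m F (pattern s m N \<omega>)" if "F ?\<omega>"
    using m0 that unfolding realizes_def pattern_def by (intro exI[of _ m0]) blast
  assume io: "\<forall>k. \<exists>m\<ge>k. realizes s m F (pattern s m N \<omega>)"
  obtain \<epsilon> where \<epsilon>: "\<epsilon> > 0" "\<And>\<omega>' g. bij_betw g \<omega>' ?\<omega> \<Longrightarrow> (\<forall>x\<in>\<omega>'. dist x (g x) < \<epsilon>) \<Longrightarrow> F \<omega>' \<Longrightarrow> F ?\<omega>"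
    using F fin unfolding limit_closed_def by blast
  obtain m1 where m1: "\<And>m. m \<ge> m1 \<Longrightarrow> s / Suc m * CARD('n) < \<epsilon>"
    using mesh_small[OF \<epsilon>(1) s, of "CARD('n)"] by auto
  obtain m where m: "m \<ge> max m0 m1" "realizes s m F (pattern s m N \<omega>)" using io by blast
  let ?h = "s / real (Suc m)"
  obtain \<omega>' where \<omega>': "inj_on (blk ?h) \<omega>'" "blk ?h ` \<omega>' = blk ?h ` ?\<omega>" "F \<omega>'"
    using m(2) unfolding realizes_def pattern_def by blast
  have inj: "inj_on (blk ?h) ?\<omega>" using m0 m(1) by simp
  define g where "g = inv_into ?\<omega> (blk ?h) \<circ> blk ?h"
  have "bij_betw (blk ?h) \<omega>' (blk ?h ` ?\<omega>)" using \<omega>'(1,2) unfolding bij_betw_def by blast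
  moreover have "bij_betw (inv_into ?\<omega> (blk ?h)) (blk ?h ` ?\<omega>) ?\<omega>"
    using inj by (intro bij_betw_inv_into) (simp add: bij_betw_def)
  ultimately have bij: "bij_betw g \<omega>' ?\<omega>" unfolding g_def by (rule bij_betw_trans)
  have "dist x (g x) < \<epsilon>" if "x \<in> \<omega>'" for x
  proof -
    have "blk ?h x \<in> blk ?h ` ?\<omega>" using \<omega>'(2) that by blast
    then have "blk ?h x = blk ?h (g x)" unfolding g_def by (simp add: f_inv_into_f)
    moreover have "?h > 0" using s by simp
    ultimately have "dist x (g x) \<le> ?h * CARD('n)" by (intro blk_close)
    then show ?thesis using m1[of m] m(1) by simp
  qed
  then show "F ?\<omega>" using \<epsilon>(2)[OF bij] \<omega>'(3) by blast
qed

text \<open>The event is the limit inferior of pattern events, each of which depends on finitely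
  many counts; this makes it measurable.\<close>

lemma PPP_limit_closed_sets:
  fixes P :: "(real^'n) set measure"
  assumes P: "is_PPP P lam" and F: "limit_closed F" and s: "s > 0"
  shows "{\<omega>\<in>space P. F (\<omega> \<inter> region s N)} \<in> sets P"
proof -
  let ?E = "\<lambda>m. {\<omega>\<in>space P. realizes s m F (pattern s m N \<omega>)}"
  have "{\<omega>\<in>space P. F (\<omega> \<inter> region s N)} = (\<Union>k. \<Inter>m\<in>{k..}. ?E m)"
  proof (rule set_eqI)
    fix \<omega>
    show "\<omega> \<in> {\<omega>\<in>space P. F (\<omega> \<inter> region s N)} \<longleftrightarrow> \<omega> \<in> (\<Union>k. \<Inter>m\<in>{k..}. ?E m)"
    proof (cases "\<omega> \<in> space P")
      case True
      note lc = limit_closed_pattern[OF F PPP_finite_region[OF P s True] s]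
      have "F (\<omega> \<inter> region s N) \<longleftrightarrow> (\<exists>k. \<forall>m\<ge>k. realizes s m F (pattern s m N \<omega>))"
        using lc by (metis nat_le_linear)
      moreover have "\<omega> \<in> (\<Union>k. \<Inter>m\<in>{k..}. ?E m) \<longleftrightarrow> (\<exists>k. \<forall>m\<in>{k..}. \<omega> \<in> ?E m)" by blast
      ultimately show ?thesis using True by (simp only: mem_Collect_eq atLeast_iff Ball_def simp_thms)
    qed auto
  qed
  also have "\<dots> \<in> sets P"
    using PPP_pattern(1)[OF P s] by (intro sets.countable_UN image_subsetI sets.countable_INT) auto
  finally show ?thesis .
qed

text \<open>The event for \<open>F\<close> is contained in the limit inferior of its pattern events,
  and the event for \<open>G\<close> contains the limit superior of its own. The inequality at a
  single mesh \<open>k\<close> compares \<open>A k\<close> with \<open>B k\<close>, and both sides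
  converge monotonically.\<close>

lemma PPP_transfer:
  fixes P P' :: "(real^'n) set measure"
  assumes P: "is_PPP P lam" and P': "is_PPP P' lam'" and F: "limit_closed F" and G: "limit_closed G"
    and s: "s > 0"
    and le: "\<And>m. (\<Sum>A\<in>Pow (mesh_cells s m N). wt (mesh_cells s m N) (occ lam (s / Suc m)) A * of_bool (realizes s m F A))
      \<le> (\<Sum>A\<in>Pow (mesh_cells s m N). wt (mesh_cells s m N) (occ lam' (s / Suc m)) A * of_bool (realizes s m G A))"
  shows "measure P {\<omega>\<in>space P. F (\<omega> \<inter> region s N)} \<le> measure P' {\<omega>\<in>space P'. G (\<omega> \<inter> region s N)}"
proof -
  interpret P: prob_space P using PPP_prob_space[OF P] .
  interpret P': prob_space P' using PPP_prob_space[OF P'] .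
  let ?E = "\<lambda>m. {\<omega>\<in>space P. realizes s m F (pattern s m N \<omega>)}"
  let ?E' = "\<lambda>m. {\<omega>\<in>space P'. realizes s m G (pattern s m N \<omega>)}"
  define A where "A k = (\<Inter>m\<in>{k..}. ?E m)" for k
  define B where "B k = (\<Union>m\<in>{k..}. ?E' m)" for k
  have sE: "?E m \<in> sets P" "?E' m \<in> sets P'" for m
    by (rule PPP_pattern(1)[OF P s] PPP_pattern(1)[OF P' s])+
  have sA: "A k \<in> sets P" for k unfolding A_def using sE by (intro sets.countable_INT) auto
  have sB: "B k \<in> sets P'" for k unfolding B_def using sE by (intro sets.countable_UN) auto
  have AB: "measure P (A k) \<le> measure P' (B k)" for k
  proof -
    have "measure P (A k) \<le> measure P (?E k)" unfolding A_def by (intro P.finite_measure_mono sE) auto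
    also have "\<dots> \<le> measure P' (?E' k)"
      unfolding PPP_pattern(2)[OF P s] PPP_pattern(2)[OF P' s] by (rule le)
    also have "\<dots> \<le> measure P' (B k)" by (intro P'.finite_measure_mono sB) (auto simp: B_def)
    finally show ?thesis .
  qed
  have "(\<lambda>k. measure P (A k)) \<longlonglongrightarrow> measure P (\<Union>k. A k)"
    by (intro P.finite_Lim_measure_incseq) (use sA in \<open>auto simp: incseq_def A_def\<close>)
  moreover have decB: "decseq B" unfolding decseq_def B_def by (intro allI impI UN_mono) auto
  have "(\<lambda>k. measure P' (B k)) \<longlonglongrightarrow> measure P' (\<Inter>k. B k)"
    by (intro P'.finite_Lim_measure_decseq decB) (use sB in \<open>auto\<close>)
  ultimately have lim: "measure P (\<Union>k. A k) \<le> measure P' (\<Inter>k. B k)"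
    by (rule LIMSEQ_le) (use AB in blast)
  have "measure P {\<omega>\<in>space P. F (\<omega> \<inter> region s N)} \<le> measure P (\<Union>k. A k)"
  proof (intro P.finite_measure_mono subsetI)
    fix \<omega> assume \<omega>: "\<omega> \<in> {\<omega>\<in>space P. F (\<omega> \<inter> region s N)}"
    then have "finite (\<omega> \<inter> region s N)" using PPP_finite_region[OF P s] by blast
    then obtain k where "\<forall>m\<ge>k. realizes s m F (pattern s m N \<omega>)"
      using limit_closed_pattern(1)[OF F _ s] \<omega> by blast
    then show "\<omega> \<in> (\<Union>k. A k)" using \<omega> unfolding A_def by auto
  qed (use sA in auto)
  also note lim
  also have "measure P' (\<Inter>k. B k) \<le> measure P' {\<omega>\<in>space P'. G (\<omega> \<inter> region s N)}"
  proof (intro P'.finite_measure_mono subsetI PPP_limit_closed_sets[OF P' G s])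
    fix \<omega> assume \<omega>: "\<omega> \<in> (\<Inter>k. B k)"
    then have "\<omega> \<in> B 0" by blast
    then have sp: "\<omega> \<in> space P'" unfolding B_def by blast
    have "\<forall>k. \<exists>m\<ge>k. realizes s m G (pattern s m N \<omega>)" using \<omega> unfolding B_def by fastforce
    then show "\<omega> \<in> {\<omega>\<in>space P'. G (\<omega> \<inter> region s N)}"
      using limit_closed_pattern(2)[OF G PPP_finite_region[OF P' s sp] s] sp by blast
  qed
  finally show ?thesis .
qed

section \<open>Face percolation forces star percolation at lower intensity\<close>

lemma star_crosses_mono:
  assumes "star_crosses d r j n \<omega>" "\<omega> \<subseteq> \<omega>'"
  shows "star_crosses d r j n \<omega>'"
proof -
  have "sstep d r \<omega> \<subseteq> sstep d r \<omega>'"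
    unfolding sstep_def using simplex_verts_mono[OF _ assms(2)] by blast
  then have "(sstep d r \<omega>)\<^sup>* \<subseteq> (sstep d r \<omega>')\<^sup>*" by (rule rtrancl_mono)
  then show ?thesis
    using assms(1) simplex_verts_mono[OF _ assms(2)] unfolding star_crosses_def by blast
qed

lemma star_crosses_le: "star_crosses d r j n \<omega> \<Longrightarrow> n' \<le> n \<Longrightarrow> star_crosses d r j n' \<omega>"
  unfolding star_crosses_def by (meson order_trans)

text \<open>The restriction \<open>j \<le> n\<close> singles out the crossings known to be decided
  in a bounded window, hence measurable.\<close>

lemma star_percolates_iff:
  assumes "loc_finite \<omega>"
  shows "star_percolates d r \<omega> \<longleftrightarrow> (\<exists>j::nat. \<forall>n::nat. j \<le> n \<longrightarrow> star_crosses d r (real j) (real n) \<omega>)"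
proof
  assume "star_percolates d r \<omega>"
  then show "\<exists>j::nat. \<forall>n::nat. j \<le> n \<longrightarrow> star_crosses d r (real j) (real n) \<omega>"
    using star_percolates_imp_crosses[OF assms] by blast
next
  assume "\<exists>j::nat. \<forall>n::nat. j \<le> n \<longrightarrow> star_crosses d r (real j) (real n) \<omega>"
  then obtain j :: nat where j: "\<And>n::nat. j \<le> n \<Longrightarrow> star_crosses d r (real j) (real n) \<omega>" by blast
  have "star_crosses d r j (real n) \<omega>" for n
    by (rule star_crosses_le[OF j[of "max j n"]]) simp_all
  then show "star_percolates d r \<omega>" by (rule crosses_imp_star_percolates[OF assms])
qed

lemma star_crosses_sets:
  assumes P: "is_PPP P lam" and jn: "j \<le> n" and r: "0 \<le> r"
  shows "{\<omega>\<in>space P. star_crosses d r j n \<omega>} \<in> sets P"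
proof -
  obtain N :: nat where N: "n + r + 2 \<le> N" using real_arch_simple by blast
  have sub: "cball 0 (n + r + 2) \<subseteq> region 1 N" by (rule cball_subset_region) (use N in auto)
  have "{\<omega>\<in>space P. star_crosses d r j n \<omega>} = {\<omega>\<in>space P. star_crosses d r j n (\<omega> \<inter> region 1 N)}"
    using star_crosses_local[OF _ jn r sub] star_crosses_mono[OF _ Int_lower1] by blast
  then show ?thesis using PPP_limit_closed_sets[OF P limit_closed_star_crosses, of 1] by simp
qed

lemma star_percolates_sets:
  assumes P: "is_PPP P lam" and r: "0 \<le> r"
  shows "{\<omega>\<in>space P. star_percolates d r \<omega>} \<in> sets P"
proof -
  have "{\<omega>\<in>space P. star_percolates d r \<omega>}
      = (\<Union>j::nat. \<Inter>n\<in>{j..}. {\<omega>\<in>space P. star_crosses d r (real j) (real n) \<omega>})"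
  proof (rule set_eqI)
    fix \<omega>
    show "\<omega> \<in> {\<omega>\<in>space P. star_percolates d r \<omega>} \<longleftrightarrow>
      \<omega> \<in> (\<Union>j::nat. \<Inter>n\<in>{j..}. {\<omega>\<in>space P. star_crosses d r (real j) (real n) \<omega>})"
    proof (cases "\<omega> \<in> space P")
      case True
      have "\<omega> \<in> (\<Union>j::nat. \<Inter>n\<in>{j..}. {\<omega>\<in>space P. star_crosses d r (real j) (real n) \<omega>})
        \<longleftrightarrow> (\<exists>j::nat. \<forall>n\<in>{j..}. \<omega> \<in> {\<omega>\<in>space P. star_crosses d r (real j) (real n) \<omega>})" by blast
      then show ?thesis using star_percolates_iff[OF PPP_loc_finite[OF P True], of d r] True
        by (simp only: mem_Collect_eq atLeast_iff Ball_def simp_thms)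
    qed auto
  qed
  also have "\<dots> \<in> sets P"
    by (intro sets.countable_UN image_subsetI sets.countable_INT star_crosses_sets[OF P _ r]) auto
  finally show ?thesis .
qed

lemma occ_bounds:
  assumes "0 \<le> lam"
  shows "0 \<le> occ lam h w \<and> occ lam h w \<le> 1"
  using assms by (simp add: occ_def)

text \<open>\<open>1 - exp (- x)\<close> is concave and vanishes at 0.\<close>

lemma occ_concave:
  assumes "0 < lam'" "lam' \<le> lam"
  shows "lam' / lam * occ lam h w \<le> occ lam' h w"
proof -
  define v where "v = measure lborel (cell h w)"
  define q where "q = lam' / lam"
  have q: "0 \<le> q" "q \<le> 1" using assms by (auto simp: q_def)
  have "exp ((1 - q) *\<^sub>R 0 + q *\<^sub>R (- (lam * v))) \<le> (1 - q) * exp 0 + q * exp (- (lam * v))"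
    by (rule convex_onD[OF exp_convex]) (use q in auto)
  moreover have "q * lam = lam'" using assms by (simp add: q_def)
  ultimately have "exp (- (lam' * v)) \<le> 1 - q + q * exp (- (lam * v))"
    by (simp add: mult.assoc[symmetric])
  then show ?thesis unfolding occ_def v_def[symmetric] q_def[symmetric] by (simp add: algebra_simps)
qed

text \<open>The emptiness probabilities of the cells multiply to that of the whole block, so the
  bound is the same for all meshes; the ball makes it the same for all blocks.\<close>

lemma wt_cells_empty:
  fixes b :: "int^'n" and s :: real
  assumes s: "s > 0" and lam: "lam \<ge> 0"
  shows "exp (- (lam * measure lborel (cball (0::real^'n) (s * CARD('n))))) \<le> wt (cells s m b) (occ lam (s / Suc m)) {}"
proof -
  let ?h = "s / Suc m"
  have h: "?h > 0" using s by simp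
  have cs: "cell ?h w \<in> sets lborel" "emeasure lborel (cell ?h w) \<noteq> \<infinity>" for w :: "int^'n"
    using cell_sets[OF h] emeasure_bounded_finite[OF bounded_cell[OF h]] by (auto simp: less_top[symmetric])
  have "(\<Sum>w\<in>cells s m b. measure lborel (cell ?h w)) = measure lborel (\<Union>w\<in>cells s m b. cell ?h w)"
    by (rule measure_finite_Union[symmetric]) (use finite_cells[OF s] cs disjoint_cells in auto)
  also have "(\<Union>w\<in>cells s m b. cell ?h w) = cell s b"
    unfolding cell_def using in_cells_iff[of s m _ b] by auto
  also have "measure lborel (cell s b) \<le> measure lborel (cball (\<chi> i. s * real_of_int (b $ i)) (s * CARD('n)))"
    using cell_sets[OF s] emeasure_bounded_finite[OF bounded_cball]
    by (intro measure_mono_fmeasurable[OF cell_subset_cball[OF s]] fmeasurableI) auto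
  also have "\<dots> = measure lborel (cball (0::real^'n) (s * CARD('n)))"
    using s by (simp add: content_cball)
  finally have "lam * (\<Sum>w\<in>cells s m b. measure lborel (cell ?h w)) \<le> lam * measure lborel (cball (0::real^'n) (s * CARD('n)))"
    by (rule mult_left_mono[OF _ lam])
  moreover have "wt (cells s m b) (occ lam ?h) {} = exp (- (lam * (\<Sum>w\<in>cells s m b. measure lborel (cell ?h w))))"
    using finite_cells[OF s, of m b] unfolding wt_def occ_def
    by (simp add: exp_sum sum_distrib_left sum_negf[symmetric])
  ultimately show ?thesis by simp
qed

text \<open>Families free of conflicts are those whose erasure a face path can bridge according to
  \<open>erase_blocks\<close>.\<close>

definition conflict :: "real \<Rightarrow> int^'n \<Rightarrow> int^'n \<Rightarrow> bool" where
  "conflict s b c \<longleftrightarrow> b \<noteq> c \<and> (\<exists>p q :: real^'n. blk s p = b \<and> blk s q = c \<and> dist p q \<le> 2)"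

text \<open>The erasure inequality with blocks of side \<open>s\<close>, each made of mesh cells.
  Erasing shifts the radii by 3 and passing from blocks to simplices by 1 more, in total 4.
  \<open>K\<close> bounds the conflicts of a block and \<open>k0\<close> its certificates; neither
  involves \<open>m\<close> or \<open>N\<close>.\<close>

lemma mesh_inequality:
  fixes s r lam lam' j n :: real and m N d :: nat
  defines "V \<equiv> measure lborel (cball (0::real^'n) (s * CARD('n)))"
    and "K \<equiv> card {w :: int^'n. \<forall>i. \<bar>w $ i\<bar> \<le> \<lceil>2 / s\<rceil> + 1}"
    and "k0 \<equiv> card {w :: int^'n. \<forall>i. \<bar>w $ i\<bar> \<le> \<lceil>1 / s\<rceil> + 1} * (d + 1)"
    and "I \<equiv> (mesh_cells s m N :: (int^'n) set)"
  assumes s: "s > 0" "s * CARD('n) \<le> 1" and r: "2 + 3 * (s * CARD('n)) \<le> r"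
    and lam: "0 < lam'" "lam' \<le> lam" and jn: "j + 3 < n"
    and qk: "1 \<le> (1 + exp (- (lam * V)) / 2 ^ K) * (lam' / lam) ^ k0"
  shows "(\<Sum>A\<in>Pow I. wt I (occ lam (s / Suc m)) A * of_bool (realizes s m (face_crosses d j n) A))
    \<le> (\<Sum>A\<in>Pow I. wt I (occ lam' (s / Suc m)) A * of_bool (realizes s m (star_crosses d r (j + 4) (n - 4)) A))"
proof -
  let ?h = "s / Suc m"
  define \<rho> where "\<rho> = 2 + s * CARD('n)"
  define U :: "(int^'n) set \<Rightarrow> bool" where "U = realizes s m (block_crosses d s \<rho> (j + 3) (n - 3))"
  have h: "?h > 0" using s by simp
  have "(\<Sum>A\<in>Pow I. wt I (occ lam ?h) A * of_bool (realizes s m (face_crosses d j n) A))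
    \<le> (\<Sum>A\<in>Pow I. wt I (occ lam' ?h) A * of_bool (U A))"
    unfolding I_def mesh_cells_def
  proof (rule erasure_inequality[where conf = "conflict s" and q = "lam' / lam"
        and \<kappa> = "exp (- (lam * V))" and K = K and k = k0])
    fix b :: "int^'n" assume "b \<in> blocks N"
    show "card {b' \<in> blocks N. conflict s b b'} \<le> K"
    proof -
      have sub: "{b' \<in> blocks N. conflict s b b'} \<subseteq> {w. \<forall>i. \<bar>w $ i - b $ i\<bar> \<le> \<lceil>2 / s\<rceil> + 1}"
      proof (intro subsetI CollectI allI)
        fix b' i assume "b' \<in> {b' \<in> blocks N. conflict s b b'}"
        then obtain p q :: "real^'n" where pq: "blk s p = b" "blk s q = b'" "dist p q \<le> 2"
          unfolding conflict_def by blast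
        then have "dist q p \<le> 2" by (simp add: dist_commute)
        then show "\<bar>b' $ i - b $ i\<bar> \<le> \<lceil>2 / s\<rceil> + 1" using blk_near[OF s(1), of q p 2 i] pq by simp
      qed
      show ?thesis unfolding K_def
        by (rule order_trans[OF card_mono[OF int_box_translate(1) sub] int_box_translate(2)])
    qed
    show "exp (- (lam * V)) \<le> wt (cells s m b) (occ lam ?h) {}"
      unfolding V_def by (rule wt_cells_empty) (use s lam in auto)
  next
    fix A T :: "(int^'n) set"
    assume A: "A \<subseteq> \<Union> (cells s m ` blocks N)" "realizes s m (face_crosses d j n) A"
      and T: "T \<subseteq> blocks N" "\<forall>x\<in>T. \<forall>y\<in>T. x \<noteq> y \<longrightarrow> \<not> conflict s x y"
    obtain \<omega> where \<omega>: "inj_on (blk ?h) \<omega>" "blk ?h ` \<omega> = A" "face_crosses d j n \<omega>"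
      using A(2) unfolding realizes_def by blast
    have "block_crosses d s \<rho> (j + 3) (n - 3) {x \<in> \<omega>. blk s x \<notin> T}"
      by (rule erase_blocks[OF s \<rho>_def jn \<omega>(3)]) (use T(2) in \<open>auto simp: conflict_def\<close>)
    moreover have "blk ?h ` {x \<in> \<omega>. blk s x \<notin> T} = A - \<Union> (cells s m ` T)"
    proof -
      have "blk ?h x \<in> \<Union> (cells s m ` T) \<longleftrightarrow> blk s x \<in> T" for x :: "real^'n"
        by (simp add: in_cells_iff del: of_nat_Suc)
      then show ?thesis unfolding \<omega>(2)[symmetric] by blast
    qed
    moreover have "inj_on (blk ?h) {x \<in> \<omega>. blk s x \<notin> T}" using \<omega>(1) by (rule inj_on_subset) blast
    ultimately show "U (A - \<Union> (cells s m ` T))" unfolding U_def realizes_def by blast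
  next
    fix A A' :: "(int^'n) set" assume UA: "U A" and AA: "A \<subseteq> A'"
    obtain \<omega> where \<omega>: "inj_on (blk ?h) \<omega>" "blk ?h ` \<omega> = A" "block_crosses d s \<rho> (j + 3) (n - 3) \<omega>"
      using UA unfolding U_def realizes_def by blast
    define corner :: "int^'n \<Rightarrow> real^'n" where "corner w = (\<chi> i. ?h * real_of_int (w $ i))" for w
    have corner: "blk ?h (corner w) = w" for w unfolding corner_def by (rule blk_corner[OF h])
    \<comment> \<open>Additional occupied cells are realized by their corners, which keeps exactly
      one point in each cell.\<close>
    define \<omega>' where "\<omega>' = \<omega> \<union> corner ` (A' - A)"
    have "block_crosses d s \<rho> (j + 3) (n - 3) \<omega>'"
      by (rule block_crosses_mono_good[OF \<omega>(3)]) (auto simp: \<omega>'_def intro: good_mono)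
    moreover have "blk ?h ` \<omega>' = A'"
    proof -
      have "blk ?h ` corner ` (A' - A) = A' - A" by (simp only: image_image corner image_ident)
      then show ?thesis unfolding \<omega>'_def image_Un \<omega>(2) using AA by auto
    qed
    moreover have "inj_on (blk ?h) \<omega>'"
    proof -
      have "inj_on (blk ?h) (corner ` (A' - A))" by (intro inj_onI) (metis corner imageE)
      moreover have "blk ?h ` corner ` (A' - A) = A' - A" by (simp only: image_image corner image_ident)
      ultimately show ?thesis unfolding \<omega>'_def inj_on_Un using \<omega>(1,2) by blast
    qed
    ultimately show "U A'" unfolding U_def realizes_def by blast
  next
    fix A and b :: "int^'n" assume A: "A \<subseteq> \<Union> (cells s m ` blocks N)" "U A" "b \<in> blocks N"
    obtain \<omega> where \<omega>: "inj_on (blk ?h) \<omega>" "blk ?h ` \<omega> = A" "block_crosses d s \<rho> (j + 3) (n - 3) \<omega>"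
      using A(2) unfolding U_def realizes_def by blast
    obtain C where C: "C \<subseteq> {x \<in> \<omega>. blk s x = b}" "finite C" "card C \<le> k0"
      "block_crosses d s \<rho> (j + 3) (n - 3) ({x \<in> \<omega>. blk s x \<noteq> b} \<union> C)"
      using block_crosses_certificate[OF s(1) \<omega>(3), of b] unfolding k0_def by blast
    have "blk ?h ` C \<subseteq> A \<inter> cells s m b" using C(1) \<omega>(2) in_cells_iff[of s m _ b] by blast
    moreover have "card (blk ?h ` C) \<le> k0" using card_image_le[OF C(2)] C(3) order_trans by blast
    moreover have "U ((A - cells s m b) \<union> blk ?h ` C)"
    proof -
      have "blk ?h ` {x \<in> \<omega>. blk s x \<noteq> b} = A - cells s m b"
        using in_cells_iff[of s m _ b] unfolding \<omega>(2)[symmetric] by blast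
      then have "blk ?h ` ({x \<in> \<omega>. blk s x \<noteq> b} \<union> C) = (A - cells s m b) \<union> blk ?h ` C"
        by (simp only: image_Un)
      moreover have "inj_on (blk ?h) ({x \<in> \<omega>. blk s x \<noteq> b} \<union> C)"
        using \<omega>(1) by (rule inj_on_subset) (use C(1) in blast)
      ultimately show ?thesis unfolding U_def realizes_def using C(4) by blast
    qed
    ultimately show "\<exists>C\<subseteq>A \<inter> cells s m b. card C \<le> k0 \<and> U ((A - cells s m b) \<union> C)" by blast
  next
    show "0 \<le> occ lam' ?h c \<and> occ lam' ?h c \<le> 1" for c :: "int^'n"
      by (rule occ_bounds) (use lam in simp)
    show "0 \<le> occ lam ?h c \<and> occ lam ?h c \<le> 1" for c :: "int^'n"
      by (rule occ_bounds) (use lam in simp)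
    show "lam' / lam * occ lam ?h c \<le> occ lam' ?h c" for c :: "int^'n"
      by (rule occ_concave[OF lam])
    show "conflict s y x" if "conflict s x y" for x y :: "int^'n"
      using that unfolding conflict_def by (metis dist_commute)
    show "cells s m b \<inter> cells s m b' = {}" if "b \<noteq> b'" for b b' :: "int^'n"
      by (rule disjoint_cells_blocks[OF that])
  qed (use lam qk finite_blocks finite_cells[OF s(1)] in auto)
  \<comment> \<open>Simplices return only after the comparison of laws, which relies on certificates
    for block crossings.\<close>
  also have "\<dots> \<le> (\<Sum>A\<in>Pow I. wt I (occ lam' ?h) A * of_bool (realizes s m (star_crosses d r (j + 4) (n - 4)) A))"
  proof (intro sum_mono mult_left_mono)
    fix A assume "A \<in> Pow I"
    then show "0 \<le> wt I (occ lam' ?h) A" using lam by (intro wt_nonneg occ_bounds) auto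
    have "star_crosses d r (j + 4) (n - 4) \<omega>" if "block_crosses d s \<rho> (j + 3) (n - 3) \<omega>" for \<omega> :: "(real^'n) set"
      using block_crosses_imp_star[OF s _ that, of r] r by (simp add: \<rho>_def add.commute)
    then have "realizes s m (star_crosses d r (j + 4) (n - 4)) A" if "U A"
      using that unfolding U_def realizes_def by blast
    then show "(of_bool (U A) :: real) \<le> of_bool (realizes s m (star_crosses d r (j + 4) (n - 4)) A)" by simp
  qed
  finally show ?thesis .
qed

text \<open>Face percolation is covered by countably many events \<open>A j\<close>, each demanding
  crossings from radius \<open>j\<close> to all larger radii, so one of them has positive
  probability. That probability bounds from below the decreasing star events \<open>S n\<close>, and
  therefore their intersection.\<close>

lemma star_of_face:
  fixes P P' :: "(real^'n) set measure" and s r lam lam' :: real and d :: nat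
  defines "V \<equiv> measure lborel (cball (0::real^'n) (s * CARD('n)))"
    and "K \<equiv> card {w :: int^'n. \<forall>i. \<bar>w $ i\<bar> \<le> \<lceil>2 / s\<rceil> + 1}"
    and "k0 \<equiv> card {w :: int^'n. \<forall>i. \<bar>w $ i\<bar> \<le> \<lceil>1 / s\<rceil> + 1} * (d + 1)"
  assumes P: "is_PPP P lam" and P': "is_PPP P' lam'" and d: "1 \<le> d"
    and s: "s > 0" "s * CARD('n) \<le> 1" and r: "2 + 3 * (s * CARD('n)) \<le> r"
    and lam: "0 < lam'" "lam' \<le> lam"
    and qk: "1 \<le> (1 + exp (- (lam * V)) / 2 ^ K) * (lam' / lam) ^ k0"
    and pos: "0 < measure P {\<omega>\<in>space P. face_percolates d \<omega>}"
  shows "0 < measure P' {\<omega>\<in>space P'. star_percolates d r \<omega>}"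
proof -
  interpret P: prob_space P using PPP_prob_space[OF P] .
  interpret P': prob_space P' using PPP_prob_space[OF P'] .
  have r0: "0 \<le> r" using r s by (smt (verit) mult_nonneg_nonneg of_nat_0_le_iff)
  define N where "N n = nat \<lceil>(real n + 1) / s\<rceil>" for n :: nat
  have N: "cball 0 (real n + 1) \<subseteq> (region s (N n) :: (real^'n) set)" for n
  proof (rule cball_subset_region[OF s(1)])
    have "(real n + 1) / s \<le> real (N n)" unfolding N_def by linarith
    then show "real n + 1 \<le> s * real (N n)" using s(1) by (simp add: divide_le_eq mult.commute)
  qed
  define F where "F j n = {\<omega>\<in>space P. face_crosses d (real j) (real n) (\<omega> \<inter> region s (N n))}" for j n
  \<comment> \<open>The offset 9 leaves room for the shift by 4 at both ends:
    \<open>n \<ge> j + 9\<close> gives \<open>n - 4 \<ge> j + 5\<close>, above the inner radius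
    \<open>j + 4\<close>.\<close>
  define A where "A j = (\<Inter>n\<in>{j + 9..}. F j n)" for j
  have sF: "F j n \<in> sets P" if "j < n" for j n
    unfolding F_def by (intro PPP_limit_closed_sets[OF P limit_closed_face_crosses s(1)]) (use that in simp)
  have sA: "A j \<in> sets P" for j
    unfolding A_def by (intro sets.countable_INT image_subsetI sF) auto
  have "\<exists>j. 0 < measure P (A j)"
  proof (rule ccontr)
    assume "\<not> ?thesis"
    then have "measure P (A j) = 0" for j by (meson measure_nonneg not_less order_antisym)
    then have "A j \<in> null_sets P" for j using sA by (simp add: P.emeasure_eq_measure null_sets_def)
    then have null: "(\<Union>j. A j) \<in> null_sets P" by (rule null_sets_UN)
    have "{\<omega>\<in>space P. face_percolates d \<omega>} \<subseteq> (\<Union>j. A j)"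
    proof
      fix \<omega> assume "\<omega> \<in> {\<omega>\<in>space P. face_percolates d \<omega>}"
      then have \<omega>: "\<omega> \<in> space P" "face_percolates d \<omega>" by auto
      obtain j :: nat where j: "\<And>n. face_crosses d j n \<omega>"
        using face_percolates_imp_crosses[OF PPP_loc_finite[OF P \<omega>(1)] d \<omega>(2)] by blast
      have "\<omega> \<in> F j n" if "n \<ge> j + 9" for n
        unfolding F_def using face_crosses_local[OF j _ N, of n] that \<omega>(1) by simp
      then show "\<omega> \<in> (\<Union>j. A j)" unfolding A_def by blast
    qed
    then have "measure P {\<omega>\<in>space P. face_percolates d \<omega>} \<le> measure P (\<Union>j. A j)"
      using sA by (intro P.finite_measure_mono) auto
    also have "\<dots> = 0" using null by (simp add: P.emeasure_eq_measure null_sets_def)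
    finally show False using pos by simp
  qed
  then obtain j where j: "0 < measure P (A j)" by blast
  define S where "S n = {\<omega>\<in>space P'. star_crosses d r (real (j + 4)) (real (n + j + 5)) \<omega>}" for n
  have sS: "S n \<in> sets P'" for n unfolding S_def by (rule star_crosses_sets[OF P' _ r0]) simp
  have AS: "measure P (A j) \<le> measure P' (S n)" for n
  proof -
    let ?n = "n + j + 9"
    have "measure P (A j) \<le> measure P (F j ?n)"
      by (intro P.finite_measure_mono sF) (auto simp: A_def)
    also have "\<dots> \<le> measure P' {\<omega>\<in>space P'. star_crosses d r (real j + 4) (real ?n - 4) (\<omega> \<inter> region s (N ?n))}"
      unfolding F_def
    proof (rule PPP_transfer[OF P P' limit_closed_face_crosses limit_closed_star_crosses s(1)])
      show "(\<Sum>A\<in>Pow (mesh_cells s m (N ?n) :: (int^'n) set).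
          wt (mesh_cells s m (N ?n)) (occ lam (s / Suc m)) A * of_bool (realizes s m (face_crosses d j ?n) A))
        \<le> (\<Sum>A\<in>Pow (mesh_cells s m (N ?n) :: (int^'n) set).
          wt (mesh_cells s m (N ?n)) (occ lam' (s / Suc m)) A * of_bool (realizes s m (star_crosses d r (real j + 4) (real ?n - 4)) A))" for m
        by (rule mesh_inequality[OF s r lam _ qk[unfolded V_def K_def k0_def], of "real j" "real ?n" m "N ?n"]) simp
    qed simp
    also have "\<dots> \<le> measure P' (S n)"
    proof (intro P'.finite_measure_mono sS subsetI)
      fix \<omega> assume "\<omega> \<in> {\<omega>\<in>space P'. star_crosses d r (real j + 4) (real ?n - 4) (\<omega> \<inter> region s (N ?n))}"
      then have "\<omega> \<in> space P'" "star_crosses d r (real j + 4) (real ?n - 4) (\<omega> \<inter> region s (N ?n))" by auto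
      moreover have "real j + 4 = real (j + 4)" "real ?n - 4 = real (n + j + 5)" by simp_all
      ultimately show "\<omega> \<in> S n"
        unfolding S_def using star_crosses_mono[OF _ Int_lower1] by (simp only: mem_Collect_eq) blast
    qed
    finally show ?thesis .
  qed
  have "decseq S"
    unfolding decseq_def S_def using star_crosses_le by (fastforce simp del: of_nat_add)
  then have "(\<lambda>n. measure P' (S n)) \<longlonglongrightarrow> measure P' (\<Inter>n. S n)"
    using sS by (intro P'.finite_Lim_measure_decseq) auto
  then have "measure P (A j) \<le> measure P' (\<Inter>n. S n)"
    by (rule LIMSEQ_le_const) (use AS in blast)
  also have "\<dots> \<le> measure P' {\<omega>\<in>space P'. star_percolates d r \<omega>}"
  proof (intro P'.finite_measure_mono star_percolates_sets[OF P' r0] subsetI)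
    fix \<omega> assume \<omega>: "\<omega> \<in> (\<Inter>n. S n)"
    then have sp: "\<omega> \<in> space P'" unfolding S_def by blast
    have "star_crosses d r (real (j + 4)) (real n) \<omega>" for n
      using \<omega> star_crosses_le[of d r "real (j + 4)" "real (n + j + 5)" \<omega> "real n"] unfolding S_def by auto
    then have "star_percolates d r \<omega>" by (rule crosses_imp_star_percolates[OF PPP_loc_finite[OF P' sp]])
    then show "\<omega> \<in> {\<omega>\<in>space P'. star_percolates d r \<omega>}" using sp by blast
  qed
  finally show ?thesis using j by simp
qed

section \<open>Nondegenerate critical values\<close>

text \<open>There are at most \<open>K ^ l\<close> walks, and the \<open>Suc l\<close> distinct sets
  on each are disjoint, so their counts are independent. Used with \<open>S\<close> the positive
  counts for small intensities and with \<open>S\<close> the counts up to \<open>d\<close> for large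
  ones.\<close>

lemma PPP_walk:
  fixes A :: "'v \<Rightarrow> (real^'n) set" and P :: "(real^'n) set measure"
  assumes P: "is_PPP P lam" and A: "\<And>v. A v \<in> sets lborel \<and> bounded (A v)"
    and disj: "disjoint_family A" and fin: "\<And>v. finite (nb v)" and K: "\<And>v. card (nb v) \<le> K"
    and \<rho>: "0 \<le> \<rho>" "\<And>v. measure P {\<omega>\<in>space P. card (\<omega> \<inter> A v) \<in> S} \<le> \<rho>"
  defines "W l a \<equiv> {\<omega>\<in>space P. \<exists>xs\<in>walks nb l a. distinct xs \<and> (\<forall>v\<in>set xs. card (\<omega> \<inter> A v) \<in> S)}"
  shows "W l a \<in> sets P" and "measure P (W l a) \<le> real K ^ l * \<rho> ^ Suc l"
proof -
  interpret prob_space P using PPP_prob_space[OF P] .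
  define E where "E xs = {\<omega>\<in>space P. \<forall>v\<in>set xs. card (\<omega> \<inter> A v) \<in> S}" for xs
  let ?X = "{xs \<in> walks nb l a. distinct xs}"
  have finX: "finite ?X" by (rule finite_subset[OF _ finite_walks[where nb = nb and l = l and a = a, OF fin]]) blast
  have W: "W l a = (\<Union>xs\<in>?X. E xs)"
  proof (intro equalityI subsetI)
    fix \<omega> assume "\<omega> \<in> W l a"
    then have \<omega>: "\<omega> \<in> space P" "\<exists>xs\<in>walks nb l a. distinct xs \<and> (\<forall>v\<in>set xs. card (\<omega> \<inter> A v) \<in> S)"
      unfolding W_def by simp_all
    from \<omega>(2) obtain xs where "xs \<in> walks nb l a" "distinct xs" "\<forall>v\<in>set xs. card (\<omega> \<inter> A v) \<in> S"
      by (elim bexE conjE)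
    then show "\<omega> \<in> (\<Union>xs\<in>?X. E xs)" using \<omega>(1) by (intro UN_I[of xs]) (simp_all add: E_def)
  next
    fix \<omega> assume "\<omega> \<in> (\<Union>xs\<in>?X. E xs)"
    then obtain xs where "xs \<in> ?X" "\<omega> \<in> E xs" by (elim UN_E)
    then show "\<omega> \<in> W l a" unfolding W_def E_def by (simp add: bexI[of _ xs])
  qed
  have sE: "E xs \<in> sets P" for xs
    unfolding E_def
  proof (rule sets.sets_Collect_finite_All)
    show "{\<omega> \<in> space P. card (\<omega> \<inter> A v) \<in> S} \<in> sets P" for v
      by (rule PPP_sets[OF P]) (simp_all only: A)
  qed simp
  then show "W l a \<in> sets P" unfolding W using finX by (intro sets.finite_UN) auto
  have "measure P (W l a) \<le> (\<Sum>xs\<in>?X. measure P (E xs))"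
    unfolding W by (rule finite_measure_subadditive_finite) (use finX sE in auto)
  also have "\<dots> \<le> (\<Sum>xs\<in>?X. \<rho> ^ Suc l)"
  proof (rule sum_mono)
    fix xs assume xs: "xs \<in> ?X"
    have dj: "disjoint_family_on A (set xs)" using disj unfolding disjoint_family_on_def by blast
    have "measure P (E xs) = (\<Prod>v\<in>set xs. measure P {\<omega>\<in>space P. card (\<omega> \<inter> A v) \<in> S})"
      unfolding E_def by (rule PPP_indep[OF P _ A dj]) simp
    also have "\<dots> \<le> (\<Prod>v\<in>set xs. \<rho>)"
      by (intro prod_mono conjI measure_nonneg \<rho>(2))
    also have "\<dots> = \<rho> ^ Suc l" using xs walks_length[of xs nb l a] distinct_card[of xs] by simp
    finally show "measure P (E xs) \<le> \<rho> ^ Suc l" .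
  qed
  also have "\<dots> = real (card ?X) * \<rho> ^ Suc l" by simp
  also have "\<dots> \<le> real K ^ l * \<rho> ^ Suc l"
  proof (rule mult_right_mono)
    have "card ?X \<le> card (walks nb l a)" by (rule card_mono[OF finite_walks[where nb = nb, OF fin]]) blast
    also have "\<dots> \<le> K ^ l" by (rule card_walks[where nb = nb, OF fin K])
    finally show "real (card ?X) \<le> real K ^ l" by (simp only: of_nat_le_iff of_nat_power[symmetric])
  qed (use \<rho>(1) in simp)
  finally show "measure P (W l a) \<le> real K ^ l * \<rho> ^ Suc l" .
qed

lemma infinite_path_walks:
  assumes "inj f" "\<And>i. (f i, f (Suc i)) \<in> r" "\<And>u v. (u, v) \<in> r \<Longrightarrow> v \<in> nb u"
  shows "map f [0..<Suc l] \<in> walks nb l (f 0) \<and> distinct (map f [0..<Suc l])"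
proof
  have eq: "map f [0..<Suc l] = f 0 # map (\<lambda>i. f (Suc i)) [0..<l]"
    by (rule map_upt_Suc)
  have "successively (\<lambda>x y. y \<in> nb x) (map f [0..<Suc l])"
    unfolding successively_conv_nth
  proof (intro allI impI)
    fix i assume "Suc i < length (map f [0..<Suc l])"
    then have "map f [0..<Suc l] ! i = f i" "map f [0..<Suc l] ! Suc i = f (Suc i)"
      by (simp_all add: nth_map del: upt_Suc)
    then show "map f [0..<Suc l] ! Suc i \<in> nb (map f [0..<Suc l] ! i)"
      using assms(3)[OF assms(2)[of i]] by (simp only:)
  qed
  then show "map f [0..<Suc l] \<in> walks nb l (f 0)"
    using in_walks[of nb "f 0" "map (\<lambda>i. f (Suc i)) [0..<l]"] unfolding eq by simp
  show "distinct (map f [0..<Suc l])"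
    using inj_on_subset[OF assms(1) subset_UNIV] by (simp add: distinct_map del: upt_Suc)
qed

lemma loc_finite_cell:
  fixes \<omega> :: "(real^'n) set"
  assumes "loc_finite \<omega>" "s > 0"
  shows "finite (\<omega> \<inter> cell s w)"
proof -
  obtain r where "\<forall>x\<in>(cell s w :: (real^'n) set). norm x \<le> r"
    using bounded_cell[OF assms(2), of w] unfolding bounded_iff by (rule exE)
  then have "\<omega> \<inter> cell s w \<subseteq> \<omega> \<inter> cball 0 r" by (intro Int_mono subset_refl subsetI) simp
  moreover have "finite (\<omega> \<inter> cball 0 r)" using assms(1) unfolding loc_finite_def by (rule spec)
  ultimately show ?thesis by (rule finite_subset)
qed

text \<open>The unit cubes visited by the unbounded point path are infinitely many, so
  \<open>koenig_path\<close> gives an injective path of occupied cubes. The radius 2 is the bound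
  \<open>\<lceil>1\<rceil> + 1\<close> of \<open>blk_near\<close> for points at distance at most
  1.\<close>

lemma face_percolates_block_walks:
  fixes \<omega> :: "(real^'n) set"
  assumes lf: "loc_finite \<omega>" and d: "1 \<le> d" and perc: "face_percolates d \<omega>"
  shows "\<exists>b. \<forall>l. \<exists>xs\<in>walks (\<lambda>b. {c. \<forall>i. \<bar>c $ i - b $ i\<bar> \<le> 2}) l b. distinct xs \<and>
    (\<forall>c\<in>set xs. card (\<omega> \<inter> cell 1 c) \<in> {0<..})"
proof -
  let ?nb = "\<lambda>b :: int^'n. {c. \<forall>i. \<bar>c $ i - b $ i\<bar> \<le> 2}"
  define R where "R = {(b, c). b \<in> blk 1 ` \<omega> \<and> c \<in> blk 1 ` \<omega> \<and> c \<in> ?nb b}"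
  from face_percolates_reach[OF assms]
  obtain x where x: "x \<in> \<omega>" "\<forall>n. \<exists>y. n \<le> norm y \<and> (x, y) \<in> (pstep d \<omega>)\<^sup>*" by (elim bexE)
  have finR: "finite (R `` {b})" for b
  proof (rule finite_subset[OF _ int_box_translate(1)[of b 2]])
    show "R `` {b} \<subseteq> ?nb b" by (intro subsetI) (simp add: R_def)
  qed
  have step: "(blk 1 u, blk 1 v) \<in> R" if uv: "(u, v) \<in> pstep d \<omega>" for u v
  proof -
    obtain V where V: "simplex_verts d \<omega> V" "u \<in> V" "v \<in> V" using uv unfolding pstep_def by blast
    have "dist v u \<le> 1" by (rule simplex_verts_dist[OF V(1,3,2)])
    then have "\<bar>blk 1 v $ i - blk 1 u $ i\<bar> \<le> 2" for i using blk_near[of 1 v u 1 i] by simp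
    moreover have "u \<in> \<omega>" "v \<in> \<omega>" using V(2,3) simplex_verts_ne[OF V(1)] by blast+
    ultimately show ?thesis unfolding R_def by simp
  qed
  have "infinite (R\<^sup>* `` {blk 1 x})"
  proof
    assume "finite (R\<^sup>* `` {blk 1 x})"
    then have "bounded (\<Union>b\<in>R\<^sup>* `` {blk 1 x}. cell 1 b)" by (intro bounded_UN ballI bounded_cell) simp_all
    then obtain M where M: "\<forall>y\<in>(\<Union>b\<in>R\<^sup>* `` {blk 1 x}. cell 1 b). norm y \<le> M" unfolding bounded_iff by (rule exE)
    obtain y where y: "M + 1 \<le> norm y" "(x, y) \<in> (pstep d \<omega>)\<^sup>*" using x(2)[rule_format, of "M + 1"] by (elim exE conjE)
    have "(blk 1 x, blk 1 y) \<in> R\<^sup>*" by (rule rtrancl_image[where h = "blk 1" and r = "pstep d \<omega>", OF y(2) step])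
    then have "y \<in> (\<Union>b\<in>R\<^sup>* `` {blk 1 x}. cell 1 b)" by (intro UN_I[of "blk 1 y"]) (simp_all add: cell_def)
    then have "norm y \<le> M" using M by (rule bspec[rotated])
    then show False using y(1) by simp
  qed
  from koenig_path[of R "blk 1 x", OF finR this]
  obtain f :: "nat \<Rightarrow> int^'n" where f: "inj f" "f 0 = blk 1 x" "\<forall>i. (f i, f (Suc i)) \<in> R"
    by (elim exE conjE)
  have occ: "card (\<omega> \<inter> cell 1 (f i)) \<in> {0<..}" for i
  proof -
    have "f i \<in> blk 1 ` \<omega>" using spec[OF f(3), of i] by (simp add: R_def)
    then obtain z where "z \<in> \<omega>" "f i = blk 1 z" by (elim imageE)
    then have "z \<in> \<omega> \<inter> cell 1 (f i)" by (simp add: cell_def)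
    then have "\<omega> \<inter> cell 1 (f i) \<noteq> {}" by blast
    moreover have "finite (\<omega> \<inter> cell 1 (f i))"
      by (rule loc_finite_cell[OF lf]) simp
    ultimately show ?thesis by (simp add: card_gt_0_iff)
  qed
  have path: "map f [0..<Suc l] \<in> walks ?nb l (f 0) \<and> distinct (map f [0..<Suc l])" for l
    by (rule infinite_path_walks[where nb = ?nb and f = f and r = R, OF f(1) spec[OF f(3)]]) (simp add: R_def)
  show ?thesis
  proof (intro exI[of _ "f 0"] allI bexI conjI)
    show "map f [0..<Suc l] \<in> walks ?nb l (f 0)" "distinct (map f [0..<Suc l])" for l using path by blast+
    show "\<forall>c\<in>set (map f [0..<Suc l]). card (\<omega> \<inter> cell 1 c) \<in> {0<..}" for l
      using occ unfolding set_map by blast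
  qed
qed

lemma measure_cell_le:
  fixes b :: "int^'n"
  assumes "s > 0"
  shows "measure lborel (cell s b) \<le> measure lborel (cball (0::real^'n) (s * CARD('n)))"
proof -
  have "measure lborel (cell s b) \<le> measure lborel (cball (\<chi> i. s * real_of_int (b $ i)) (s * CARD('n)))"
    using cell_sets[OF assms] emeasure_bounded_finite[OF bounded_cball]
    by (intro measure_mono_fmeasurable[OF cell_subset_cball[OF assms]] fmeasurableI) auto
  also have "\<dots> = measure lborel (cball (0::real^'n) (s * CARD('n)))"
    using assms by (simp add: content_cball)
  finally show ?thesis .
qed

text \<open>A unit cube is occupied with probability at most \<open>lam * V\<close> and a walk has
  at most \<open>K\<close> continuations, so the expected number of occupied walks decays like
  \<open>(1 / 2) ^ l\<close>. There are countably many starting cubes.\<close>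

lemma face_null_small:
  fixes P :: "(real^'n) set measure"
  defines "V \<equiv> measure lborel (cball (0::real^'n) CARD('n))"
    and "K \<equiv> card {w :: int^'n. \<forall>i. \<bar>w $ i\<bar> \<le> 2}"
  assumes P: "is_PPP P lam" and d: "1 \<le> d" and lam: "0 \<le> lam" and small: "K * (lam * V) \<le> 1 / 2"
  shows "measure P {\<omega>\<in>space P. face_percolates d \<omega>} = 0"
proof -
  interpret prob_space P using PPP_prob_space[OF P] .
  let ?nb = "\<lambda>b :: int^'n. {c. \<forall>i. \<bar>c $ i - b $ i\<bar> \<le> 2}"
  define W where "W l a = {\<omega>\<in>space P. \<exists>xs\<in>walks ?nb l a. distinct xs \<and> (\<forall>v\<in>set xs. card (\<omega> \<inter> cell 1 v) \<in> {0<..})}" for l a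
  have V0: "0 \<le> lam * V" using lam by (simp add: V_def)
  have cl: "cell 1 v \<in> sets lborel \<and> bounded (cell 1 v)" for v :: "int^'n"
    using cell_sets[of 1 v] bounded_cell[of 1 v] by simp
  have occ: "measure P {\<omega>\<in>space P. card (\<omega> \<inter> cell 1 v) \<in> {0<..}} \<le> lam * V" for v
  proof -
    have "measure P {\<omega>\<in>space P. card (\<omega> \<inter> cell 1 v) \<in> {0<..}} = occ lam 1 v"
      by (rule PPP_occ(2)[OF P]) simp
    also have "\<dots> \<le> lam * measure lborel (cell 1 v)"
      using exp_ge_add_one_self[of "- (lam * measure lborel (cell 1 v))"] unfolding occ_def by simp
    also have "\<dots> \<le> lam * V"
      using measure_cell_le[of 1 v] lam unfolding V_def by (intro mult_left_mono) auto
    finally show ?thesis .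
  qed
  have K: "card (?nb v) \<le> K" "finite (?nb v)" for v
    unfolding K_def by (rule int_box_translate)+
  have W_props: "W l a \<in> sets P" "measure P (W l a) \<le> real K ^ l * (lam * V) ^ Suc l" for l a
    unfolding W_def by (rule PPP_walk[OF P cl disjoint_cells K(2,1) V0 occ])+
  have null: "(\<Inter>l. W l a) \<in> null_sets P" for a
  proof -
    have "measure P (\<Inter>l. W l a) \<le> (1 / 2) ^ l * (lam * V)" for l
    proof -
      have "measure P (\<Inter>l. W l a) \<le> measure P (W l a)" by (intro finite_measure_mono W_props) auto
      also have "\<dots> \<le> real K ^ l * (lam * V) ^ Suc l" by (rule W_props)
      also have "\<dots> = (K * (lam * V)) ^ l * (lam * V)" by (simp add: power_mult_distrib)
      also have "\<dots> \<le> (1 / 2) ^ l * (lam * V)"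
        using small V0 by (intro mult_right_mono power_mono) auto
      finally show ?thesis .
    qed
    moreover have "(\<lambda>l. (1 / 2) ^ l * (lam * V)) \<longlonglongrightarrow> 0 * (lam * V)"
      by (intro tendsto_mult tendsto_const LIMSEQ_realpow_zero) auto
    ultimately have "measure P (\<Inter>l. W l a) \<le> 0" by (intro LIMSEQ_le_const) auto
    then have "measure P (\<Inter>l. W l a) = 0" by (simp add: measure_le_0_iff)
    moreover have "(\<Inter>l. W l a) \<in> sets P" using W_props(1) by (intro sets.countable_INT) auto
    ultimately show ?thesis by (simp add: emeasure_eq_measure null_sets_def)
  qed
  have "{\<omega>\<in>space P. face_percolates d \<omega>} \<subseteq> (\<Union>a. \<Inter>l. W l a)"
  proof
    fix \<omega> assume "\<omega> \<in> {\<omega>\<in>space P. face_percolates d \<omega>}"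
    then have \<omega>: "\<omega> \<in> space P" "face_percolates d \<omega>" by auto
    show "\<omega> \<in> (\<Union>a. \<Inter>l. W l a)"
      using face_percolates_block_walks[OF PPP_loc_finite[OF P \<omega>(1)] d \<omega>(2)] \<omega>(1) unfolding W_def by blast
  qed
  moreover have nullU: "(\<Union>a. \<Inter>l. W l a) \<in> null_sets P" using null by (rule null_sets_UN)
  ultimately have "measure P {\<omega>\<in>space P. face_percolates d \<omega>} \<le> measure P (\<Union>a. \<Inter>l. W l a)"
    by (intro finite_measure_mono) auto
  also have "\<dots> = 0" using nullU by (simp add: emeasure_eq_measure null_sets_def)
  finally show ?thesis by (simp add: measure_le_0_iff)
qed

section \<open>Star percolation at high intensity\<close>

lemma blk_adjacent:
  fixes x y :: "real^'n"
  assumes "s > 0" "\<And>i. \<bar>blk s x $ i - blk s y $ i\<bar> \<le> 1"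
  shows "dist x y \<le> 2 * (s * CARD('n))"
proof -
  have fl: "\<bar>\<lfloor>a\<rfloor> - \<lfloor>b\<rfloor>\<bar> \<le> 1 \<Longrightarrow> \<bar>a - b\<bar> \<le> 2" for a b :: real by linarith
  have "\<bar>(x - y) $ i\<bar> \<le> 2 * s" for i
  proof -
    have "\<bar>\<lfloor>x $ i / s\<rfloor> - \<lfloor>y $ i / s\<rfloor>\<bar> \<le> 1" using assms(2)[of i] unfolding blk_def vec_lambda_beta .
    then have "\<bar>x $ i / s - y $ i / s\<bar> \<le> 2" by (rule fl)
    then have "\<bar>(x $ i - y $ i) / s\<bar> \<le> 2" by (simp only: diff_divide_distrib)
    then show ?thesis using assms(1) by (simp add: divide_le_eq)
  qed
  then have "(\<Sum>i\<in>UNIV. \<bar>(x - y) $ i\<bar>) \<le> (\<Sum>i\<in>(UNIV :: 'n set). 2 * s)" by (intro sum_mono)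
  then show ?thesis using norm_le_l1_cart[of "x - y"] by (simp add: dist_norm mult_ac)
qed

lemma measure_cell_ge:
  fixes w :: "int^'n"
  assumes s: "s > 0"
  shows "s ^ CARD('n) \<le> measure lborel (cell s w)"
proof -
  define a :: "real^'n" where "a = (\<chi> i. s * real_of_int (w $ i))"
  define e :: "real^'n" where "e = (\<chi> i. s)"
  have eB: "e \<bullet> b = s" if "b \<in> Basis" for b
    using that by (auto simp: Basis_vec_def e_def inner_axis)
  have sub: "box a (a + e) \<subseteq> cell s w"
  proof
    fix x assume x: "x \<in> box a (a + e)"
    have "\<lfloor>x $ i / s\<rfloor> = w $ i" for i
    proof -
      have "s * real_of_int (w $ i) < x $ i \<and> x $ i < s * real_of_int (w $ i) + s"
        using x by (auto simp: mem_box_cart a_def e_def)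
      then show ?thesis using s by (simp add: floor_eq_iff pos_le_divide_eq pos_divide_less_eq algebra_simps)
    qed
    then show "x \<in> cell s w" by (simp add: cell_def blk_def vec_eq_iff)
  qed
  have "measure lborel (box a (a + e)) = (\<Prod>b\<in>(Basis :: (real^'n) set). s)"
    using eB s by (simp add: measure_lborel_box_eq inner_add_left)
  also have "\<dots> = s ^ CARD('n)" by simp
  finally have "s ^ CARD('n) = measure lborel (box a (a + e))" by simp
  also have "\<dots> \<le> measure lborel (cell s w)"
    using cell_sets[OF s, of w] emeasure_bounded_finite[OF bounded_cell[OF s, of w]]
    by (intro measure_mono_fmeasurable[OF sub] fmeasurableI) auto
  finally show ?thesis .
qed

lemma poisson_head_tendsto_0: "((\<lambda>x::real. \<Sum>k\<le>d. x ^ k / fact k * exp (- x)) \<longlongrightarrow> 0) at_top"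
proof -
  have "((\<lambda>x::real. x ^ k / fact k * exp (- x)) \<longlongrightarrow> 0) at_top" for k
  proof -
    have "((\<lambda>x::real. x ^ k / exp x * (1 / fact k)) \<longlongrightarrow> 0 * (1 / fact k)) at_top"
      by (intro tendsto_mult tendsto_const tendsto_power_div_exp_0)
    then show ?thesis by (simp add: exp_minus field_simps)
  qed
  then have "((\<lambda>x::real. \<Sum>k\<le>d. x ^ k / fact k * exp (- x)) \<longlongrightarrow> (\<Sum>k\<le>d. 0)) at_top"
    by (intro tendsto_sum)
  then show ?thesis by simp
qed

text \<open>Cells of side \<open>1 / CARD('n)\<close> have diameter at most 1, so any
  \<open>d + 1\<close> points in one cell span a simplex, and points of neighbouring cells are
  within 2. Simplices from different cells differ, since equal hulls would share a vertex.\<close>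

lemma star_percolates_of_cells:
  fixes \<omega> :: "(real^'n) set" and i0 i1 :: 'n
  defines "s \<equiv> 1 / real CARD('n)"
  defines "site v \<equiv> (\<chi> i. if i = i0 then fst v else if i = i1 then snd v else 0) :: int^'n"
  assumes ne: "i0 \<noteq> i1" and r: "2 \<le> r"
    and inf: "infinite (cluster {v. d < card (\<omega> \<inter> cell s (site v))})"
  shows "star_percolates d r \<omega>"
proof -
  define Op where "Op = {v. d < card (\<omega> \<inter> cell s (site v))}"
  have s: "s > 0" "s * real CARD('n) = 1" by (simp_all add: s_def)
  define R where "R = {(u, v). adj4 u v \<and> u \<in> Op \<and> v \<in> Op}"
  have finR: "finite (R `` {u})" for u
    by (rule finite_subset[OF _ finite_kings[of u]]) (auto simp: R_def adj4_def kings_def mem_Times_iff)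
  have "infinite (R\<^sup>* `` {(0, 0)})" using inf unfolding cluster_def R_def Op_def .
  from koenig_path[of R "(0, 0)", OF finR this]
  obtain f :: "nat \<Rightarrow> int \<times> int" where f: "inj f" "f 0 = (0, 0)" "\<forall>i. (f i, f (Suc i)) \<in> R"
    by (elim exE conjE)
  have "\<exists>V. V \<subseteq> \<omega> \<inter> cell s (site (f i)) \<and> finite V \<and> card V = d + 1" for i
  proof -
    have "d + 1 \<le> card (\<omega> \<inter> cell s (site (f i)))" using spec[OF f(3), of i] by (simp add: R_def Op_def)
    then show ?thesis by (metis obtain_subset_with_card_n)
  qed
  then obtain V where V: "\<And>i. V i \<subseteq> \<omega> \<inter> cell s (site (f i))" "\<And>i. finite (V i)" "\<And>i. card (V i) = d + 1"
    by metis
  have sv: "simplex_verts d \<omega> (V i)" for i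
    unfolding simplex_verts_def
  proof (intro conjI ballI)
    fix x y assume "x \<in> V i" "y \<in> V i"
    then have "x \<in> cell s (site (f i))" "y \<in> cell s (site (f i))" using V(1)[of i] by blast+
    then have "blk s x = blk s y" unfolding cell_def by simp
    then show "dist x y \<le> 1" using blk_close[OF s(1), of x y] s(2) by simp
  qed (use V in auto)
  have Vne: "V i \<noteq> {}" for i using simplex_verts_ne[OF sv] by blast
  have "inj (\<lambda>i. convex hull V i)"
  proof (rule injI)
    fix i j assume "convex hull V i = convex hull V j"
    then have "V i \<inter> V j \<noteq> {}" by (rule common_vertex[OF V(2) Vne])
    then obtain x where "blk s x = site (f i)" "blk s x = site (f j)" using V(1)[of i] V(1)[of j] unfolding cell_def by blast
    then have eq: "site (f i) $ k = site (f j) $ k" for k by simp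
    have "f i = f j" using eq[of i0] eq[of i1] ne by (simp add: site_def prod_eq_iff)
    then show "i = j" using f(1) by (rule injD[rotated])
  qed
  moreover have "setdist (convex hull V i) (convex hull V (Suc i)) \<le> r" for i
  proof -
    obtain x y where xy: "x \<in> V i" "y \<in> V (Suc i)" using Vne by blast
    then have b: "blk s x = site (f i)" "blk s y = site (f (Suc i))"
      using V(1)[of i] V(1)[of "Suc i"] unfolding cell_def by auto
    have adj: "adj4 (f i) (f (Suc i))" using spec[OF f(3), of i] by (simp add: R_def)
    have "\<bar>blk s x $ k - blk s y $ k\<bar> \<le> 1" for k
      unfolding b site_def using adj by (auto simp: adj4_def)
    then have "dist x y \<le> 2 * (s * CARD('n))" by (rule blk_adjacent[OF s(1)])
    then have "dist x y \<le> r" using r s(2) by simp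
    moreover have "setdist (convex hull V i) (convex hull V (Suc i)) \<le> dist x y"
      using xy by (intro setdist_le_dist hull_inc)
    ultimately show ?thesis by simp
  qed
  moreover have "convex hull V i \<in> simplices d \<omega>" for i using sv unfolding simplices_def by blast
  ultimately show ?thesis unfolding star_percolates_def by (intro exI[of _ "\<lambda>i. convex hull V i"]) blast
qed

text \<open>Peierls argument in the layer of cubes given by two coordinates: a finite cluster of
  cubes with more than \<open>d\<close> points forces a walk of \<open>Suc l\<close> closed cubes
  from \<open>(l, 0)\<close> for some \<open>l\<close>, and with positive probability no such walk
  exists.\<close>

lemma star_of_large_intensity:
  fixes r :: real
  assumes card: "2 \<le> CARD('n)" and r: "2 \<le> r"
  shows "\<exists>lam0>0. \<forall>(P :: (real^'n) set measure) lam. lam0 \<le> lam \<longrightarrow> is_PPP P lam \<longrightarrow>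
    0 < measure P {\<omega>\<in>space P. star_percolates d r \<omega>}"
proof -
  obtain i0 i1 :: 'n where ne: "i0 \<noteq> i1"
  proof -
    have "\<not> card (UNIV :: 'n set) \<le> Suc 0" using card by simp
    then have "\<exists>i0 i1 :: 'n. i0 \<noteq> i1" by (simp add: card_le_Suc0_iff_eq)
    then show ?thesis using that by blast
  qed
  define s where "s = 1 / real CARD('n)"
  have s: "s > 0" by (simp add: s_def)
  define site :: "int \<times> int \<Rightarrow> int^'n" where
    "site v = (\<chi> i. if i = i0 then fst v else if i = i1 then snd v else 0)" for v
  have inj: "inj site"
  proof (rule injI)
    fix u v assume "site u = site v"
    then have "site u $ i0 = site v $ i0" "site u $ i1 = site v $ i1" by simp_all
    then show "u = v" using ne by (simp add: site_def prod_eq_iff)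
  qed
  \<comment> \<open>18 is twice the number 9 of sites in \<open>kings\<close>, the centre included.
    The walks of length \<open>l\<close> then cost at most \<open>(1 / 18) * (1 / 2) ^ l\<close>,
    and all lengths together at most \<open>1 / 9\<close>.\<close>
  have "eventually (\<lambda>x::real. (\<Sum>k\<le>d. x ^ k / fact k * exp (- x)) < 1 / 18) at_top"
    by (rule order_tendstoD(2)[OF poisson_head_tendsto_0]) simp
  then obtain X :: real where X: "\<And>x. x \<ge> X \<Longrightarrow> (\<Sum>k\<le>d. x ^ k / fact k * exp (- x)) < 1 / 18"
    unfolding eventually_at_top_linorder by blast
  define c where "c = s ^ CARD('n)"
  have c: "c > 0" using s by (simp add: c_def)
  define lam0 where "lam0 = max 1 (X / c)"
  have "0 < measure P {\<omega>\<in>space P. star_percolates d r \<omega>}"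
    if lam: "lam0 \<le> lam" and P: "is_PPP P lam" for P :: "(real^'n) set measure" and lam
  proof -
    interpret prob_space P using PPP_prob_space[OF P] .
    have cl: "cell s (site v) \<in> sets lborel \<and> bounded (cell s (site v))" for v
      using cell_sets[OF s, of "site v"] bounded_cell[OF s, of "site v"] by blast
    have disj: "disjoint_family (\<lambda>v. cell s (site v))"
      using inj unfolding disjoint_family_on_def cell_def inj_def by fastforce
    have \<rho>: "measure P {\<omega>\<in>space P. card (\<omega> \<inter> cell s (site v)) \<in> {..d}} \<le> 1 / 18" for v
    proof -
      let ?E = "\<lambda>k. {\<omega>\<in>space P. card (\<omega> \<inter> cell s (site v)) \<in> {k}}"
      define x where "x = lam * measure lborel (cell s (site v))"
      have "lam0 * c \<le> x" unfolding x_def c_def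
        using measure_cell_ge[OF s, of "site v"] lam s by (intro mult_mono) (auto simp: lam0_def)
      moreover have "X \<le> lam0 * c" using c unfolding lam0_def by (simp add: max_def field_simps)
      ultimately have xX: "X \<le> x" by simp
      have sE: "?E k \<in> sets P" for k using PPP_sets[OF P] cl by blast
      have "{\<omega>\<in>space P. card (\<omega> \<inter> cell s (site v)) \<in> {..d}} = (\<Union>k\<in>{..d}. ?E k)" by blast
      then have "measure P {\<omega>\<in>space P. card (\<omega> \<inter> cell s (site v)) \<in> {..d}} \<le> (\<Sum>k\<le>d. measure P (?E k))"
        using finite_measure_subadditive_finite[of "{..d}" ?E] sE by auto
      also have "\<dots> = (\<Sum>k\<le>d. x ^ k / fact k * exp (- x))"
        using PPP_count(3)[OF P, of "cell s (site v)"] cl unfolding x_def by (intro sum.cong refl) simp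
      also have "\<dots> \<le> 1 / 18" using X[OF xX] by simp
      finally show ?thesis .
    qed
    define W where "W l a = {\<omega>\<in>space P. \<exists>xs\<in>walks kings l a. distinct xs \<and> (\<forall>v\<in>set xs. card (\<omega> \<inter> cell s (site v)) \<in> {..d})}" for l a
    have W: "W l a \<in> sets P" "measure P (W l a) \<le> real 9 ^ l * (1 / 18) ^ Suc l" for l a
      unfolding W_def by (rule PPP_walk[OF P cl disj finite_kings eq_refl[OF card_kings] _ \<rho>], simp)+
    define Bad where "Bad = (\<Union>l. W l (int l, 0))"
    have sBad: "Bad \<in> sets P" unfolding Bad_def using W(1) by blast
    have gs: "(\<lambda>l. (1 / 18) * (1 / 2) ^ l) sums ((1 / 18) * (1 / (1 - 1 / 2)) :: real)"
      by (intro sums_mult geometric_sums) simp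
    have W': "measure P (W l (int l, 0)) \<le> (1 / 18) * (1 / 2) ^ l" for l
    proof -
      have "real 9 ^ l * (1 / 18) ^ Suc l = (1 / 18) * (9 * (1 / 18)) ^ l"
        unfolding power_mult_distrib by simp
      then show ?thesis using W(2)[of l "(int l, 0)"] by simp
    qed
    have summ: "summable (\<lambda>l. measure P (W l (int l, 0)))"
      by (rule summable_comparison_test'[OF sums_summable[OF gs]]) (use W' in auto)
    have "measure P Bad \<le> (\<Sum>l. measure P (W l (int l, 0)))"
      unfolding Bad_def by (rule finite_measure_subadditive_countably) (use W(1) summ in auto)
    also have "\<dots> \<le> (\<Sum>l. (1 / 18) * (1 / 2) ^ l)"
      by (rule suminf_le[OF W' summ sums_summable[OF gs]])
    also have "\<dots> = 1 / 9" using sums_unique[OF gs] by simp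
    finally have "measure P Bad \<le> 1 / 9" .
    then have "0 < measure P (space P - Bad)" using prob_compl[OF sBad] by simp
    also have "\<dots> \<le> measure P {\<omega>\<in>space P. star_percolates d r \<omega>}"
    proof (intro finite_measure_mono subsetI)
      show "{\<omega>\<in>space P. star_percolates d r \<omega>} \<in> sets P"
        by (rule star_percolates_sets[OF P]) (use r in simp)
      fix \<omega> assume \<omega>: "\<omega> \<in> space P - Bad"
      define Op where "Op = {v. d < card (\<omega> \<inter> cell s (site v))}"
      have "infinite (cluster Op)"
      proof
        assume "finite (cluster Op)"
        then obtain l xs where xs: "xs \<in> walks kings l (int l, 0)" "distinct xs" "set xs \<inter> Op = {}"
          using finite_cluster_closed_walk[of Op] by blast
        have "\<forall>v\<in>set xs. card (\<omega> \<inter> cell s (site v)) \<in> {..d}"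
          using xs(3) unfolding Op_def by (auto simp: not_less[symmetric])
        then have "\<omega> \<in> W l (int l, 0)" using xs(1,2) \<omega> unfolding W_def by blast
        then show False using \<omega> unfolding Bad_def by blast
      qed
      then have "star_percolates d r \<omega>"
        unfolding Op_def s_def site_def by (rule star_percolates_of_cells[OF ne r])
      then show "\<omega> \<in> {\<omega>\<in>space P. star_percolates d r \<omega>}" using \<omega> by blast
    qed
    finally show ?thesis .
  qed
  moreover have "lam0 > 0" by (simp add: lam0_def)
  ultimately show ?thesis by blast
qed

section \<open>Existence of the Poisson process\<close>

text \<open>Leaving out \<open>x = 0\<close> keeps the hypothesis stable when a vanishing constant
  term is removed and the series is divided by \<open>x\<close>.\<close>

lemma powser_zero_coeffs:
  fixes c :: "nat \<Rightarrow> real"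
  assumes "\<And>x. x \<noteq> 0 \<Longrightarrow> \<bar>x\<bar> < 1 \<Longrightarrow> (\<lambda>n. c n * x ^ n) sums 0"
  shows "c n = 0"
  using assms
proof (induction n arbitrary: c)
  case 0
  have "((\<lambda>_. 0) \<longlongrightarrow> c 0) (at (0::real))"
    by (rule powser_limit_0_strong[of 1 c]) (use 0 in auto)
  then show ?case by (simp add: tendsto_const_iff)
next
  case (Suc n)
  have "((\<lambda>_. 0) \<longlongrightarrow> c 0) (at (0::real))"
    by (rule powser_limit_0_strong[of 1 c]) (use Suc.prems in auto)
  then have c0: "c 0 = 0" by (simp add: tendsto_const_iff)
  show ?case
  proof (rule Suc.IH)
    fix x :: real assume x: "x \<noteq> 0" "\<bar>x\<bar> < 1"
    have "(\<lambda>n. c (Suc n) * x ^ Suc n) sums 0"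
      using Suc.prems[OF x] by (subst sums_Suc_iff) (simp add: c0)
    then have "(\<lambda>n. c (Suc n) * x ^ Suc n * (1 / x)) sums (0 * (1 / x))" by (rule sums_mult2)
    then show "(\<lambda>n. c (Suc n) * x ^ n) sums 0" using x(1) by simp
  qed
qed

text \<open>A generating function in one variable with a bounded weight \<open>Z\<close>, which will
  carry the other variables.\<close>

lemma (in prob_space) pgf_sums:
  fixes Z :: "'a \<Rightarrow> real" and Y :: "'a \<Rightarrow> nat"
  assumes Z[measurable]: "Z \<in> borel_measurable M" and Zb: "\<And>x. \<bar>Z x\<bar> \<le> 1"
    and Y[measurable]: "Y \<in> measurable M (count_space UNIV)" and t: "\<bar>t\<bar> < 1"
  shows "(\<lambda>k. expectation (\<lambda>x. Z x * of_bool (Y x = k)) * t ^ k) sums expectation (\<lambda>x. Z x * t ^ Y x)"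
proof -
  define f where "f k x = Z x * of_bool (Y x = k) * t ^ k" for k x
  have meas: "f k \<in> borel_measurable M" for k unfolding f_def by measurable
  have bd: "norm (f k x) \<le> \<bar>t\<bar> ^ k" for k x
  proof -
    have "\<bar>Z x\<bar> * of_bool (Y x = k) \<le> 1" using Zb[of x] by auto
    then have "(\<bar>Z x\<bar> * of_bool (Y x = k)) * \<bar>t\<bar> ^ k \<le> 1 * \<bar>t\<bar> ^ k" by (intro mult_right_mono) auto
    then show ?thesis unfolding f_def by (simp add: abs_mult power_abs)
  qed
  have int: "integrable M (f k)" for k
    by (rule integrable_const_bound[of _ "\<bar>t\<bar> ^ k"]) (use bd meas in auto)
  have geo: "summable (\<lambda>k. \<bar>t\<bar> ^ k)" using t by (simp add: summable_geometric)
  have s1: "summable (\<lambda>k. norm (f k x))" for x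
    by (rule summable_comparison_test'[OF geo]) (use bd in auto)
  have s2: "summable (\<lambda>k. \<integral>x. norm (f k x) \<partial>M)"
  proof (rule summable_comparison_test'[OF geo])
    fix k
    have "(\<integral>x. norm (f k x) \<partial>M) \<le> (\<integral>x. \<bar>t\<bar> ^ k \<partial>M)"
      by (intro integral_mono integrable_norm int bd) simp
    also have "\<dots> = \<bar>t\<bar> ^ k" by (simp add: prob_space)
    finally show "norm (\<integral>x. norm (f k x) \<partial>M) \<le> \<bar>t\<bar> ^ k" by simp
  qed
  have "(\<lambda>k. integral\<^sup>L M (f k)) sums (\<integral>x. (\<Sum>k. f k x) \<partial>M)"
    by (rule sums_integral) (use int s1 s2 in auto)
  moreover have "(\<Sum>k. f k x) = Z x * t ^ Y x" for x
  proof -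
    have "f k x = (if k = Y x then Z x * t ^ Y x else 0)" for k unfolding f_def by auto
    then show ?thesis using sums_unique[OF sums_single[of "Y x" "\<lambda>_. Z x * t ^ Y x"]] by simp
  qed
  ultimately show ?thesis unfolding f_def by simp
qed

text \<open>The factors \<open>t j ^ Y j\<close> are exchanged for the indicators of
  \<open>Y j = k j\<close> one index at a time; \<open>S\<close> holds the indices already
  exchanged. At each exchange all other factors form the weight, and both sides are power series in
  the remaining variable with equal coefficients.\<close>

lemma (in prob_space) joint_poisson_of_pgf:
  fixes Y :: "'j \<Rightarrow> 'a \<Rightarrow> nat"
  assumes J: "finite J" and Y[measurable]: "\<And>j. j \<in> J \<Longrightarrow> Y j \<in> measurable M (count_space UNIV)"
    and pgf: "\<And>t. (\<And>j. \<bar>t j\<bar> < 1) \<Longrightarrow>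
      expectation (\<lambda>x. \<Prod>j\<in>J. t j ^ Y j x) = (\<Prod>j\<in>J. exp (\<mu> j * (t j - 1)))"
  shows "prob {x \<in> space M. \<forall>j\<in>J. Y j x = k j} = (\<Prod>j\<in>J. \<mu> j ^ k j / fact (k j) * exp (- \<mu> j))"
proof -
  have "expectation (\<lambda>x. (\<Prod>j\<in>S. of_bool (Y j x = k j)) * (\<Prod>j\<in>J - S. t j ^ Y j x))
      = (\<Prod>j\<in>S. \<mu> j ^ k j / fact (k j) * exp (- \<mu> j)) * (\<Prod>j\<in>J - S. exp (\<mu> j * (t j - 1)))"
    if "S \<subseteq> J" "\<And>j. \<bar>t j\<bar> < 1" for S t
    using finite_subset[OF that(1) J] that
  proof (induction S arbitrary: t rule: finite_induct)
    case empty
    then show ?case using pgf by simp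
  next
    case (insert i S)
    have iJ: "i \<in> J - S" "J - S = insert i (J - insert i S)" "i \<notin> J - insert i S" "finite (J - insert i S)"
      using insert.prems(1) insert.hyps J by auto
    define Z where "Z x = (\<Prod>j\<in>S. of_bool (Y j x = k j)) * (\<Prod>j\<in>J - insert i S. t j ^ Y j x)" for x
    have SJ: "S \<subseteq> J" using insert.prems(1) by simp
    have Zm: "Z \<in> borel_measurable M"
      unfolding Z_def
    proof (intro borel_measurable_times borel_measurable_prod)
      fix j assume "j \<in> S"
      then have [measurable]: "Y j \<in> measurable M (count_space UNIV)" using SJ Y by blast
      show "(\<lambda>x. of_bool (Y j x = k j) :: real) \<in> borel_measurable M" by measurable
    next
      fix j assume "j \<in> J - insert i S"
      then have [measurable]: "Y j \<in> measurable M (count_space UNIV)" using Y by blast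
      show "(\<lambda>x. t j ^ Y j x) \<in> borel_measurable M" by measurable
    qed
    have Zb: "\<bar>Z x\<bar> \<le> 1" for x
    proof -
      have a: "\<bar>\<Prod>j\<in>S. of_bool (Y j x = k j) :: real\<bar> \<le> 1"
        unfolding abs_prod by (rule prod_le_1) auto
      have b: "\<bar>\<Prod>j\<in>J - insert i S. t j ^ Y j x\<bar> \<le> 1"
        unfolding abs_prod
      proof (rule prod_le_1)
        fix j assume "j \<in> J - insert i S"
        have "\<bar>t j\<bar> \<le> 1" using insert.prems(2)[of j] by simp
        then show "0 \<le> \<bar>t j ^ Y j x\<bar> \<and> \<bar>t j ^ Y j x\<bar> \<le> 1" by (simp add: power_abs power_le_one)
      qed
      show ?thesis unfolding Z_def abs_mult using mult_mono[OF a b] by simp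
    qed
    have Yi: "Y i \<in> measurable M (count_space UNIV)" using iJ(1) Y by blast
    define C where "C = (\<Prod>j\<in>S. \<mu> j ^ k j / fact (k j) * exp (- \<mu> j)) * (\<Prod>j\<in>J - insert i S. exp (\<mu> j * (t j - 1)))"
    have "(\<lambda>n. (expectation (\<lambda>x. Z x * of_bool (Y i x = n)) - C * (\<mu> i ^ n / fact n * exp (- \<mu> i))) * s ^ n) sums 0"
      if s: "\<bar>s\<bar> < 1" for s
    proof -
      have 1: "(\<lambda>n. expectation (\<lambda>x. Z x * of_bool (Y i x = n)) * s ^ n) sums expectation (\<lambda>x. Z x * s ^ Y i x)"
        by (rule pgf_sums[OF Zm Zb Yi s])
      have "expectation (\<lambda>x. (\<Prod>j\<in>S. of_bool (Y j x = k j)) * (\<Prod>j\<in>J - S. (t(i := s)) j ^ Y j x))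
        = (\<Prod>j\<in>S. \<mu> j ^ k j / fact (k j) * exp (- \<mu> j)) * (\<Prod>j\<in>J - S. exp (\<mu> j * ((t(i := s)) j - 1)))"
        by (rule insert.IH[OF SJ]) (use insert.prems(2) s in simp)
      moreover have "(\<Prod>j\<in>J - S. (t(i := s)) j ^ Y j x) = s ^ Y i x * (\<Prod>j\<in>J - insert i S. t j ^ Y j x)" for x
        unfolding iJ(2) by (subst prod.insert[OF iJ(4,3)]) (use iJ(3) in \<open>auto intro!: prod.cong\<close>)
      moreover have "(\<Prod>j\<in>J - S. exp (\<mu> j * ((t(i := s)) j - 1)))
          = exp (\<mu> i * (s - 1)) * (\<Prod>j\<in>J - insert i S. exp (\<mu> j * (t j - 1)))"
        unfolding iJ(2) by (subst prod.insert[OF iJ(4,3)]) (use iJ(3) in \<open>auto intro!: prod.cong\<close>)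
      ultimately have 2: "expectation (\<lambda>x. Z x * s ^ Y i x) = C * exp (\<mu> i * (s - 1))"
        unfolding Z_def C_def by (simp add: mult_ac)
      have "(\<lambda>n. C * exp (- \<mu> i) * ((\<mu> i * s) ^ n /\<^sub>R fact n)) sums (C * exp (- \<mu> i) * exp (\<mu> i * s))"
        by (intro sums_mult exp_converges)
      also have "C * exp (- \<mu> i) * exp (\<mu> i * s) = C * exp (\<mu> i * (s - 1))"
        by (simp add: exp_add[symmetric] mult.assoc algebra_simps)
      also have "(\<lambda>n. C * exp (- \<mu> i) * ((\<mu> i * s) ^ n /\<^sub>R fact n)) = (\<lambda>n. C * (\<mu> i ^ n / fact n * exp (- \<mu> i)) * s ^ n)"
        by (simp add: fun_eq_iff power_mult_distrib divide_inverse mult_ac)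
      finally show ?thesis using sums_diff[OF 1[unfolded 2]] by (fastforce simp: left_diff_distrib)
    qed
    then have "expectation (\<lambda>x. Z x * of_bool (Y i x = k i)) - C * (\<mu> i ^ k i / fact (k i) * exp (- \<mu> i)) = 0"
      by (intro powser_zero_coeffs[of "\<lambda>n. expectation (\<lambda>x. Z x * of_bool (Y i x = n)) - C * (\<mu> i ^ n / fact n * exp (- \<mu> i))"]) auto
    then show ?case unfolding Z_def C_def using insert.hyps by (simp add: mult_ac)
  qed
  from this[of J "\<lambda>_. 0"] have "expectation (\<lambda>x. \<Prod>j\<in>J. of_bool (Y j x = k j)) = (\<Prod>j\<in>J. \<mu> j ^ k j / fact (k j) * exp (- \<mu> j))"
    by simp
  moreover have "(\<Prod>j\<in>J. of_bool (Y j x = k j) :: real) = of_bool (\<forall>j\<in>J. Y j x = k j)" for x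
    using J by (induction J rule: finite_induct) auto
  moreover have "expectation (\<lambda>x. of_bool (\<forall>j\<in>J. Y j x = k j)) = prob {x \<in> space M. \<forall>j\<in>J. Y j x = k j}"
  proof -
    have "expectation (\<lambda>x. of_bool (\<forall>j\<in>J. Y j x = k j)) = expectation (indicator {x \<in> space M. \<forall>j\<in>J. Y j x = k j})"
      by (rule Bochner_Integration.integral_cong) (auto simp: indicator_def)
    also have "\<dots> = prob ({x \<in> space M. \<forall>j\<in>J. Y j x = k j} \<inter> space M)" by (rule Bochner_Integration.integral_indicator)
    also have "{x \<in> space M. \<forall>j\<in>J. Y j x = k j} \<inter> space M = {x \<in> space M. \<forall>j\<in>J. Y j x = k j}" by blast
    finally show ?thesis .
  qed
  ultimately show ?thesis by simp
qed

lemma indep_vars_of_joint_pmf: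
  fixes Y :: "'j \<Rightarrow> 'a \<Rightarrow> nat"
  assumes P: "prob_space P" and J: "finite J" and Y: "\<And>j. j \<in> J \<Longrightarrow> Y j \<in> measurable P (count_space UNIV)"
    and joint: "\<And>I k. I \<subseteq> J \<Longrightarrow> measure P {x \<in> space P. \<forall>j\<in>I. Y j x = k j} = (\<Prod>j\<in>I. measure P {x \<in> space P. Y j x = k j})"
  shows "prob_space.indep_vars P (\<lambda>_. count_space UNIV) Y J"
proof -
  interpret prob_space P by fact
  show ?thesis
  proof (cases "J = {}")
    case True
    then show ?thesis by (simp add: indep_vars_def indep_sets_def)
  next
    case False
    \<comment> \<open>The empty set makes the singletons stable under intersection.
      \<open>UNIV\<close> stands for coordinates without condition, which are later dropped by
      passing to \<open>I\<close>; hence the joint law is assumed for all subsets of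
      \<open>J\<close>.\<close>
    let ?E = "insert {} (insert UNIV ((\<lambda>k::nat. {k}) ` UNIV))"
    have "sets (count_space UNIV :: nat measure) = sigma_sets UNIV ?E"
    proof (intro equalityI subsetI)
      fix X :: "nat set"
      have "X \<in> Pow UNIV" by simp
      then have "X \<in> sigma_sets UNIV ((\<lambda>k::nat. {k}) ` UNIV)"
        using sigma_sets_singletons[of "UNIV :: nat set"] by (simp only: countableI_type simp_thms)
      then show "X \<in> sigma_sets UNIV ?E" by (rule subsetD[OF sigma_sets_mono', rotated]) auto
    qed simp
    moreover have "Int_stable ?E" unfolding Int_stable_def by auto
    ultimately have "indep_vars (\<lambda>_. count_space UNIV) Y J \<longleftrightarrow>
      (\<forall>A\<in>(\<Pi> j\<in>J. ?E). prob (\<Inter>j\<in>J. Y j -` A j \<inter> space P) = (\<Prod>j\<in>J. prob (Y j -` A j \<inter> space P)))"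
      by (intro indep_vars_finite[OF False J]) (use Y in auto)
    moreover have "prob (\<Inter>j\<in>J. Y j -` A j \<inter> space P) = (\<Prod>j\<in>J. prob (Y j -` A j \<inter> space P))"
      if A: "A \<in> (\<Pi> j\<in>J. ?E)" for A
    proof (cases "\<exists>j\<in>J. A j = {}")
      case True
      then obtain j where j: "j \<in> J" "A j = {}" by blast
      then have "(\<Inter>j\<in>J. Y j -` A j \<inter> space P) = {}" by blast
      moreover have "(\<Prod>j\<in>J. prob (Y j -` A j \<inter> space P)) = 0" using j J by (intro prod_zero bexI[of _ j]) auto
      ultimately show ?thesis by simp
    next
      case nonempty: False
      define I where "I = {j \<in> J. A j \<noteq> UNIV}"
      have IJ: "I \<subseteq> J" unfolding I_def by blast
      define k where "k j = the_elem (A j)" for j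
      have Ak: "A j = {k j}" if j: "j \<in> I" for j
      proof -
        have "A j \<in> ?E" using A j IJ by (auto simp: Pi_iff)
        then obtain n where "A j = {n}" using nonempty j unfolding I_def by auto
        then show ?thesis by (simp add: k_def)
      qed
      have "(\<Inter>j\<in>J. Y j -` A j \<inter> space P) = {x \<in> space P. \<forall>j\<in>J. Y j x \<in> A j}" using False by blast
      also have "\<dots> = {x \<in> space P. \<forall>j\<in>I. Y j x = k j}"
      proof (intro Collect_cong conj_cong refl)
        fix x
        have "(\<forall>j\<in>J. Y j x \<in> A j) \<longleftrightarrow> (\<forall>j\<in>I. Y j x \<in> A j)" unfolding I_def by blast
        also have "\<dots> \<longleftrightarrow> (\<forall>j\<in>I. Y j x = k j)" using Ak by (intro ball_cong) auto
        finally show "(\<forall>j\<in>J. Y j x \<in> A j) \<longleftrightarrow> (\<forall>j\<in>I. Y j x = k j)" .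
      qed
      finally have "prob (\<Inter>j\<in>J. Y j -` A j \<inter> space P) = (\<Prod>j\<in>I. prob {x \<in> space P. Y j x = k j})"
        using joint[OF IJ] by simp
      also have "\<dots> = (\<Prod>j\<in>J. prob (Y j -` A j \<inter> space P))"
      proof (rule prod.mono_neutral_cong_left[OF J IJ])
        show "\<forall>j\<in>J - I. prob (Y j -` A j \<inter> space P) = 1" unfolding I_def by (auto simp: prob_space)
        show "prob {x \<in> space P. Y j x = k j} = prob (Y j -` A j \<inter> space P)" if "j \<in> I" for j
          using Ak[OF that] by (intro arg_cong[of _ _ prob]) auto
      qed
      finally show ?thesis .
    qed
    ultimately show ?thesis by blast
  qed
qed

lemma indep_vars_coordinates:
  fixes M :: "'i \<Rightarrow> 'a measure"
  assumes "\<And>i. prob_space (M i)"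
  shows "prob_space.indep_vars (PiM UNIV M) M (\<lambda>i x. x i) UNIV"
proof -
  interpret prob_space "PiM UNIV M" by (rule prob_space_PiM) (rule assms)
  have "distr (PiM UNIV M) (\<Pi>\<^sub>M i\<in>UNIV. M i) (\<lambda>x. \<lambda>i\<in>UNIV. x i) = PiM UNIV M"
    by (simp add: restrict_UNIV distr_id)
  also have "\<dots> = (\<Pi>\<^sub>M i\<in>UNIV. distr (PiM UNIV M) (M i) (\<lambda>x. x i))"
    by (rule PiM_cong) (auto simp: distr_PiM_component assms)
  finally show ?thesis by (subst indep_vars_iff_distr_eq_PiM') auto
qed

lemma expectation_prod_coordinates:
  fixes M :: "'i \<Rightarrow> 'a measure" and f :: "'i \<Rightarrow> 'a \<Rightarrow> real"
  assumes M: "\<And>i. prob_space (M i)" and J: "finite J"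
    and f: "\<And>i. f i \<in> borel_measurable (M i)" and fb: "\<And>i x. \<bar>f i x\<bar> \<le> 1"
  shows "(\<integral>x. (\<Prod>i\<in>J. f i (x i)) \<partial>PiM UNIV M) = (\<Prod>i\<in>J. \<integral>y. f i y \<partial>M i)"
proof -
  interpret prob_space "PiM UNIV M" by (rule prob_space_PiM) (rule M)
  have "indep_vars M (\<lambda>i x. x i) J" by (rule indep_vars_subset[OF indep_vars_coordinates[OF M]]) simp
  then have ind: "indep_vars (\<lambda>_. borel) (\<lambda>i x. f i (x i)) J" by (rule indep_vars_compose2) (rule f)
  have m: "(\<lambda>x. f i (x i)) \<in> borel_measurable (PiM UNIV M)" for i
    using f by (intro measurable_compose[OF measurable_component_singleton]) auto
  have "(\<integral>x. (\<Prod>i\<in>J. f i (x i)) \<partial>PiM UNIV M) = (\<Prod>i\<in>J. \<integral>x. f i (x i) \<partial>PiM UNIV M)"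
    by (rule indep_vars_lebesgue_integral[OF J ind])
      (use fb m in \<open>auto intro!: integrable_const_bound[of _ 1]\<close>)
  also have "\<dots> = (\<Prod>i\<in>J. \<integral>y. f i y \<partial>M i)"
  proof (rule prod.cong[OF refl])
    fix i
    have "(\<integral>y. f i y \<partial>distr (PiM UNIV M) (M i) (\<lambda>x. x i)) = (\<integral>x. f i (x i) \<partial>PiM UNIV M)"
      by (rule integral_distr) (use f in auto)
    then show "(\<integral>x. f i (x i) \<partial>PiM UNIV M) = (\<integral>y. f i y \<partial>M i)" by (simp add: distr_PiM_component M)
  qed
  finally show ?thesis .
qed

lemma poisson_pgf:
  assumes \<mu>: "0 < \<mu>" and a: "\<bar>a\<bar> \<le> 1"
  shows "(\<integral>n. a ^ n \<partial>measure_pmf (poisson_pmf \<mu>)) = exp (\<mu> * (a - 1))"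
proof -
  have int: "integrable (measure_pmf (poisson_pmf \<mu>)) (\<lambda>n. a ^ n)"
    by (rule measure_pmf.integrable_const_bound[of _ 1]) (use a in \<open>auto simp: power_abs power_le_one\<close>)
  have "integrable (count_space UNIV) (\<lambda>n. pmf (poisson_pmf \<mu>) n *\<^sub>R a ^ n)"
    using int unfolding measure_pmf_eq_density by (subst (asm) integrable_density) auto
  then have "(\<integral>n. a ^ n \<partial>measure_pmf (poisson_pmf \<mu>)) = (\<Sum>n. pmf (poisson_pmf \<mu>) n *\<^sub>R a ^ n)"
    unfolding measure_pmf_eq_density by (subst integral_density) (auto simp: integral_count_space_nat)
  also have "(\<lambda>n. pmf (poisson_pmf \<mu>) n *\<^sub>R a ^ n) = (\<lambda>n. exp (- \<mu>) * ((\<mu> * a) ^ n /\<^sub>R fact n))"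
    using \<mu> by (simp add: fun_eq_iff power_mult_distrib divide_inverse mult_ac)
  also have "(\<Sum>n. exp (- \<mu>) * ((\<mu> * a) ^ n /\<^sub>R fact n)) = exp (- \<mu>) * exp (\<mu> * a)"
    by (intro sums_unique[symmetric] sums_mult exp_converges)
  also have "\<dots> = exp (\<mu> * (a - 1))" by (simp add: exp_add[symmetric] algebra_simps)
  finally show ?thesis .
qed

lemma measurable_random_prod:
  fixes \<phi> :: "'b \<Rightarrow> real"
  assumes [measurable]: "\<phi> \<in> borel_measurable U"
  shows "(\<lambda>x. \<Prod>i<fst x. \<phi> (snd x i)) \<in> borel_measurable (measure_pmf p \<Otimes>\<^sub>M PiM (UNIV :: nat set) (\<lambda>_. U))"
proof (rule measurable_compose_countable[where g = fst])
  show "fst \<in> measurable (measure_pmf p \<Otimes>\<^sub>M PiM (UNIV :: nat set) (\<lambda>_. U)) (count_space UNIV)"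
    using measurable_fst[of "measure_pmf p"] by (simp cong: measurable_cong_sets)
qed measurable

text \<open>Compound Poisson formula: given the number of points, independence yields a power of the
  mean of \<open>\<phi>\<close>, and the Poisson generating function is evaluated there.\<close>

lemma poisson_many_pgf:
  fixes \<phi> :: "'b \<Rightarrow> real"
  assumes U: "prob_space U" and \<mu>: "0 < \<mu>" and \<phi>: "\<phi> \<in> borel_measurable U" and b: "\<And>x. \<bar>\<phi> x\<bar> \<le> 1"
  shows "(\<integral>x. (\<Prod>i<fst x. \<phi> (snd x i)) \<partial>(measure_pmf (poisson_pmf \<mu>) \<Otimes>\<^sub>M PiM (UNIV :: nat set) (\<lambda>_. U)))
    = exp (\<mu> * ((\<integral>x. \<phi> x \<partial>U) - 1))"
proof -
  let ?N = "measure_pmf (poisson_pmf \<mu>)" and ?Q = "PiM (UNIV :: nat set) (\<lambda>_. U)"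
  interpret U: prob_space U by fact
  interpret Q: prob_space ?Q by (rule prob_space_PiM) (rule U)
  interpret N: prob_space ?N by (rule prob_space_measure_pmf)
  interpret NQ: pair_prob_space ?N ?Q ..
  have bound: "\<bar>\<Prod>i<n. \<phi> (u i)\<bar> \<le> 1" for n :: nat and u
    unfolding abs_prod using b by (intro prod_le_1) auto
  have "(\<integral>x. (\<Prod>i<fst x. \<phi> (snd x i)) \<partial>(?N \<Otimes>\<^sub>M ?Q)) = (\<integral>n. (\<integral>u. (\<Prod>i<n. \<phi> (u i)) \<partial>?Q) \<partial>?N)"
    using NQ.integral_fst'[of "\<lambda>x. \<Prod>i<fst x. \<phi> (snd x i)"]
      NQ.integrable_const_bound[of "\<lambda>x. \<Prod>i<fst x. \<phi> (snd x i)" 1] measurable_random_prod[OF \<phi>] bound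
    by simp
  also have "(\<lambda>n. \<integral>u. (\<Prod>i<n. \<phi> (u i)) \<partial>?Q) = (\<lambda>n. (\<integral>x. \<phi> x \<partial>U) ^ n)"
    by (rule ext) (subst expectation_prod_coordinates, use U \<phi> b in auto)
  also have "(\<integral>n. (\<integral>x. \<phi> x \<partial>U) ^ n \<partial>?N) = exp (\<mu> * ((\<integral>x. \<phi> x \<partial>U) - 1))"
  proof (rule poisson_pgf[OF \<mu>])
    have "\<bar>\<integral>x. \<phi> x \<partial>U\<bar> \<le> (\<integral>x. \<bar>\<phi> x\<bar> \<partial>U)" by (rule integral_abs_bound)
    also have "\<dots> \<le> (\<integral>x. 1 \<partial>U)"
      by (rule integral_mono) (use \<phi> b in \<open>auto intro!: U.integrable_const_bound[of _ 1]\<close>)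
    finally show "\<bar>\<integral>x. \<phi> x \<partial>U\<bar> \<le> 1" by (simp add: U.prob_space)
  qed
  finally show ?thesis .
qed

lemma measurable_nat_add:
  fixes f g :: "'a \<Rightarrow> nat"
  assumes "f \<in> measurable M (count_space UNIV)" "g \<in> measurable M (count_space UNIV)"
  shows "(\<lambda>x. f x + g x) \<in> measurable M (count_space UNIV)"
  by (rule measurable_compose_countable[where g = f and f = "\<lambda>a x. a + g x"])
    (use assms in \<open>auto intro!: measurable_compose[OF assms(2)]\<close>)

lemma measurable_nat_sum:
  fixes f :: "'i \<Rightarrow> 'a \<Rightarrow> nat"
  assumes "finite S" "\<And>i. i \<in> S \<Longrightarrow> f i \<in> measurable M (count_space UNIV)"
  shows "(\<lambda>x. \<Sum>i\<in>S. f i x) \<in> measurable M (count_space UNIV)"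
  using assms
proof (induction S rule: finite_induct)
  case (insert i S)
  have "(\<lambda>x. f i x + (\<Sum>i\<in>S. f i x)) \<in> measurable M (count_space UNIV)"
    by (rule measurable_nat_add) (use insert in auto)
  then show ?case using insert.hyps by simp
qed simp

section \<open>Marked cubes and the configuration they generate\<close>

definition cube_law :: "real \<Rightarrow> int^'n \<Rightarrow> (nat \<times> (nat \<Rightarrow> real^'n)) measure" where
  "cube_law lam w = measure_pmf (poisson_pmf (lam * measure lborel (cell 1 w :: (real^'n) set)))
     \<Otimes>\<^sub>M PiM UNIV (\<lambda>_. uniform_measure lborel (cell 1 w))"

definition marks :: "real \<Rightarrow> ((int^'n) \<Rightarrow> nat \<times> (nat \<Rightarrow> real^'n)) measure" where
  "marks lam = PiM UNIV (cube_law lam)"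

definition simple_marks :: "((int^'n) \<Rightarrow> nat \<times> (nat \<Rightarrow> real^'n)) \<Rightarrow> bool" where
  "simple_marks m \<longleftrightarrow> (\<forall>w i. snd (m w) i \<in> cell 1 w) \<and> (\<forall>w i j. i < j \<longrightarrow> snd (m w) i \<noteq> snd (m w) j)"

text \<open>Each cube carries an infinite sequence of points, of which a Poisson number is used. The
  empty set as default on the null event of non-simple marks makes local finiteness hold at every
  sample point.\<close>

definition configuration :: "((int^'n) \<Rightarrow> nat \<times> (nat \<Rightarrow> real^'n)) \<Rightarrow> (real^'n) set" where
  "configuration m = (if simple_marks m then (\<Union>w. snd (m w) ` {..<fst (m w)}) else {})"

lemma cell_1_measure:
  fixes w :: "int^'n"
  shows "0 < measure lborel (cell 1 w :: (real^'n) set)"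
    and "emeasure lborel (cell 1 w :: (real^'n) set) \<noteq> 0"
    and "emeasure lborel (cell 1 w :: (real^'n) set) \<noteq> \<infinity>"
proof -
  have fin: "emeasure lborel (cell 1 w :: (real^'n) set) < \<infinity>"
    by (rule emeasure_bounded_finite[OF bounded_cell]) simp
  show pos: "0 < measure lborel (cell 1 w :: (real^'n) set)"
    using measure_cell_ge[of 1 w] by simp
  show "emeasure lborel (cell 1 w :: (real^'n) set) \<noteq> \<infinity>" using fin by simp
  show "emeasure lborel (cell 1 w :: (real^'n) set) \<noteq> 0" using pos unfolding measure_def by auto
qed

lemma prob_uniform_cell: "prob_space (uniform_measure lborel (cell 1 w))"
  by (rule prob_space_uniform_measure) (rule cell_1_measure)+

lemma prob_cube_law: "prob_space (cube_law lam w)"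
proof -
  interpret A: prob_space "measure_pmf (poisson_pmf (lam * measure lborel (cell 1 w :: (real^'a) set)))"
    by (rule prob_space_measure_pmf)
  interpret B: prob_space "PiM (UNIV :: nat set) (\<lambda>_. uniform_measure lborel (cell 1 w))"
    by (rule prob_space_PiM) (rule prob_uniform_cell)
  interpret pair_prob_space "measure_pmf (poisson_pmf (lam * measure lborel (cell 1 w :: (real^'a) set)))"
    "PiM (UNIV :: nat set) (\<lambda>_. uniform_measure lborel (cell 1 w))" ..
  show ?thesis unfolding cube_law_def by (rule prob_space_axioms)
qed

lemma prob_marks: "prob_space (marks lam)"
  unfolding marks_def by (rule prob_space_PiM) (rule prob_cube_law)

lemma measurable_mark_num: "(\<lambda>m. fst (m w)) \<in> measurable (marks lam) (count_space UNIV)"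
proof -
  have "fst \<in> measurable (cube_law lam w) (count_space UNIV)"
    unfolding cube_law_def using measurable_fst by (simp cong: measurable_cong_sets)
  then show ?thesis unfolding marks_def by (rule measurable_compose[OF measurable_component_singleton, rotated]) simp
qed

lemma measurable_mark_point: "(\<lambda>m. snd (m w) i) \<in> measurable (marks lam) borel"
proof -
  have "(\<lambda>x. snd x i) \<in> measurable (cube_law lam w) (uniform_measure lborel (cell 1 w))"
    unfolding cube_law_def
    by (rule measurable_compose[OF measurable_snd measurable_component_singleton]) simp
  then have "(\<lambda>x. snd x i) \<in> measurable (cube_law lam w) borel"
    by (simp cong: measurable_cong_sets)
  then show ?thesis unfolding marks_def by (rule measurable_compose[OF measurable_component_singleton, rotated]) simp
qed

lemma simple_marks_sets:
  "{m \<in> space (marks lam). simple_marks (m :: (int^'n) \<Rightarrow> nat \<times> (nat \<Rightarrow> real^'n))} \<in> sets (marks lam)"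
proof -
  let ?M = "marks lam :: ((int^'n) \<Rightarrow> nat \<times> (nat \<Rightarrow> real^'n)) measure"
  have 1: "{m \<in> space ?M. snd (m w) i \<in> cell 1 w} \<in> sets ?M" for w i
  proof -
    have "(\<lambda>m. snd (m w) i) -` cell 1 w \<inter> space ?M \<in> sets ?M"
      by (rule measurable_sets[OF measurable_mark_point]) (use cell_sets[of 1 w] in simp)
    also have "(\<lambda>m. snd (m w) i) -` cell 1 w \<inter> space ?M = {m \<in> space ?M. snd (m w) i \<in> cell 1 w}" by blast
    finally show ?thesis .
  qed
  have 2: "{m \<in> space ?M. i < j \<longrightarrow> snd (m w) i \<noteq> snd (m w) j} \<in> sets ?M" for w i j
  proof -
    have d: "(\<lambda>m. dist (snd (m w) i) (snd (m w) j)) \<in> borel_measurable ?M"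
      by (rule borel_measurable_dist[OF measurable_mark_point measurable_mark_point])
    have "(\<lambda>m. dist (snd (m w) i) (snd (m w) j)) -` (if i < j then - {0} else UNIV) \<inter> space ?M \<in> sets ?M"
      by (rule measurable_sets[OF d]) simp
    also have "(\<lambda>m. dist (snd (m w) i) (snd (m w) j)) -` (if i < j then - {0} else UNIV) \<inter> space ?M
      = {m \<in> space ?M. i < j \<longrightarrow> snd (m w) i \<noteq> snd (m w) j}"
      by (cases "i < j") (simp_all add: vimage_def Int_def conj_commute)
    finally show ?thesis .
  qed
  have all_in: "{m \<in> space ?M. \<forall>w i. snd (m w) i \<in> cell 1 w} \<in> sets ?M"
    by (rule sets.sets_Collect_countable_All, rule sets.sets_Collect_countable_All, rule 1)
  have all_ne: "{m \<in> space ?M. \<forall>w i j. i < j \<longrightarrow> snd (m w) i \<noteq> snd (m w) j} \<in> sets ?M"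
    by (rule sets.sets_Collect_countable_All, rule sets.sets_Collect_countable_All, rule sets.sets_Collect_countable_All, rule 2)
  show ?thesis unfolding simple_marks_def by (rule sets.sets_Collect_conj[OF all_ne all_in])
qed

text \<open>Two coordinates have the joint law \<open>U \<Otimes>\<^sub>M U\<close>, and integrating
  over sections shows that the diagonal is null because \<open>U\<close> has no atoms.\<close>

lemma AE_distinct_coordinates:
  fixes U :: "(real^'n) measure" and i j :: nat
  assumes U: "prob_space U" and sU: "sets U = sets borel" and null: "\<And>x. emeasure U {x} = 0" and ij: "i \<noteq> j"
  shows "AE u in PiM (UNIV :: nat set) (\<lambda>_. U). u i \<noteq> u j"
proof -
  let ?Q = "PiM (UNIV :: nat set) (\<lambda>_. U)"
  interpret U: prob_space U by fact
  interpret Q: prob_space ?Q by (rule prob_space_PiM) (rule U)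
  interpret UU: pair_prob_space U U ..
  have comp: "(\<lambda>u. u k) \<in> measurable ?Q U" for k by (rule measurable_component_singleton) simp
  have pm: "(\<lambda>u. (u i, u j)) \<in> measurable ?Q (U \<Otimes>\<^sub>M U)" by (rule measurable_Pair[OF comp comp])
  have eq: "U \<Otimes>\<^sub>M U = distr ?Q (U \<Otimes>\<^sub>M U) (\<lambda>u. (u i, u j))"
  proof (rule pair_measure_eqI)
    fix A B assume A: "A \<in> sets U" and B: "B \<in> sets U"
    define f :: "nat \<Rightarrow> real^'n \<Rightarrow> real" where "f k = (if k = i then indicator A else indicator B)" for k
    let ?E = "(\<lambda>u. (u i, u j)) -` (A \<times> B) \<inter> space ?Q"
    have sE: "?E \<in> sets ?Q" by (rule measurable_sets[OF pm]) (use A B in auto)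
    have "(\<integral>u. (\<Prod>k\<in>{i, j}. f k (u k)) \<partial>?Q) = (\<Prod>k\<in>{i, j}. \<integral>y. f k y \<partial>U)"
      by (rule expectation_prod_coordinates) (use U A B in \<open>auto simp: f_def indicator_def\<close>)
    also have "(\<Prod>k\<in>{i, j}. \<integral>y. f k y \<partial>U) = measure U A * measure U B"
      using ij sets.sets_into_space[OF A] sets.sets_into_space[OF B] by (simp add: f_def Int_absorb2)
    also have "(\<integral>u. (\<Prod>k\<in>{i, j}. f k (u k)) \<partial>?Q) = (\<integral>u. indicator ?E u \<partial>?Q)"
      by (rule Bochner_Integration.integral_cong) (use ij in \<open>auto simp: f_def indicator_def\<close>)
    finally have "measure ?Q ?E = measure U A * measure U B" by simp
    then show "emeasure U A * emeasure U B = emeasure (distr ?Q (U \<Otimes>\<^sub>M U) (\<lambda>u. (u i, u j))) (A \<times> B)"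
      using A B by (subst emeasure_distr[OF pm]) (simp_all add: U.emeasure_eq_measure Q.emeasure_eq_measure ennreal_mult[symmetric])
  qed (auto intro: U.sigma_finite_measure_axioms)
  have ae: "AE p in U \<Otimes>\<^sub>M U. fst p \<noteq> snd p"
  proof -
    have "fst \<in> borel_measurable (U \<Otimes>\<^sub>M U)" "snd \<in> borel_measurable (U \<Otimes>\<^sub>M U)"
      using measurable_fst[of U U] measurable_snd[of U U] sU by (simp_all cong: measurable_cong_sets)
    then have [measurable]: "(\<lambda>p. dist (fst p) (snd p)) \<in> borel_measurable (U \<Otimes>\<^sub>M U)"
      by (rule borel_measurable_dist)
    have "{p \<in> space (U \<Otimes>\<^sub>M U). dist (fst p) (snd p) = 0} \<in> sets (U \<Otimes>\<^sub>M U)" by measurable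
    then have D: "{p \<in> space (U \<Otimes>\<^sub>M U). fst p = snd p} \<in> sets (U \<Otimes>\<^sub>M U)" by simp
    have "emeasure (U \<Otimes>\<^sub>M U) {p \<in> space (U \<Otimes>\<^sub>M U). fst p = snd p}
        = (\<integral>\<^sup>+x. emeasure U (Pair x -` {p \<in> space (U \<Otimes>\<^sub>M U). fst p = snd p}) \<partial>U)"
      by (rule U.emeasure_pair_measure_alt[OF D])
    also have "\<dots> = (\<integral>\<^sup>+x. 0 \<partial>U)"
    proof (rule nn_integral_cong)
      fix x assume x: "x \<in> space U"
      have "Pair x -` {p \<in> space (U \<Otimes>\<^sub>M U). fst p = snd p} = {x}"
        using x by (auto simp: space_pair_measure)
      then show "emeasure U (Pair x -` {p \<in> space (U \<Otimes>\<^sub>M U). fst p = snd p}) = 0" using null by simp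
    qed
    finally have "emeasure (U \<Otimes>\<^sub>M U) {p \<in> space (U \<Otimes>\<^sub>M U). fst p = snd p} = 0" by simp
    then show ?thesis using D by (intro AE_I[of _ _ "{p \<in> space (U \<Otimes>\<^sub>M U). fst p = snd p}"]) auto
  qed
  have "AE p in distr ?Q (U \<Otimes>\<^sub>M U) (\<lambda>u. (u i, u j)). fst p \<noteq> snd p"
    by (subst eq[symmetric]) (rule ae)
  then have "AE u in ?Q. fst (u i, u j) \<noteq> snd (u i, u j)" by (rule AE_distrD[OF pm])
  then show ?thesis by simp
qed

lemma AE_marks:
  fixes w :: "int^'n"
  assumes "AE u in PiM (UNIV :: nat set) (\<lambda>_. uniform_measure lborel (cell 1 w :: (real^'n) set)). R u"
  shows "AE m in marks lam. R (snd (m w))"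
proof -
  let ?N = "measure_pmf (poisson_pmf (lam * measure lborel (cell 1 w :: (real^'n) set)))"
  let ?Q = "PiM (UNIV :: nat set) (\<lambda>_. uniform_measure lborel (cell 1 w :: (real^'n) set))"
  interpret Q: prob_space ?Q by (rule prob_space_PiM) (rule prob_uniform_cell)
  obtain Z where Z: "Z \<in> null_sets ?Q" "{u \<in> space ?Q. \<not> R u} \<subseteq> Z"
    using assms unfolding eventually_ae_filter by blast
  have "emeasure (?N \<Otimes>\<^sub>M ?Q) (space ?N \<times> Z) = emeasure ?N (space ?N) * emeasure ?Q Z"
    by (rule Q.emeasure_pair_measure_Times) (use Z in auto)
  then have "space ?N \<times> Z \<in> null_sets (?N \<Otimes>\<^sub>M ?Q)"
    using Z(1) by (auto simp: null_sets_def)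
  then have "AE x in ?N \<Otimes>\<^sub>M ?Q. R (snd x)"
    by (rule AE_I') (use Z(2) in \<open>auto simp: space_pair_measure\<close>)
  then have "AE x in cube_law lam w. R (snd x)" unfolding cube_law_def .
  then show ?thesis unfolding marks_def by (intro AE_PiM_component prob_cube_law) auto
qed

lemma AE_simple_marks: "AE m in marks lam. simple_marks (m :: (int^'n) \<Rightarrow> nat \<times> (nat \<Rightarrow> real^'n))"
proof -
  have 1: "AE m in marks lam. snd (m w) i \<in> cell 1 w" for w :: "int^'n" and i
  proof (rule AE_marks)
    have "AE y in uniform_measure lborel (cell 1 w :: (real^'n) set). y \<in> cell 1 w"
      by (rule AE_uniform_measureI) (use cell_sets[of 1 w] in auto)
    then show "AE u in PiM UNIV (\<lambda>_. uniform_measure lborel (cell 1 w :: (real^'n) set)). u i \<in> cell 1 w"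
      by (intro AE_PiM_component prob_uniform_cell) auto
  qed
  have 2: "AE m in marks lam. i < j \<longrightarrow> snd (m w) i \<noteq> snd (m w) j" for w :: "int^'n" and i j
  proof (rule AE_marks)
    have null: "emeasure (uniform_measure lborel (cell 1 w)) {x} = 0" for x :: "real^'n"
    proof -
      have "emeasure lborel (cell 1 w \<inter> {x}) \<le> emeasure lborel {x}" by (rule emeasure_mono) auto
      then have "emeasure lborel (cell 1 w \<inter> {x}) = 0" by simp
      then show ?thesis using cell_sets[of 1 w] by (subst emeasure_uniform_measure) auto
    qed
    show "AE u in PiM UNIV (\<lambda>_. uniform_measure lborel (cell 1 w :: (real^'n) set)). i < j \<longrightarrow> u i \<noteq> u j"
    proof (cases "i < j")
      case True
      then show ?thesis using AE_distinct_coordinates[OF prob_uniform_cell[of w] _ null, of i j] by simp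
    qed simp
  qed
  show ?thesis unfolding simple_marks_def
    by (intro AE_conjI) (simp_all only: AE_all_countable 1 2 simp_thms)
qed

lemma card_configuration:
  fixes A :: "(real^'n) set"
  assumes m: "simple_marks m" and A: "A \<subseteq> region 1 N"
  shows "card (configuration m \<inter> A) = (\<Sum>w\<in>blocks N. card {i \<in> {..<fst (m w)}. snd (m w) i \<in> A})"
proof -
  have cell: "snd (m w) i \<in> cell 1 w" for w i using m unfolding simple_marks_def by blast
  have inj: "inj (snd (m w))" for w
    by (rule linorder_injI) (use m in \<open>auto simp: simple_marks_def\<close>)
  have "configuration m \<inter> A = (\<Union>w\<in>blocks N. snd (m w) ` {i \<in> {..<fst (m w)}. snd (m w) i \<in> A})"
  proof (intro equalityI subsetI)
    fix x assume x: "x \<in> configuration m \<inter> A"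
    then obtain w i where wi: "i < fst (m w)" "x = snd (m w) i" using m unfolding configuration_def by auto
    have "blk 1 x = w" using cell[of w i] wi(2) by (simp add: cell_def)
    then have "w \<in> blocks N" using x A unfolding region_def by blast
    then show "x \<in> (\<Union>w\<in>blocks N. snd (m w) ` {i \<in> {..<fst (m w)}. snd (m w) i \<in> A})" using wi x by blast
  qed (use m in \<open>auto simp: configuration_def\<close>)
  also have "card \<dots> = (\<Sum>w\<in>blocks N. card (snd (m w) ` {i \<in> {..<fst (m w)}. snd (m w) i \<in> A}))"
  proof (rule card_UN_disjoint[OF finite_blocks])
    show "\<forall>w\<in>blocks N. \<forall>w'\<in>blocks N. w \<noteq> w' \<longrightarrow>
      snd (m w) ` {i \<in> {..<fst (m w)}. snd (m w) i \<in> A} \<inter> snd (m w') ` {i \<in> {..<fst (m w')}. snd (m w') i \<in> A} = {}"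
    proof (intro ballI impI equals0I)
      fix w w' x assume ne: "w \<noteq> w'"
        and x: "x \<in> snd (m w) ` {i \<in> {..<fst (m w)}. snd (m w) i \<in> A} \<inter> snd (m w') ` {i \<in> {..<fst (m w')}. snd (m w') i \<in> A}"
      then obtain i i' where "x = snd (m w) i" "x = snd (m w') i'" by blast
      then have "blk 1 x = w" "blk 1 x = w'" using cell[of w i] cell[of w' i'] by (auto simp: cell_def)
      then show False using ne by simp
    qed
  qed auto
  also have "\<dots> = (\<Sum>w\<in>blocks N. card {i \<in> {..<fst (m w)}. snd (m w) i \<in> A})"
    by (intro sum.cong refl card_image inj_on_subset[OF inj]) simp
  finally show ?thesis .
qed

lemma bounded_subset_region:
  fixes A :: "(real^'n) set"
  assumes "bounded A"
  shows "\<exists>N. A \<subseteq> region 1 N"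
proof -
  obtain r where r: "\<forall>x\<in>A. norm x \<le> r" using assms unfolding bounded_iff by (rule exE)
  obtain N :: nat where "r \<le> N" using real_arch_simple by blast
  then have "cball 0 r \<subseteq> (region 1 N :: (real^'n) set)" by (intro cball_subset_region) auto
  moreover have "A \<subseteq> cball 0 r" using r by auto
  ultimately show ?thesis by blast
qed

lemma loc_finite_configuration:
  fixes m :: "(int^'n) \<Rightarrow> nat \<times> (nat \<Rightarrow> real^'n)"
  shows "loc_finite (configuration m)"
  unfolding loc_finite_def
proof
  fix r
  obtain N where N: "cball 0 r \<subseteq> (region 1 N :: (real^'n) set)" using bounded_subset_region[OF bounded_cball] by blast
  show "finite (configuration m \<inter> cball 0 r)"
  proof (cases "simple_marks m")
    case True
    have "configuration m \<inter> cball 0 r \<subseteq> (\<Union>w\<in>blocks N. snd (m w) ` {..<fst (m w)})"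
    proof
      fix x assume x: "x \<in> configuration m \<inter> cball 0 r"
      then obtain w i where wi: "i < fst (m w)" "x = snd (m w) i" using True unfolding configuration_def by auto
      have "snd (m w) i \<in> cell 1 w" using True unfolding simple_marks_def by blast
      then have "blk 1 x = w" using wi(2) by (simp add: cell_def)
      then have "w \<in> blocks N" using x N unfolding region_def by blast
      then show "x \<in> (\<Union>w\<in>blocks N. snd (m w) ` {..<fst (m w)})" using wi by blast
    qed
    then show ?thesis by (rule finite_subset) (simp add: finite_blocks)
  qed (simp add: configuration_def)
qed

lemma measurable_card_configuration:
  fixes A :: "(real^'n) set"
  assumes A: "A \<in> sets lborel" "bounded A"
  shows "(\<lambda>m. card (configuration m \<inter> A)) \<in> measurable (marks lam) (count_space UNIV)"
proof -
  obtain N where N: "A \<subseteq> region 1 N" using bounded_subset_region[OF A(2)] by blast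
  define c where "c w n m = (\<Sum>i<n. if snd (m w) i \<in> A then 1 else 0 :: nat)"
    for w n and m :: "(int^'n) \<Rightarrow> nat \<times> (nat \<Rightarrow> real^'n)"
  have cc: "card {i \<in> {..<fst (m w)}. snd (m w) i \<in> A} = c w (fst (m w)) m" for w m
    unfolding c_def by (subst sum.If_cases) (simp_all add: Int_def)
  have eq: "card (configuration m \<inter> A) = (if simple_marks m then \<Sum>w\<in>blocks N. c w (fst (m w)) m else 0)" for m
  proof (cases "simple_marks m")
    case True
    show ?thesis using card_configuration[OF True N] True unfolding cc by simp
  qed (simp add: configuration_def)
  have ind: "(\<lambda>m. if snd (m w) i \<in> A then 1 else 0 :: nat) \<in> measurable (marks lam) (count_space UNIV)" for w i
  proof (rule measurable_If)
    have "A \<in> sets borel" using A(1) by simp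
    from measurable_sets[OF measurable_mark_point[of w i lam] this]
    have "(\<lambda>m. snd (m w) i) -` A \<inter> space (marks lam) \<in> sets (marks lam)" .
    also have "(\<lambda>m. snd (m w) i) -` A \<inter> space (marks lam) = {m \<in> space (marks lam). snd (m w) i \<in> A}" by auto
    finally show "{m \<in> space (marks lam). snd (m w) i \<in> A} \<in> sets (marks lam)" .
  qed simp_all
  have cm: "(\<lambda>m. c w n m) \<in> measurable (marks lam) (count_space UNIV)" for w n
    unfolding c_def by (rule measurable_nat_sum) (simp, rule ind)
  have "(\<lambda>m. c w (fst (m w)) m) \<in> measurable (marks lam) (count_space UNIV)" for w
    by (rule measurable_compose_countable[where f="\<lambda>n m. c w n m" and g="\<lambda>m. fst (m w)", OF cm measurable_mark_num])
  then have "(\<lambda>m. \<Sum>w\<in>blocks N. c w (fst (m w)) m) \<in> measurable (marks lam) (count_space UNIV)"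
    by (intro measurable_nat_sum finite_blocks)
  then show ?thesis unfolding eq by (rule measurable_If) (simp, rule simple_marks_sets)
qed

text \<open>For simple marks the product over the sets \<open>A j\<close> regroups into a product
  over unit cubes, which are independent. Each cube contributes a compound Poisson factor, and the
  exponents add up to the volumes of the \<open>A j\<close>.\<close>

lemma marks_pgf:
  fixes A :: "'j \<Rightarrow> (real^'n) set"
  assumes lam: "0 < lam" and J: "finite J" and A: "\<And>j. j \<in> J \<Longrightarrow> A j \<in> sets lborel \<and> bounded (A j)"
    and disj: "disjoint_family_on A J" and t: "\<And>j. \<bar>t j\<bar> < 1"
  shows "(\<integral>m. (\<Prod>j\<in>J. t j ^ card (configuration m \<inter> A j)) \<partial>marks lam)
    = (\<Prod>j\<in>J. exp (lam * measure lborel (A j) * (t j - 1)))"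
proof -
  have "bounded (\<Union>j\<in>J. A j)" using J A by blast
  then obtain N where "(\<Union>j\<in>J. A j) \<subseteq> region 1 N" using bounded_subset_region by blast
  then have N: "A j \<subseteq> region 1 N" if "j \<in> J" for j using that by blast
  define \<phi> where "\<phi> x = (\<Prod>j\<in>J. if x \<in> A j then t j else 1)" for x
  have \<phi>m: "\<phi> \<in> borel_measurable borel"
    unfolding \<phi>_def by (intro borel_measurable_prod measurable_If) (use A in auto)
  have \<phi>b: "\<bar>\<phi> x\<bar> \<le> 1" for x
    unfolding \<phi>_def abs_prod by (rule prod_le_1) (use t in \<open>auto intro: less_imp_le\<close>)
  \<comment> \<open>By disjointness at most one factor of \<open>\<phi> x\<close> differs from 1, so
    the product is affine in the indicators and can be integrated term by term.\<close>
  have \<phi>sum: "\<phi> x = 1 + (\<Sum>j\<in>J. (t j - 1) * indicator (A j) x)" for x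
  proof (cases "\<exists>j\<in>J. x \<in> A j")
    case True
    then obtain i where i: "i \<in> J" "x \<in> A i" by blast
    have notin: "x \<notin> A j" if "j \<in> J - {i}" for j
      using disj i that unfolding disjoint_family_on_def by blast
    have "\<phi> x = t i * (\<Prod>j\<in>J - {i}. if x \<in> A j then t j else 1)"
      unfolding \<phi>_def using i by (subst prod.remove[OF J i(1)]) simp
    also have "(\<Prod>j\<in>J - {i}. if x \<in> A j then t j else 1) = 1" using notin by (intro prod.neutral) auto
    finally have l: "\<phi> x = t i" by simp
    have "(\<Sum>j\<in>J. (t j - 1) * indicator (A j) x) = (t i - 1) + (\<Sum>j\<in>J - {i}. (t j - 1) * indicator (A j) x)"
      using i by (subst sum.remove[OF J i(1)]) simp
    also have "(\<Sum>j\<in>J - {i}. (t j - 1) * indicator (A j) x) = 0" using notin by (intro sum.neutral) auto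
    finally show ?thesis using l by simp
  next
    case False
    then have "\<phi> x = 1" unfolding \<phi>_def by (intro prod.neutral) auto
    moreover have "(\<Sum>j\<in>J. (t j - 1) * indicator (A j) x) = 0" using False by (intro sum.neutral) auto
    ultimately show ?thesis by simp
  qed
  define G where "G x = (\<Prod>i<fst x. \<phi> (snd x i))" for x :: "nat \<times> (nat \<Rightarrow> real^'n)"
  have Gm: "G \<in> borel_measurable (cube_law lam w)" for w
    unfolding G_def cube_law_def by (rule measurable_random_prod) (use \<phi>m in \<open>simp cong: measurable_cong_sets\<close>)
  have Gb: "\<bar>G x\<bar> \<le> 1" for x
    unfolding G_def abs_prod by (rule prod_le_1) (use \<phi>b in auto)
  have prodG: "(\<Prod>j\<in>J. t j ^ card (configuration m \<inter> A j)) = (\<Prod>w\<in>blocks N. G (m w))" if m: "simple_marks m" for m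
  proof -
    have "(\<Prod>j\<in>J. t j ^ card (configuration m \<inter> A j))
        = (\<Prod>j\<in>J. \<Prod>w\<in>blocks N. t j ^ card {i \<in> {..<fst (m w)}. snd (m w) i \<in> A j})"
      using card_configuration[OF m N] by (intro prod.cong refl) (simp add: power_sum)
    also have "\<dots> = (\<Prod>w\<in>blocks N. \<Prod>j\<in>J. t j ^ card {i \<in> {..<fst (m w)}. snd (m w) i \<in> A j})" by (rule prod.swap)
    also have "\<dots> = (\<Prod>w\<in>blocks N. G (m w))"
    proof (rule prod.cong[OF refl])
      fix w
      have "G (m w) = (\<Prod>j\<in>J. \<Prod>i<fst (m w). if snd (m w) i \<in> A j then t j else 1)"
        unfolding G_def \<phi>_def by (rule prod.swap)
      also have "\<dots> = (\<Prod>j\<in>J. t j ^ card {i \<in> {..<fst (m w)}. snd (m w) i \<in> A j})"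
        by (intro prod.cong refl) (simp add: prod.If_cases Int_def)
      finally show "(\<Prod>j\<in>J. t j ^ card {i \<in> {..<fst (m w)}. snd (m w) i \<in> A j}) = G (m w)" by simp
    qed
    finally show ?thesis .
  qed
  have cardm: "(\<lambda>m. card (configuration m \<inter> A j)) \<in> measurable (marks lam) (count_space UNIV)" if "j \<in> J" for j
    using measurable_card_configuration A[OF that] by blast
  have "(\<integral>m. (\<Prod>j\<in>J. t j ^ card (configuration m \<inter> A j)) \<partial>marks lam) = (\<integral>m. (\<Prod>w\<in>blocks N. G (m w)) \<partial>marks lam)"
  proof (rule integral_cong_AE)
    show "AE m in marks lam. (\<Prod>j\<in>J. t j ^ card (configuration m \<inter> A j)) = (\<Prod>w\<in>blocks N. G (m w))"
      using AE_simple_marks by (rule AE_mp) (rule AE_I2, use prodG in blast)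
    show "(\<lambda>m. \<Prod>j\<in>J. t j ^ card (configuration m \<inter> A j)) \<in> borel_measurable (marks lam)"
      by (intro borel_measurable_prod measurable_compose[OF cardm]) auto
    show "(\<lambda>m. \<Prod>w\<in>blocks N. G (m w)) \<in> borel_measurable (marks lam)"
    proof (rule borel_measurable_prod)
      fix w
      show "(\<lambda>m. G (m w)) \<in> borel_measurable (marks lam)"
        unfolding marks_def
        by (rule measurable_compose[OF measurable_component_singleton[of w UNIV "cube_law lam"] Gm]) simp
    qed
  qed
  also have "\<dots> = (\<Prod>w\<in>blocks N. \<integral>x. G x \<partial>cube_law lam w)"
    unfolding marks_def by (rule expectation_prod_coordinates[OF prob_cube_law finite_blocks Gm Gb])
  also have "\<dots> = (\<Prod>w\<in>blocks N. exp (\<Sum>j\<in>J. lam * (t j - 1) * measure lborel (A j \<inter> cell 1 w)))"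
  proof (rule prod.cong[OF refl])
    fix w :: "int^'n"
    let ?U = "uniform_measure lborel (cell 1 w :: (real^'n) set)" and ?v = "measure lborel (cell 1 w :: (real^'n) set)"
    interpret U: prob_space ?U by (rule prob_uniform_cell)
    have v: "0 < ?v" by (rule cell_1_measure)
    have "(\<integral>x. G x \<partial>cube_law lam w) = exp (lam * ?v * ((\<integral>x. \<phi> x \<partial>?U) - 1))"
      unfolding G_def cube_law_def
      by (rule poisson_many_pgf) (use prob_uniform_cell lam v \<phi>m \<phi>b in \<open>auto cong: measurable_cong_sets\<close>)
    also have "(\<integral>x. \<phi> x \<partial>?U) = 1 + (\<Sum>j\<in>J. (t j - 1) * measure ?U (A j))"
    proof -
      have int: "integrable ?U (\<lambda>x. (t j - 1) * indicator (A j) x)" if "j \<in> J" for j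
        using A[OF that] by (intro integrable_mult_right U.integrable_const_bound[of _ 1]) (auto simp: indicator_def)
      have "(\<integral>x. \<phi> x \<partial>?U) = (\<integral>x. 1 \<partial>?U) + (\<integral>x. (\<Sum>j\<in>J. (t j - 1) * indicator (A j) x) \<partial>?U)"
        unfolding \<phi>sum by (intro Bochner_Integration.integral_add Bochner_Integration.integrable_sum int) simp_all
      also have "(\<integral>x. (\<Sum>j\<in>J. (t j - 1) * indicator (A j) x) \<partial>?U) = (\<Sum>j\<in>J. \<integral>x. (t j - 1) * indicator (A j) x \<partial>?U)"
        by (rule Bochner_Integration.integral_sum) (rule int)
      also have "\<dots> = (\<Sum>j\<in>J. (t j - 1) * measure ?U (A j))"
        by (intro sum.cong refl) simp
      finally show ?thesis using U.prob_space by simp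
    qed
    also have "lam * ?v * (1 + (\<Sum>j\<in>J. (t j - 1) * measure ?U (A j)) - 1) = (\<Sum>j\<in>J. lam * (t j - 1) * measure lborel (A j \<inter> cell 1 w))"
    proof -
      have "measure ?U (A j) = measure lborel (A j \<inter> cell 1 w) / ?v" if "j \<in> J" for j
        using A[OF that] cell_1_measure[of w] by (subst measure_uniform_measure) (auto simp: Int_commute)
      then show ?thesis using v by (simp add: sum_distrib_left mult_ac)
    qed
    finally show "(\<integral>x. G x \<partial>cube_law lam w) = exp (\<Sum>j\<in>J. lam * (t j - 1) * measure lborel (A j \<inter> cell 1 w))" .
  qed
  also have "\<dots> = exp (\<Sum>w\<in>blocks N. \<Sum>j\<in>J. lam * (t j - 1) * measure lborel (A j \<inter> cell 1 w))"
    by (rule exp_sum[OF finite_blocks, symmetric])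
  also have "(\<Sum>w\<in>blocks N. \<Sum>j\<in>J. lam * (t j - 1) * measure lborel (A j \<inter> cell 1 w))
      = (\<Sum>j\<in>J. lam * measure lborel (A j) * (t j - 1))"
  proof -
    have "(\<Sum>w\<in>blocks N. measure lborel (A j \<inter> cell 1 w)) = measure lborel (A j)" if j: "j \<in> J" for j
    proof -
      have fin: "emeasure lborel (A j \<inter> cell 1 w) \<noteq> \<infinity>" for w
        using emeasure_bounded_finite[of "A j \<inter> cell 1 w"] A[OF j] by (auto simp: bounded_Int less_top[symmetric])
      have "(\<Sum>w\<in>blocks N. measure lborel (A j \<inter> cell 1 w)) = measure lborel (\<Union>w\<in>blocks N. A j \<inter> cell 1 w)"
        by (rule measure_finite_Union[symmetric])
          (use finite_blocks fin A[OF j] cell_sets[of 1] in \<open>auto simp: disjoint_family_on_def cell_def\<close>)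
      also have "(\<Union>w\<in>blocks N. A j \<inter> cell 1 w) = A j" using N[OF j] unfolding region_def cell_def by blast
      finally show ?thesis .
    qed
    then show ?thesis by (subst sum.swap) (simp add: sum_distrib_left[symmetric] mult_ac)
  qed
  also have "exp (\<Sum>j\<in>J. lam * measure lborel (A j) * (t j - 1)) = (\<Prod>j\<in>J. exp (lam * measure lborel (A j) * (t j - 1)))"
    by (rule exp_sum[OF J])
  finally show ?thesis .
qed

lemma marks_joint_law:
  fixes A :: "'j \<Rightarrow> (real^'n) set"
  assumes lam: "0 < lam" and J: "finite J" and A: "\<And>j. j \<in> J \<Longrightarrow> A j \<in> sets lborel \<and> bounded (A j)"
    and disj: "disjoint_family_on A J"
  shows "measure (marks lam) {m \<in> space (marks lam). \<forall>j\<in>J. card (configuration m \<inter> A j) = k j}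
    = (\<Prod>j\<in>J. (lam * measure lborel (A j)) ^ k j / fact (k j) * exp (- (lam * measure lborel (A j))))"
proof -
  interpret M: prob_space "marks lam :: ((int^'n) \<Rightarrow> nat \<times> (nat \<Rightarrow> real^'n)) measure" by (rule prob_marks)
  show ?thesis
    by (rule M.joint_poisson_of_pgf[OF J, where Y="\<lambda>j m. card (configuration m \<inter> A j)" and \<mu>="\<lambda>j. lam * measure lborel (A j)"])
      (use A in \<open>blast intro: measurable_card_configuration\<close>, rule marks_pgf[OF lam J A disj])
qed

text \<open>Image of the marks under \<open>configuration\<close>, with the sigma-algebra generated
  by the counts. The space is restricted to locally finite sets because \<open>is_PPP\<close> asks
  for finite counts at every sample point.\<close>

lemma PPP_exists:
  assumes lam: "0 < lam"
  shows "\<exists>P :: (real^'n) set measure. is_PPP P lam"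
proof -
  let ?M = "marks lam :: ((int^'n) \<Rightarrow> nat \<times> (nat \<Rightarrow> real^'n)) measure"
  interpret M: prob_space ?M by (rule prob_marks)
  define LF where "LF = {\<omega> :: (real^'n) set. loc_finite \<omega>}"
  define G where "G = {{\<omega>\<in>LF. card (\<omega> \<inter> A) = k} | A k. A \<in> sets lborel \<and> bounded A}"
  define N where "N = sigma LF G"
  have G: "G \<subseteq> Pow LF" unfolding G_def by auto
  have spN: "space N = LF" unfolding N_def using G by (rule space_measure_of)
  have seN: "{\<omega>\<in>LF. card (\<omega> \<inter> A) = k} \<in> sets N" if "A \<in> sets lborel" "bounded A" for A k
    unfolding N_def sets_measure_of[OF G] by (rule sigma_sets.Basic) (use that in \<open>auto simp: G_def\<close>)
  have cm: "configuration \<in> measurable ?M N"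
    unfolding N_def
  proof (rule measurable_measure_of[OF G])
    show "configuration \<in> space ?M \<rightarrow> LF" unfolding LF_def using loc_finite_configuration by auto
    fix y assume "y \<in> G"
    then obtain A k where y: "y = {\<omega>\<in>LF. card (\<omega> \<inter> A) = k}" and A: "A \<in> sets lborel" "bounded A"
      unfolding G_def by auto
    have "(\<lambda>m. card (configuration m \<inter> A)) -` {k} \<inter> space ?M \<in> sets ?M"
      by (rule measurable_sets[OF measurable_card_configuration[OF A]]) simp
    also have "(\<lambda>m. card (configuration m \<inter> A)) -` {k} \<inter> space ?M = configuration -` y \<inter> space ?M"
      unfolding y LF_def using loc_finite_configuration by auto
    finally show "configuration -` y \<inter> space ?M \<in> sets ?M" .
  qed
  define P where "P = distr ?M N configuration"
  have spP: "space P = LF" unfolding P_def using spN by simp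
  have P: "prob_space P" unfolding P_def by (rule M.prob_space_distr[OF cm])
  have count: "(\<lambda>\<omega>. card (\<omega> \<inter> A)) \<in> measurable P (count_space UNIV)" if "A \<in> sets lborel" "bounded A" for A
    unfolding measurable_count_space_eq2_countable
  proof (intro conjI ballI)
    fix k
    have "(\<lambda>\<omega>. card (\<omega> \<inter> A)) -` {k} \<inter> space P = {\<omega>\<in>LF. card (\<omega> \<inter> A) = k}" unfolding spP by auto
    then show "(\<lambda>\<omega>. card (\<omega> \<inter> A)) -` {k} \<inter> space P \<in> sets P"
      using seN[OF that] unfolding P_def sets_distr by simp
  qed simp
  have joint: "measure P {\<omega>\<in>space P. \<forall>j\<in>J. card (\<omega> \<inter> A j) = k j}
      = (\<Prod>j\<in>J. (lam * measure lborel (A j)) ^ k j / fact (k j) * exp (- (lam * measure lborel (A j))))"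
    if J: "finite J" and A: "\<And>j. j \<in> J \<Longrightarrow> A j \<in> sets lborel \<and> bounded (A j)" and disj: "disjoint_family_on A J"
    for J :: "nat set" and A k
  proof -
    have "{\<omega>\<in>space P. \<forall>j\<in>J. card (\<omega> \<inter> A j) = k j} \<in> sets P"
    proof (rule sets.sets_Collect_finite_All[OF _ J])
      fix j assume j: "j \<in> J"
      show "{\<omega>\<in>space P. card (\<omega> \<inter> A j) = k j} \<in> sets P"
        using seN[of "A j" "k j"] A[OF j] unfolding spP unfolding P_def sets_distr by simp
    qed
    then have S: "{\<omega>\<in>space P. \<forall>j\<in>J. card (\<omega> \<inter> A j) = k j} \<in> sets N" unfolding P_def sets_distr .
    have "measure P {\<omega>\<in>space P. \<forall>j\<in>J. card (\<omega> \<inter> A j) = k j}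
        = measure ?M (configuration -` {\<omega>\<in>space P. \<forall>j\<in>J. card (\<omega> \<inter> A j) = k j} \<inter> space ?M)"
      unfolding P_def using S unfolding P_def by (rule measure_distr[OF cm])
    also have "configuration -` {\<omega>\<in>space P. \<forall>j\<in>J. card (\<omega> \<inter> A j) = k j} \<inter> space ?M
        = {m \<in> space ?M. \<forall>j\<in>J. card (configuration m \<inter> A j) = k j}"
      unfolding spP LF_def using loc_finite_configuration by auto
    finally show ?thesis using marks_joint_law[OF lam J A disj] by simp
  qed
  have single: "measure P {\<omega>\<in>space P. card (\<omega> \<inter> B) = k}
      = (lam * measure lborel B) ^ k / fact k * exp (- (lam * measure lborel B))"
    if "B \<in> sets lborel" "bounded B" for B k
    using joint[of "{0}" "\<lambda>_. B" "\<lambda>_. k"] that by (simp add: disjoint_family_on_def)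
  have fin: "finite (\<omega> \<inter> A)" if "\<omega> \<in> space P" "bounded A" for \<omega> A
  proof -
    obtain r where "\<forall>x\<in>A. norm x \<le> r" using \<open>bounded A\<close> unfolding bounded_iff by (rule exE)
    then have "\<omega> \<inter> A \<subseteq> \<omega> \<inter> cball 0 r" by auto
    moreover have "finite (\<omega> \<inter> cball 0 r)" using \<open>\<omega> \<in> space P\<close> unfolding spP LF_def loc_finite_def by blast
    ultimately show ?thesis by (rule finite_subset)
  qed
  have indep: "prob_space.indep_vars P (\<lambda>_. count_space UNIV) (\<lambda>j \<omega>. card (\<omega> \<inter> A j)) J"
    if J: "finite J" and A: "\<forall>j\<in>J. A j \<in> sets lborel \<and> bounded (A j)" and disj: "disjoint_family_on A J"
    for J :: "nat set" and A
  proof (rule indep_vars_of_joint_pmf[OF P J])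
    show "(\<lambda>\<omega>. card (\<omega> \<inter> A j)) \<in> measurable P (count_space UNIV)" if "j \<in> J" for j
      using count A that by blast
    fix I k assume I: "I \<subseteq> J"
    have AI: "A j \<in> sets lborel \<and> bounded (A j)" if "j \<in> I" for j using A I that by blast
    have "measure P {\<omega>\<in>space P. \<forall>j\<in>I. card (\<omega> \<inter> A j) = k j}
        = (\<Prod>j\<in>I. (lam * measure lborel (A j)) ^ k j / fact (k j) * exp (- (lam * measure lborel (A j))))"
      by (rule joint[OF finite_subset[OF I J] AI disjoint_family_on_mono[OF I disj]])
    also have "\<dots> = (\<Prod>j\<in>I. measure P {\<omega>\<in>space P. card (\<omega> \<inter> A j) = k j})"
      by (rule prod.cong[OF refl]) (use single AI in simp)
    finally show "measure P {\<omega>\<in>space P. \<forall>j\<in>I. card (\<omega> \<inter> A j) = k j}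
        = (\<Prod>j\<in>I. measure P {\<omega>\<in>space P. card (\<omega> \<inter> A j) = k j})" .
  qed
  have "is_PPP P lam"
    unfolding is_PPP_def
    by (intro conjI ballI allI impI) (fact P | rule fin count single indep; assumption)+
  then show ?thesis ..
qed

section \<open>Strict inequality\<close>

text \<open>Since \<open>lam < t * l\<close>, the ratio of the intensities is at least
  \<open>1 / t ^ 2\<close>, so the loss is at most a factor \<open>t ^ (2 * k)\<close>. With
  \<open>t < 2\<close> the gain stays above its value \<open>c > 1\<close> at intensity
  \<open>2 * l\<close>, and \<open>t\<close> is taken close enough to 1 for
  \<open>t ^ (2 * k) < c\<close>.\<close>

lemma erasure_gain:
  fixes l V :: real and K k :: nat
  assumes l: "0 < l" and V: "0 \<le> V"
  shows "\<exists>t>1. \<forall>lam. l \<le> lam \<longrightarrow> lam < t * l \<longrightarrow>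
    1 \<le> (1 + exp (- (lam * V)) / 2 ^ K) * ((l / t) / lam) ^ k"
proof -
  define c where "c = 1 + exp (- (2 * l * V)) / 2 ^ K"
  have c: "1 < c" unfolding c_def by simp
  have "((\<lambda>t::real. t ^ (2 * k)) \<longlongrightarrow> 1 ^ (2 * k)) (at_right 1)"
    by (rule tendsto_power[OF tendsto_ident_at])
  then have lim: "((\<lambda>t::real. t ^ (2 * k)) \<longlongrightarrow> 1) (at_right 1)" by simp
  have "eventually (\<lambda>t. t ^ (2 * k) < c) (at_right (1::real))"
    by (rule order_tendstoD(2)[OF lim c])
  then obtain b where b: "1 < b" "\<forall>y>1. y < b \<longrightarrow> y ^ (2 * k) < c"
    unfolding eventually_at_right_field by (elim exE conjE) (rule that)
  obtain t where t: "1 < t" "t < min b 2" using dense[of 1 "min b 2"] b(1) by auto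
  have t2: "t < 2" and tc: "t ^ (2 * k) < c" using t b(2) by simp_all
  show ?thesis
  proof (intro exI[of _ t] conjI allI impI)
    fix lam assume lam: "l \<le> lam" "lam < t * l"
    have "t * l \<le> 2 * l" by (rule mult_right_mono) (use t2 l in simp_all)
    then have "lam \<le> 2 * l" using lam by linarith
    then have "lam * V \<le> 2 * l * V" by (rule mult_right_mono[OF _ V])
    then have "exp (- (2 * l * V)) / 2 ^ K \<le> exp (- (lam * V)) / 2 ^ K" by (intro divide_right_mono) simp_all
    then have cl: "c \<le> 1 + exp (- (lam * V)) / 2 ^ K" unfolding c_def by simp
    have "lam * t \<le> (t * l) * t" by (rule mult_right_mono) (use lam t in simp_all)
    then have "1 / t ^ 2 \<le> (l / t) / lam"
      using lam t l by (simp add: divide_simps power2_eq_square mult_ac)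
    then have pw: "(1 / t ^ 2) ^ k \<le> ((l / t) / lam) ^ k" by (rule power_mono) simp
    have "0 < t ^ (2 * k)" using t by simp
    then have "1 \<le> c / t ^ (2 * k)" using tc by simp
    also have "c / t ^ (2 * k) = c * (1 / t ^ 2) ^ k" by (simp add: power_divide power_mult)
    also have "\<dots> \<le> (1 + exp (- (lam * V)) / 2 ^ K) * ((l / t) / lam) ^ k"
    proof (rule mult_mono[OF cl pw])
      show "0 \<le> 1 + exp (- (lam * V)) / 2 ^ K" using cl c by linarith
    qed simp
    finally show "1 \<le> (1 + exp (- (lam * V)) / 2 ^ K) * ((l / t) / lam) ^ k" .
  qed (fact t(1))
qed

theorem theorem3:
  fixes d :: nat and r0 :: real
  assumes "CARD('n::finite) \<ge> 2" and "1 \<le> d" and "d \<le> CARD('n)" and "r0 > 2"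
  shows "lambda_star TYPE('n) d r0 < lambda_face TYPE('n) d"
proof -
  define F where "F = {lam. 0 < lam \<and> (\<exists>P :: (real^'n) set measure. is_PPP P lam \<and>
    0 < measure P {\<Lambda>\<in>space P. face_percolates d \<Lambda>})}"
  have face: "lambda_face TYPE('n) d = (INF lam\<in>F. ereal lam)"
    unfolding lambda_face_def F_def by (rule arg_cong[of _ _ Inf]) (simp only: image_def, blast)
  have star_le: "lambda_star TYPE('n) d r0 \<le> ereal lam"
    if "0 < lam" "is_PPP P lam" "0 < measure P {\<omega>\<in>space P. star_percolates d r0 \<omega>}"
    for lam and P :: "(real^'n) set measure"
    unfolding lambda_star_def by (rule Inf_lower) (use that in blast)
  show ?thesis
  \<comment> \<open>If no intensity gives face percolation, the infimum over the empty set is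
    infinite and finiteness of the star value suffices.\<close>
  proof (cases "F = {}")
    case True
    obtain lam0 where lam0: "0 < lam0"
      "\<forall>(P :: (real^'n) set measure) lam. lam0 \<le> lam \<longrightarrow> is_PPP P lam \<longrightarrow>
        0 < measure P {\<omega>\<in>space P. star_percolates d r0 \<omega>}"
      using star_of_large_intensity[OF assms(1) less_imp_le[OF assms(4)], of d] by (elim exE conjE) (rule that)
    obtain P :: "(real^'n) set measure" where P: "is_PPP P lam0" using PPP_exists[OF lam0(1)] by (rule exE)
    have "lambda_star TYPE('n) d r0 \<le> ereal lam0"
      by (rule star_le[OF lam0(1) P]) (use lam0(2) P in blast)
    also have "\<dots> < lambda_face TYPE('n) d" unfolding face True by (simp add: top_ereal_def)
    finally show ?thesis .
  next
    case False
    define l where "l = Inf F"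
    let ?K1 = "real (card {w :: int^'n. \<forall>i. \<bar>w $ i\<bar> \<le> 2})"
    let ?V1 = "measure lborel (cball (0::real^'n) CARD('n))"
    \<comment> \<open>An intensity violating this bound would make face percolation a null event;
      the bound keeps the infimum \<open>l\<close> away from 0.\<close>
    have F1: "1 / 2 \<le> ?K1 * (lam * ?V1)" if lamF: "lam \<in> F" for lam
    proof (rule ccontr)
      assume "\<not> 1 / 2 \<le> ?K1 * (lam * ?V1)"
      then have s: "?K1 * (lam * ?V1) \<le> 1 / 2" by simp
      obtain P :: "(real^'n) set measure" where P: "is_PPP P lam"
        "0 < measure P {\<Lambda>\<in>space P. face_percolates d \<Lambda>}"
        using lamF unfolding F_def by auto
      have p: "0 \<le> lam" using lamF unfolding F_def by simp
      show False using face_null_small[OF P(1) assms(2) p s] P(2) by simp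
    qed
    obtain e where e: "e \<in> F" using False by blast
    have KV: "0 < ?K1 * ?V1"
    proof -
      have "?K1 * (e * ?V1) = e * (?K1 * ?V1)" by (simp only: mult_ac)
      then have "0 < e * (?K1 * ?V1)" using F1[OF e] by linarith
      then have "?K1 * ?V1 \<noteq> 0" by (metis less_irrefl mult_zero_right)
      moreover have "0 \<le> ?K1 * ?V1" by simp
      ultimately show ?thesis by linarith
    qed
    have low: "1 / 2 / (?K1 * ?V1) \<le> lam" if "lam \<in> F" for lam
      using F1[OF that] KV by (simp add: pos_divide_le_eq mult_ac)
    have bdd: "bdd_below F" using low by (rule bdd_belowI)
    have "1 / 2 / (?K1 * ?V1) \<le> l" unfolding l_def using low False by (intro cInf_greatest)
    moreover have "0 < 1 / 2 / (?K1 * ?V1)" using KV by simp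
    ultimately have l: "0 < l" by linarith
    have lface: "ereal l \<le> lambda_face TYPE('n) d"
      unfolding face l_def by (rule INF_greatest) (simp add: cInf_lower[OF _ bdd])
    \<comment> \<open>The block side is chosen so that a cube counts with diameter at most 1 and the
      bridging range \<open>2 + 3 * (s * CARD('n))\<close> stays within \<open>r0\<close>; this is
      where \<open>r0 > 2\<close> enters.\<close>
    define s where "s = min 1 ((r0 - 2) / 3) / CARD('n)"
    have sc: "s * CARD('n) = min 1 ((r0 - 2) / 3)" unfolding s_def by simp
    have s: "0 < s" unfolding s_def using assms(4) by simp
    have s1: "s * CARD('n) \<le> 1" unfolding sc by simp
    have third: "2 + 3 * x \<le> r0" if "x \<le> (r0 - 2) / 3" for x using that by simp
    have s2: "2 + 3 * (s * CARD('n)) \<le> r0" unfolding sc by (rule third) (rule min.cobounded2)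
    let ?V = "measure lborel (cball (0::real^'n) (s * CARD('n)))"
    obtain t where t: "1 < t" and gain: "\<forall>lam. l \<le> lam \<longrightarrow> lam < t * l \<longrightarrow>
        1 \<le> (1 + exp (- (lam * ?V)) / 2 ^ card {w :: int^'n. \<forall>i. \<bar>w $ i\<bar> \<le> \<lceil>2 / s\<rceil> + 1})
          * ((l / t) / lam) ^ (card {w :: int^'n. \<forall>i. \<bar>w $ i\<bar> \<le> \<lceil>1 / s\<rceil> + 1} * (d + 1))"
      using erasure_gain[OF l measure_nonneg[of lborel "cball (0::real^'n) (s * CARD('n))"],
          of "card {w :: int^'n. \<forall>i. \<bar>w $ i\<bar> \<le> \<lceil>2 / s\<rceil> + 1}"
            "card {w :: int^'n. \<forall>i. \<bar>w $ i\<bar> \<le> \<lceil>1 / s\<rceil> + 1} * (d + 1)"]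
      by (elim exE conjE) (rule that)
    \<comment> \<open>An intensity of \<open>F\<close> is taken within the factor \<open>t\<close>
      of the infimum, which itself need not belong to \<open>F\<close>.\<close>
    have "Inf F < t * l" unfolding l_def[symmetric] using t l by simp
    then obtain lam where lam: "lam \<in> F" "lam < t * l" using cInf_lessD[OF False] by blast
    have ll: "l \<le> lam" unfolding l_def by (rule cInf_lower[OF lam(1) bdd])
    obtain P :: "(real^'n) set measure" where P: "is_PPP P lam"
      "0 < measure P {\<Lambda>\<in>space P. face_percolates d \<Lambda>}" using lam(1) unfolding F_def by auto
    have lt: "0 < l / t" "l / t < l" using t l by (simp_all add: pos_divide_less_eq)
    obtain P' :: "(real^'n) set measure" where P': "is_PPP P' (l / t)" using PPP_exists[OF lt(1)] by (rule exE)
    have "0 < measure P' {\<omega>\<in>space P'. star_percolates d r0 \<omega>}"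
      by (rule star_of_face[OF P(1) P' assms(2) s s1 s2 lt(1) _ _ P(2)]) (use lt ll gain lam(2) in auto)
    then have "lambda_star TYPE('n) d r0 \<le> ereal (l / t)" by (rule star_le[OF lt(1) P'])
    also have "\<dots> < ereal l" using lt by simp
    finally show ?thesis using lface by (rule less_le_trans)
  qed
qed

end
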